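(* Let $\Bbbk$ be a field of characteristic zero, let $U(3)$ and $M_{(0,\Delta)}$ be as defined below, and let $\Delta\in\Bbbk$, $\Delta\neq0$. Then \[ \dim_\Bbbk H^2(U(3),M_{(0,\Delta)})=\begin{cases}1, & \Delta=1,\\ 0, & \Delta\neq 0,1.\end{cases} \]
   Context: A conformal algebra over $\Bbbk$ is a $\Bbbk[\partial]$-module $C$ with a bilinear $\lambda$-product $(a\,{}_{\lambda}\,b)=\sum_{n\ge0}\frac{\lambda^n}{n!}(a\,{}_{(n)}\,b)\in C[\lambda]$ satisfying $(\partial a\,{}_\lambda\, b)=-\lambda(a\,{}_\lambda\, b)$ and $(a\,{}_\lambda\,\partial b)=(\partial+\lambda)(a\,{}_\lambda\, b)$; it is associative if $a\,{}_\lambda(b\,{}_\mu c)=(a\,{}_\lambda b)\,{}_{\lambda+\mu} c$. $U(3)$ is the associative conformal algebra generated by one element $v$ subject to $v\,{}_{(n)}\,v=0$ for $n\ge 3$ and $2\,v\,{}_{(1)}\,v-\partial(v\,{}_{(2)}\,v)=2v$. A left conformal module over an associative conformal algebra $C$ is a $\Bbbk[\partial]$-module $M$ with a bilinear map $a\otimes m\mapsto a\,{}_\lambda m\in M[\lambda]$ satisfying $(\partial a)\,{}_\lambda m=-\lambda(a\,{}_\lambda m)$, $a\,{}_\lambda\,\partial m=(\partial+\lambda)(a\,{}_\lambda m)$, $a\,{}_\lambda(b\,{}_\mu m)=(a\,{}_\lambda b)\,{}_{\lambda+\mu}m$. $M_{(0,\Delta)}=\Bbbk[\partial]u$ with $v\,{}_\lambda\,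 u=(\partial+\Delta\lambda)u$, a conformal $U(3)$-module. Hochschild cohomology: the basic complex $\tilde C^n(C,M)$ ($n\ge1$) consists of maps $\varphi_{\bar\lambda}:C^{\otimes n}\to M[\lambda_1,\dots,\lambda_n]$ with $\varphi_{\bar\lambda}(a_1,\dots,\partial a_i,\dots,a_n)=-\lambda_i\varphi_{\bar\lambda}(a_1,\dots,a_n)$, $\tilde C^0=M$, with differential $(d\varphi)_{\bar\lambda}(a_1,\dots,a_{n+1})=a_1\,{}_{\lambda_1}\varphi_{(\lambda_2,\dots,\lambda_{n+1})}(a_2,\dots,a_{n+1})+\sum_{i=1}^n(-1)^i\varphi_{(\lambda_1,\dots,\lambda_i+\lambda_{i+1},\dots,\lambda_{n+1})}(a_1,\dots,a_i\,{}_{\lambda_i}a_{i+1},\dots,a_{n+1})$ (for $n=0$: $(dm)_\lambda(a)=a\,{}_\lambda m$). $\partial$ acts on $\tilde C^n$ by $(\partial\varphi)_{\bar\lambda}=(\partial+\sum_i\lambda_i)\varphi_{\bar\lambda}$, commuting with $d$; $H^n(C,M)$ is the cohomology of the reduced complex $\tilde C^\bullet(C,M)/\partial\tilde C^\bullet(C,M)$. *)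

theory Defs
  imports "HOL-Computational_Algebra.Polynomial" "HOL-Library.FuncSet"
begin

text \<open>A conformal algebra over the field 'k on a carrier set of type 'c.
  The lambda-product is the generating function
  (a _lambda b) = sum_n lambda^n/n! (a_(n) b); we store the n-products nprod.\<close>

record ('k, 'c) confalg =
  carr  :: "'c set"
  zer   :: 'c
  add   :: "'c \<Rightarrow> 'c \<Rightarrow> 'c"
  smul  :: "'k \<Rightarrow> 'c \<Rightarrow> 'c"
  der   :: "'c \<Rightarrow> 'c"
  nprod :: "nat \<Rightarrow> 'c \<Rightarrow> 'c \<Rightarrow> 'c"

definition csumn :: "('k, 'c) confalg \<Rightarrow> (nat \<Rightarrow> 'c) \<Rightarrow> nat \<Rightarrow> 'c" where
  "csumn C f n = foldr (\<lambda>i acc. add C (f i) acc) [0..<n] (zer C)"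

definition kspace :: "('k::field_char_0, 'c) confalg \<Rightarrow> bool" where
  "kspace C \<longleftrightarrow>
     zer C \<in> carr C \<and>
     (\<forall>x\<in>carr C. \<forall>y\<in>carr C. add C x y \<in> carr C) \<and>
     (\<forall>k. \<forall>x\<in>carr C. smul C k x \<in> carr C) \<and>
     (\<forall>x\<in>carr C. \<forall>y\<in>carr C. \<forall>z\<in>carr C. add C (add C x y) z = add C x (add C y z)) \<and>
     (\<forall>x\<in>carr C. \<forall>y\<in>carr C. add C x y = add C y x) \<and>
     (\<forall>x\<in>carr C. add C (zer C) x = x) \<and>
     (\<forall>x\<in>carr C. \<exists>y\<in>carr C. add C x y = zer C) \<and>
     (\<forall>k. \<forall>x\<in>carr C. \<forall>y\<in>carr C. smul C k (add C x y) = add C (smul C k x) (smul C k y)) \<and>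
     (\<forall>k l. \<forall>x\<in>carr C. smul C (k + l) x = add C (smul C k x) (smul C l x)) \<and>
     (\<forall>k l. \<forall>x\<in>carr C. smul C (k * l) x = smul C k (smul C l x)) \<and>
     (\<forall>x\<in>carr C. smul C 1 x = x)"

text \<open>Associative conformal algebra. The axioms are the coefficient-wise form of
  (d a _lambda b) = -lambda (a _lambda b), (a _lambda d b) = (d + lambda)(a _lambda b),
  a _lambda (b _mu c) = (a _lambda b) _(lambda+mu) c, and (a _lambda b) in C[lambda] (locality).\<close>
definition assoc_confalg :: "('k::field_char_0, 'c) confalg \<Rightarrow> bool" where
  "assoc_confalg C \<longleftrightarrow>
     kspace C \<and>
     (\<forall>x\<in>carr C. der C x \<in> carr C) \<and>
     (\<forall>x\<in>carr C. \<forall>y\<in>carr C. der C (add C x y) = add C (der C x) (der C y)) \<and>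
     (\<forall>k. \<forall>x\<in>carr C. der C (smul C k x) = smul C k (der C x)) \<and>
     (\<forall>n. \<forall>a\<in>carr C. \<forall>b\<in>carr C. nprod C n a b \<in> carr C) \<and>
     (\<forall>n. \<forall>a\<in>carr C. \<forall>b\<in>carr C. \<forall>c\<in>carr C.
        nprod C n (add C a b) c = add C (nprod C n a c) (nprod C n b c) \<and>
        nprod C n a (add C b c) = add C (nprod C n a b) (nprod C n a c)) \<and>
     (\<forall>n k. \<forall>a\<in>carr C. \<forall>b\<in>carr C.
        nprod C n (smul C k a) b = smul C k (nprod C n a b) \<and>
        nprod C n a (smul C k b) = smul C k (nprod C n a b)) \<and>
     (\<forall>a\<in>carr C. \<forall>b\<in>carr C. finite {n. nprod C n a b \<noteq> zer C}) \<and>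
     (\<forall>n. \<forall>a\<in>carr C. \<forall>b\<in>carr C.
        nprod C n (der C a) b = smul C (- of_nat n) (nprod C (n - 1) a b)) \<and>
     (\<forall>n. \<forall>a\<in>carr C. \<forall>b\<in>carr C.
        nprod C n a (der C b) = add C (der C (nprod C n a b)) (smul C (of_nat n) (nprod C (n - 1) a b))) \<and>
     (\<forall>n m. \<forall>a\<in>carr C. \<forall>b\<in>carr C. \<forall>c\<in>carr C.
        nprod C n a (nprod C m b c) =
        csumn C (\<lambda>s. smul C (of_nat (n choose s)) (nprod C (n + m - s) (nprod C s a b) c)) (Suc n))"

definition lprod :: "('k::field_char_0, 'c) confalg \<Rightarrow> 'k \<Rightarrow> 'c \<Rightarrow> 'c \<Rightarrow> 'c" where
  "lprod C l a b = csumn C (\<lambda>n. smul C (l ^ n / fact n) (nprod C n a b))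
                      (LEAST N. \<forall>n\<ge>N. nprod C n a b = zer C)"

definition conf_hom :: "('k, 'c) confalg \<Rightarrow> ('k, 'd) confalg \<Rightarrow> ('c \<Rightarrow> 'd) \<Rightarrow> bool" where
  "conf_hom C D f \<longleftrightarrow>
     (\<forall>a\<in>carr C. f a \<in> carr D) \<and>
     (\<forall>a\<in>carr C. \<forall>b\<in>carr C. f (add C a b) = add D (f a) (f b)) \<and>
     (\<forall>k. \<forall>a\<in>carr C. f (smul C k a) = smul D k (f a)) \<and>
     (\<forall>a\<in>carr C. f (der C a) = der D (f a)) \<and>
     (\<forall>n. \<forall>a\<in>carr C. \<forall>b\<in>carr C. f (nprod C n a b) = nprod D n (f a) (f b))"

definition U3_rel :: "('k::field_char_0, 'c) confalg \<Rightarrow> 'c \<Rightarrow> bool" where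
  "U3_rel C v \<longleftrightarrow> v \<in> carr C \<and> (\<forall>n\<ge>3. nprod C n v v = zer C) \<and>
     add C (smul C 2 (nprod C 1 v v)) (smul C (-1) (der C (nprod C 2 v v))) = smul C 2 v"

definition generated_by :: "('k, 'c) confalg \<Rightarrow> 'c \<Rightarrow> bool" where
  "generated_by C v \<longleftrightarrow>
     (\<forall>S. S \<subseteq> carr C \<and> v \<in> S \<and> zer C \<in> S \<and>
          (\<forall>x\<in>S. \<forall>y\<in>S. add C x y \<in> S) \<and> (\<forall>k. \<forall>x\<in>S. smul C k x \<in> S) \<and>
          (\<forall>x\<in>S. der C x \<in> S) \<and> (\<forall>n. \<forall>x\<in>S. \<forall>y\<in>S. nprod C n x y \<in> S)
          \<longrightarrow> S = carr C)"

definition is_U3 :: "('k::field_char_0, 'c) confalg \<Rightarrow> 'c \<Rightarrow> bool" where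
  "is_U3 C v \<longleftrightarrow> assoc_confalg C \<and> U3_rel C v \<and> generated_by C v \<and>
     (\<forall>(D :: ('k, nat \<Rightarrow> 'k) confalg) w. assoc_confalg D \<and> U3_rel D w \<longrightarrow>
        (\<exists>f. conf_hom C D f \<and> f v = w))"

section \<open>Conformal modules on M = k[d] (represented as 'k poly, d = multiplication by X)\<close>

abbreviation polyX :: "'k::comm_ring_1 poly" where "polyX \<equiv> [:0, 1:]"

definition conf_module :: "('k::field_char_0, 'c) confalg \<Rightarrow> (nat \<Rightarrow> 'c \<Rightarrow> 'k poly \<Rightarrow> 'k poly) \<Rightarrow> bool" where
  "conf_module C act \<longleftrightarrow>
     (\<forall>n. \<forall>a\<in>carr C. \<forall>m p. act n a (m + p) = act n a m + act n a p) \<and>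
     (\<forall>n k. \<forall>a\<in>carr C. \<forall>m. act n a (smult k m) = smult k (act n a m)) \<and>
     (\<forall>n. \<forall>a\<in>carr C. \<forall>b\<in>carr C. \<forall>m. act n (add C a b) m = act n a m + act n b m) \<and>
     (\<forall>n k. \<forall>a\<in>carr C. \<forall>m. act n (smul C k a) m = smult k (act n a m)) \<and>
     (\<forall>a\<in>carr C. \<forall>m. finite {n. act n a m \<noteq> 0}) \<and>
     (\<forall>n. \<forall>a\<in>carr C. \<forall>m. act n (der C a) m = smult (- of_nat n) (act (n - 1) a m)) \<and>
     (\<forall>n. \<forall>a\<in>carr C. \<forall>m. act n a (polyX * m) = polyX * act n a m + smult (of_nat n) (act (n - 1) a m)) \<and>
     (\<forall>n m. \<forall>a\<in>carr C. \<forall>b\<in>carr C. \<forall>p.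
        act n a (act m b p) = (\<Sum>s\<le>n. smult (of_nat (n choose s)) (act (n + m - s) (nprod C s a b) p)))"

text \<open>M_(0,Delta): v _lambda u = (d + Delta lambda) u, with u = 1\<close>
definition M0Delta_action :: "(nat \<Rightarrow> 'c \<Rightarrow> 'k::field_char_0 poly \<Rightarrow> 'k poly) \<Rightarrow> 'c \<Rightarrow> 'k \<Rightarrow> bool" where
  "M0Delta_action act v \<Delta> \<longleftrightarrow>
     act 0 v 1 = polyX \<and> act 1 v 1 = [:\<Delta>:] \<and> (\<forall>n\<ge>2. act n v 1 = 0)"

definition lact :: "(nat \<Rightarrow> 'c \<Rightarrow> 'k::field_char_0 poly \<Rightarrow> 'k poly) \<Rightarrow> 'k \<Rightarrow> 'c \<Rightarrow> 'k poly \<Rightarrow> 'k poly" where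
  "lact act l a m = (\<Sum>n\<in>{n. act n a m \<noteq> 0}. smult (l ^ n / fact n) (act n a m))"

text \<open>Elements of M[lambda_1..lambda_n] = k[d, lambda_1..lambda_n] are represented by the
  polynomial functions they induce (k is infinite, so this is faithful).\<close>
definition polyfun :: "nat \<Rightarrow> ('k::field_char_0 list \<Rightarrow> 'k poly) \<Rightarrow> bool" where
  "polyfun n g \<longleftrightarrow> (\<exists>(N::nat) (c :: (nat \<Rightarrow> nat) \<Rightarrow> 'k poly). \<forall>ls. length ls = n \<longrightarrow>
      g ls = (\<Sum>e\<in>({..<n} \<rightarrow>\<^sub>E {..<N}). smult (\<Prod>i<n. (ls ! i) ^ (e i)) (c e)))"

type_synonym ('c, 'k) cochain = "'c list \<Rightarrow> 'k list \<Rightarrow> 'k poly"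

definition cochain :: "('k::field_char_0, 'c) confalg \<Rightarrow> nat \<Rightarrow> ('c, 'k) cochain \<Rightarrow> bool" where
  "cochain C n \<phi> \<longleftrightarrow>
     (\<forall>as ls. \<not> (length as = n \<and> set as \<subseteq> carr C \<and> length ls = n) \<longrightarrow> \<phi> as ls = 0) \<and>
     (\<forall>as. length as = n \<and> set as \<subseteq> carr C \<longrightarrow> polyfun n (\<phi> as)) \<and>
     (\<forall>as i x y. length as = n \<and> set as \<subseteq> carr C \<and> i < n \<and> x \<in> carr C \<and> y \<in> carr C \<longrightarrow>
        (\<forall>ls. \<phi> (as[i := add C x y]) ls = \<phi> (as[i := x]) ls + \<phi> (as[i := y]) ls)) \<and>
     (\<forall>as i k x. length as = n \<and> set as \<subseteq> carr C \<and> i < n \<and> x \<in> carr C \<longrightarrow>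
        (\<forall>ls. \<phi> (as[i := smul C k x]) ls = smult k (\<phi> (as[i := x]) ls))) \<and>
     (\<forall>as i x. length as = n \<and> set as \<subseteq> carr C \<and> i < n \<and> x \<in> carr C \<longrightarrow>
        (\<forall>ls. length ls = n \<longrightarrow> \<phi> (as[i := der C x]) ls = smult (- (ls ! i)) (\<phi> (as[i := x]) ls)))"

definition cdel :: "('c, 'k::field_char_0) cochain \<Rightarrow> ('c, 'k) cochain" where
  "cdel \<phi> = (\<lambda>as ls. polyX * \<phi> as ls + smult (sum_list ls) (\<phi> as ls))"

definition mergeC :: "('k::field_char_0, 'c) confalg \<Rightarrow> 'k list \<Rightarrow> nat \<Rightarrow> 'c list \<Rightarrow> 'c list" where
  "mergeC C ls j as = take j as @ [lprod C (ls ! j) (as ! j) (as ! Suc j)] @ drop (Suc (Suc j)) as"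

definition mergeL :: "'k::field_char_0 list \<Rightarrow> nat \<Rightarrow> 'k list" where
  "mergeL ls j = take j ls @ [ls ! j + ls ! Suc j] @ drop (Suc (Suc j)) ls"

text \<open>Hochschild differential C^n -> C^(n+1), n >= 1 (positions are 0-indexed)\<close>
definition hdiff :: "('k::field_char_0, 'c) confalg \<Rightarrow> (nat \<Rightarrow> 'c \<Rightarrow> 'k poly \<Rightarrow> 'k poly) \<Rightarrow> nat
                       \<Rightarrow> ('c, 'k) cochain \<Rightarrow> ('c, 'k) cochain" where
  "hdiff C act n \<phi> = (\<lambda>as ls.
     if length as = Suc n \<and> set as \<subseteq> carr C \<and> length ls = Suc n then
       lact act (hd ls) (hd as) (\<phi> (tl as) (tl ls)) +
       (\<Sum>j<n. smult ((-1) ^ Suc j) (\<phi> (mergeC C ls j as) (mergeL ls j)))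
     else 0)"

text \<open>preimages in C^n of the cocycles of the reduced complex: d phi in d C^(n+1)\<close>
definition red_cocycles :: "('k::field_char_0, 'c) confalg \<Rightarrow> (nat \<Rightarrow> 'c \<Rightarrow> 'k poly \<Rightarrow> 'k poly) \<Rightarrow> nat
                              \<Rightarrow> ('c, 'k) cochain set" where
  "red_cocycles C act n = {\<phi>. cochain C n \<phi> \<and>
      (\<exists>\<chi>. cochain C (Suc n) \<chi> \<and> hdiff C act n \<phi> = cdel \<chi>)}"

text \<open>preimages in C^(n+1) of the coboundaries d(C^n) of the reduced complex\<close>
definition red_coboundaries :: "('k::field_char_0, 'c) confalg \<Rightarrow> (nat \<Rightarrow> 'c \<Rightarrow> 'k poly \<Rightarrow> 'k poly) \<Rightarrow> nat
                              \<Rightarrow> ('c, 'k) cochain set" where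
  "red_coboundaries C act n = {\<lambda>as ls. hdiff C act n \<psi> as ls + cdel \<chi> as ls | \<psi> \<chi>.
      cochain C n \<psi> \<and> cochain C (Suc n) \<chi>}"

definition quot_dim_is :: "('x \<Rightarrow> 'y \<Rightarrow> 'k::field_char_0 poly) set \<Rightarrow> ('x \<Rightarrow> 'y \<Rightarrow> 'k poly) set \<Rightarrow> nat \<Rightarrow> bool" where
  "quot_dim_is Z B n \<longleftrightarrow> (\<exists>S. finite S \<and> card S = n \<and> S \<subseteq> Z \<and>
     (\<forall>c. (\<lambda>x y. \<Sum>s\<in>S. smult (c s) (s x y)) \<in> B \<longrightarrow> (\<forall>s\<in>S. c s = 0)) \<and>
     (\<forall>\<phi>\<in>Z. \<exists>c. (\<lambda>x y. \<phi> x y - (\<Sum>s\<in>S. smult (c s) (s x y))) \<in> B))"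

text \<open>H^2(C, M) = (Z^2 / dC^2) / ((dC^1 + dC^2) / dC^2), i.e. Z^2 / (dC^1 + dC^2)\<close>
definition H2_dim_is :: "('k::field_char_0, 'c) confalg \<Rightarrow> (nat \<Rightarrow> 'c \<Rightarrow> 'k poly \<Rightarrow> 'k poly) \<Rightarrow> nat \<Rightarrow> bool" where
  "H2_dim_is C act n \<longleftrightarrow> quot_dim_is (red_cocycles C act 2) (red_coboundaries C act 1) n"

end

theory Submission
  imports Defs
begin

text \<open>
  A reduced 2-cocycle of \<open>U(3)\<close> with values in \<open>M\<close> is a null extension \<open>0 \<rightarrow> M \<rightarrow> E \<rightarrow> U(3) \<rightarrow> 0\<close>
  split over \<open>k[\<partial>]\<close>, and by the universal property it is a coboundary as soon as some lift
  \<open>v + q\<close> of the generator satisfies the relations of \<open>U(3)\<close> in \<open>E\<close>. The coefficients at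
  \<open>\<partial>\<^sup>0\<close> of the associativity condition on \<open>(v, v, v)\<close> already determine the products of \<open>v\<close> with itself
  up to the choice of such a \<open>q\<close>; because \<open>\<Delta> \<noteq> 0\<close>, what is left is a single
  constant in the relation \<open>2 v\<^bsub>(1)\<^esub> v - \<partial>(v\<^bsub>(2)\<^esub> v) = 2 v\<close>. A constant term of \<open>q\<close> changes it by a multiple of
  \<open>\<Delta> - 1\<close>, so it can be removed unless \<open>\<Delta> = 1\<close>.

  For \<open>\<Delta> = 1\<close> the cocycle \<open>(a, b) \<mapsto> a\<^sup>1 \<tau>(b)\<close> realizes the remaining constant, where
  \<open>\<tau> : U(3) \<rightarrow> M\<close> is the module map with \<open>v \<mapsto> u\<close> and \<open>a\<^sup>1\<close> is the \<open>\<epsilon>\<close>-linear part of the action of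
  \<open>a\<close> on the deformation \<open>\<Delta> = 1 + \<epsilon>\<close> of \<open>M\<close>.
\<close>

section \<open>Associative conformal algebras and the universal property\<close>

text \<open>No basis of U(3) enters: maps out of U(3) come from the universal property, equalities
  from generation by \<open>v\<close>. The differential has no term in which the last argument acts,
  so in the extension elements of \<open>M\<close> annihilate everything to their right. Modulo
  \<partial> + \<lambda>_1 + \<lambda>_2 a 2-cochain is its restriction to \<lambda>_2 = -\<partial>
  - \<lambda>_1, which is a family of n-products, and the reduced cocycle condition becomes
  associativity with no error term. Constant terms suffice because v_\<lambda> p(\<partial>)u =
  p(\<partial> + \<lambda>)(\<partial> + \<Delta>\<lambda>)u reduces to \<Delta>\<lambda>
  p(\<lambda>)u at \<partial> = 0, which loses no coefficient of p. The class at \<Delta> = 1 arises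
  because the formula for v_\<lambda> u respects the relations of U(3) for every \<Delta>, so that
  it can be differentiated in \<Delta>, whereas the relation allows the module map v -> u only if 2
  \<Delta> = 2.\<close>

locale assoc_conf =
  fixes C :: "('k::field_char_0, 'c) confalg"
  assumes ac: "assoc_confalg C"
begin

lemma kspace: "kspace C"
  using ac unfolding assoc_confalg_def by (rule conjunct1)

lemmas vspace_axioms = kspace[unfolded kspace_def]
lemmas conf_axioms = ac[unfolded assoc_confalg_def]

lemmas
  zer_in [simp] = vspace_axioms[THEN conjunct1, rule_format]
  and add_in [simp] = vspace_axioms[THEN conjunct2, THEN conjunct1, rule_format]
  and smul_in [simp] = vspace_axioms[THEN conjunct2, THEN conjunct2, THEN conjunct1, rule_format]
  and add_assoc = vspace_axioms[THEN conjunct2, THEN conjunct2, THEN conjunct2, THEN conjunct1,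
    rule_format]
  and add_comm = vspace_axioms[THEN conjunct2, THEN conjunct2, THEN conjunct2, THEN conjunct2,
    THEN conjunct1, rule_format]
  and add_zer_left [simp] = vspace_axioms[THEN conjunct2, THEN conjunct2, THEN conjunct2, THEN
    conjunct2, THEN conjunct2, THEN conjunct1, rule_format]
  and add_inverse = vspace_axioms[THEN conjunct2, THEN conjunct2, THEN conjunct2, THEN conjunct2,
    THEN conjunct2, THEN conjunct2, THEN conjunct1, rule_format]
  and smul_add = vspace_axioms[THEN conjunct2, THEN conjunct2, THEN conjunct2, THEN conjunct2,
    THEN conjunct2, THEN conjunct2, THEN conjunct2, THEN conjunct1, rule_format]
  and smul_plus = vspace_axioms[THEN conjunct2, THEN conjunct2, THEN conjunct2, THEN conjunct2,
    THEN conjunct2, THEN conjunct2, THEN conjunct2, THEN conjunct2, THEN conjunct1, rule_format]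
  and smul_mult = vspace_axioms[THEN conjunct2, THEN conjunct2, THEN conjunct2, THEN conjunct2,
    THEN conjunct2, THEN conjunct2, THEN conjunct2, THEN conjunct2, THEN conjunct2, THEN
    conjunct1, rule_format]
  and smul_one [simp] = vspace_axioms[THEN conjunct2, THEN conjunct2, THEN conjunct2, THEN
    conjunct2, THEN conjunct2, THEN conjunct2, THEN conjunct2, THEN conjunct2, THEN conjunct2,
    THEN conjunct2, rule_format]

lemmas
  der_in [simp] = conf_axioms[THEN conjunct2, THEN conjunct1, rule_format]
  and der_add = conf_axioms[THEN conjunct2, THEN conjunct2, THEN conjunct1, rule_format]
  and der_smul = conf_axioms[THEN conjunct2, THEN conjunct2, THEN conjunct2, THEN conjunct1,
    rule_format]
  and nprod_in [simp] = conf_axioms[THEN conjunct2, THEN conjunct2, THEN conjunct2, THEN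
    conjunct2, THEN conjunct1, rule_format]
  and nprod_add = conf_axioms[THEN conjunct2, THEN conjunct2, THEN conjunct2, THEN conjunct2, THEN
    conjunct2, THEN conjunct1, rule_format]
  and nprod_smul = conf_axioms[THEN conjunct2, THEN conjunct2, THEN conjunct2, THEN conjunct2,
    THEN conjunct2, THEN conjunct2, THEN conjunct1, rule_format]
  and nprod_finite = conf_axioms[THEN conjunct2, THEN conjunct2, THEN conjunct2, THEN conjunct2,
    THEN conjunct2, THEN conjunct2, THEN conjunct2, THEN conjunct1, rule_format]
  and nprod_der_left = conf_axioms[THEN conjunct2, THEN conjunct2, THEN conjunct2, THEN conjunct2,
    THEN conjunct2, THEN conjunct2, THEN conjunct2, THEN conjunct2, THEN conjunct1, rule_format]
  and nprod_der_right = conf_axioms[THEN conjunct2, THEN conjunct2, THEN conjunct2, THEN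
    conjunct2, THEN conjunct2, THEN conjunct2, THEN conjunct2, THEN conjunct2, THEN conjunct2,
    THEN conjunct1, rule_format]
  and nprod_assoc = conf_axioms[THEN conjunct2, THEN conjunct2, THEN conjunct2, THEN conjunct2,
    THEN conjunct2, THEN conjunct2, THEN conjunct2, THEN conjunct2, THEN conjunct2, THEN
    conjunct2, rule_format]

lemma eq_zer_if_add_eq:
  assumes "x \<in> carr C" "y \<in> carr C" "add C x y = x"
  shows "y = zer C"
proof -
  obtain z where z: "z \<in> carr C" "add C x z = zer C" using add_inverse assms(1) by blast
  have "add C z (add C x y) = add C (add C z x) y" using assms z by (simp add: add_assoc)
  then show ?thesis using assms z by (simp add: add_comm[of z x])
qed

lemma smul_zero [simp]: "x \<in> carr C \<Longrightarrow> smul C 0 x = zer C"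
  using smul_plus[of x 0 0] by (intro eq_zer_if_add_eq[of "smul C 0 x"]) auto

lemma smul_zer [simp]: "smul C k (zer C) = zer C"
  using smul_mult[of "zer C" k 0] by simp

end

lemma csumn_0: "csumn C f 0 = zer C"
  by (simp add: csumn_def)

text \<open>\<open>csumn\<close> folds from the right, while inductions on the upper bound split off
  the last summand; moving the start value out of the fold reconciles the two.\<close>

lemma foldr_add_shift:
  assumes "assoc_conf C" "\<And>i. i \<in> set xs \<Longrightarrow> f i \<in> carr C" "y \<in> carr C"
  shows "foldr (\<lambda>i acc. add C (f i) acc) xs y =
         add C (foldr (\<lambda>i acc. add C (f i) acc) xs (zer C)) y \<and>
         foldr (\<lambda>i acc. add C (f i) acc) xs (zer C) \<in> carr C"
proof -
  interpret assoc_conf C by fact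
  show ?thesis using assms(2,3) by (induction xs) (auto simp: add_assoc)
qed

context assoc_conf begin

lemma csumn_Suc:
  assumes "\<And>i. i \<le> n \<Longrightarrow> f i \<in> carr C"
  shows "csumn C f (Suc n) = add C (csumn C f n) (f n)"
  using foldr_add_shift[OF assoc_conf_axioms, of "[0..<n]" f "f n"] assms
  by (simp add: csumn_def add_comm[of _ "zer C"])

lemma csumn_in [simp]: "(\<And>i. i < n \<Longrightarrow> f i \<in> carr C) \<Longrightarrow> csumn C f n \<in> carr C"
  by (induction n) (auto simp: csumn_Suc csumn_0)

lemma csumn_hom:
  assumes "\<And>i. i < n \<Longrightarrow> f i \<in> carr C" "L (zer C) = (0::'a::comm_monoid_add)"
    and "\<And>x y. x \<in> carr C \<Longrightarrow> y \<in> carr C \<Longrightarrow> L (add C x y) = L x + L y"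
  shows "L (csumn C f n) = (\<Sum>i<n. L (f i))"
  using assms(1) by (induction n) (simp_all add: assms(2,3) csumn_Suc csumn_0)

end

section \<open>Transport of structure along injections, and maps out of U(3)\<close>

lemma csumn_embed:
  assumes cl: "zer B \<in> carr B" "\<And>x y. x \<in> carr B \<Longrightarrow> y \<in> carr B \<Longrightarrow> add B x y \<in> carr B"
    and h: "h (zer B) = zer D"
      "\<And>x y. x \<in> carr B \<Longrightarrow> y \<in> carr B \<Longrightarrow> h (add B x y) = add D (h x) (h y)"
    and f: "\<And>i. i < n \<Longrightarrow> f i \<in> carr B"
  shows "csumn B f n \<in> carr B \<and> h (csumn B f n) = csumn D (\<lambda>i. h (f i)) n"
proof -
  have "foldr (\<lambda>i acc. add B (f i) acc) xs (zer B) \<in> carr B \<and>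
        h (foldr (\<lambda>i acc. add B (f i) acc) xs (zer B)) =
        foldr (\<lambda>i acc. add D (h (f i)) acc) xs (zer D)" if "set xs \<subseteq> {..<n}" for xs
    using that by (induction xs) (auto simp: cl h f)
  from this[of "[0..<n]"] show ?thesis by (simp add: csumn_def atLeast0LessThan)
qed

text \<open>Apart from inverses and locality, the axioms are closure conditions and equations, and
  an injection reflects equations. Inverses come from the scalar -1; locality holds because
  \<open>h\<close> sends only zero to zero.\<close>

lemma assoc_confalg_embed:
  fixes B :: "('k::field_char_0, 'b) confalg" and D :: "('k, 'd) confalg"
  assumes D: "assoc_confalg D" and hom: "conf_hom B D h" and inj: "inj_on h (carr B)"
    and zero: "h (zer B) = zer D"
    and cl: "zer B \<in> carr B" "\<And>x y. x \<in> carr B \<Longrightarrow> y \<in> carr B \<Longrightarrow> add B x y \<in> carr B"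
      "\<And>k x. x \<in> carr B \<Longrightarrow> smul B k x \<in> carr B" "\<And>x. x \<in> carr B \<Longrightarrow> der B x \<in> carr B"
      "\<And>n x y. x \<in> carr B \<Longrightarrow> y \<in> carr B \<Longrightarrow> nprod B n x y \<in> carr B"
  shows "assoc_confalg B"
proof -
  interpret D: assoc_conf D by unfold_locales (rule D)
  have h [simp]: "\<And>x. x \<in> carr B \<Longrightarrow> h x \<in> carr D"
    "\<And>x y. x \<in> carr B \<Longrightarrow> y \<in> carr B \<Longrightarrow> h (add B x y) = add D (h x) (h y)"
    "\<And>k x. x \<in> carr B \<Longrightarrow> h (smul B k x) = smul D k (h x)"
    "\<And>x. x \<in> carr B \<Longrightarrow> h (der B x) = der D (h x)"
    "\<And>n x y. x \<in> carr B \<Longrightarrow> y \<in> carr B \<Longrightarrow> h (nprod B n x y) = nprod D n (h x) (h y)"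
    using hom by (auto simp: conf_hom_def)
  note [simp] = cl zero
  have eqI: "x = y" if "h x = h y" "x \<in> carr B" "y \<in> carr B" for x y
    using inj that by (auto dest: inj_onD)
  have inv: "\<exists>y\<in>carr B. add B x y = zer B" if "x \<in> carr B" for x
  proof
    show "add B x (smul B (-1) x) = zer B"
      using that D.smul_plus[of "h x" 1 "-1"] by (intro eqI) auto
  qed (use that in simp)
  have ks: "kspace B"
    unfolding kspace_def
  proof (intro conjI ballI allI inv; (assumption | rule cl)?)
    fix x y z assume "x \<in> carr B" "y \<in> carr B" "z \<in> carr B"
    then show "add B (add B x y) z = add B x (add B y z)"
      by (intro eqI) (simp_all add: D.add_assoc)
  next
    fix x y assume "x \<in> carr B" "y \<in> carr B"
    then show "add B x y = add B y x"
      by (intro eqI) (simp_all add: D.add_comm)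
  qed (assumption | (rule eqI; simp add: D.smul_add D.smul_plus D.smul_mult))+
  have fin: "finite {n. nprod B n a b \<noteq> zer B}" if "a \<in> carr B" "b \<in> carr B" for a b
    by (rule finite_subset[OF _ D.nprod_finite[of "h a" "h b"]])
      (use that eqI[of "nprod B _ a b" "zer B"] in auto)
  have assoc: "nprod B n a (nprod B m b c) =
        csumn B (\<lambda>s. smul B (of_nat (n choose s)) (nprod B (n + m - s) (nprod B s a b) c)) (Suc n)"
    (is "_ = csumn B ?f _")
    if "a \<in> carr B" "b \<in> carr B" "c \<in> carr B" for n m a b c
  proof (rule eqI)
    have *: "csumn B ?f (Suc n) \<in> carr B \<and> h (csumn B ?f (Suc n)) = csumn D (\<lambda>i. h (?f i)) (Suc n)"
      by (rule csumn_embed) (use that in auto)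
    then show "csumn B ?f (Suc n) \<in> carr B" by blast
    show "h (nprod B n a (nprod B m b c)) = h (csumn B ?f (Suc n))"
      unfolding conjunct2[OF *] using that by (simp add: D.nprod_assoc)
  qed (use that in simp)
  show ?thesis
    unfolding assoc_confalg_def
  proof (intro conjI ballI allI ks fin assoc; (assumption | rule cl)?; (assumption | rule cl)?)
    show "der B (add B x y) = add B (der B x) (der B y)"
      if "x \<in> carr B" "y \<in> carr B" for x y
      by (rule eqI) (use that in \<open>simp_all add: D.der_add\<close>)
    show "der B (smul B k x) = smul B k (der B x)" if "x \<in> carr B" for k x
      by (rule eqI) (use that in \<open>simp_all add: D.der_smul\<close>)
    fix n k x y z assume xyz: "x \<in> carr B" "y \<in> carr B" "z \<in> carr B"
    show "nprod B n (add B x y) z = add B (nprod B n x z) (nprod B n y z)"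
      "nprod B n x (add B y z) = add B (nprod B n x y) (nprod B n x z)"
      by (rule eqI; use xyz in \<open>simp add: D.nprod_add\<close>)+
  next
    fix n k x y assume xy: "x \<in> carr B" "y \<in> carr B"
    show "nprod B n (smul B k x) y = smul B k (nprod B n x y)"
      "nprod B n x (smul B k y) = smul B k (nprod B n x y)"
      by (rule eqI; use xy in \<open>simp add: D.nprod_smul\<close>)+
    show "nprod B n (der B x) y = smul B (- of_nat n) (nprod B (n - 1) x y)"
      by (rule eqI) (use xy in \<open>simp_all add: D.nprod_der_left del: One_nat_def\<close>)
    show "nprod B n x (der B y) = add B (der B (nprod B n x y)) (smul B (of_nat n) (nprod B (n - 1) x y))"
      by (rule eqI) (use xy in \<open>simp_all add: D.nprod_der_right del: One_nat_def\<close>)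
  qed
qed

text \<open>Formal expressions in one generator. They describe the subalgebra generated by an
  element independently of the type of its carrier, and they can be coded by finite lists of
  scalars.\<close>

datatype 'k tm = Gen | Zer | Add "'k tm" "'k tm" | Smul 'k "'k tm" | Der "'k tm"
  | Nprod nat "'k tm" "'k tm"

primrec tm_eval :: "('k, 'c) confalg \<Rightarrow> 'c \<Rightarrow> 'k tm \<Rightarrow> 'c" where
  "tm_eval D w Gen = w"
| "tm_eval D w Zer = zer D"
| "tm_eval D w (Add s t) = add D (tm_eval D w s) (tm_eval D w t)"
| "tm_eval D w (Smul k t) = smul D k (tm_eval D w t)"
| "tm_eval D w (Der t) = der D (tm_eval D w t)"
| "tm_eval D w (Nprod n s t) = nprod D n (tm_eval D w s) (tm_eval D w t)"

primrec tm_code :: "'k::field_char_0 tm \<Rightarrow> 'k list" where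
  "tm_code Gen = [0]"
| "tm_code Zer = [1]"
| "tm_code (Add s t) = 2 # tm_code s @ tm_code t"
| "tm_code (Smul k t) = 3 # k # tm_code t"
| "tm_code (Der t) = 4 # tm_code t"
| "tm_code (Nprod n s t) = 5 # of_nat n # tm_code s @ tm_code t"

text \<open>Polish notation: the first entry fixes the constructor, hence how to read on.
  Characteristic zero keeps the tags 0 to 5 and the indices \<open>of_nat n\<close>
  distinct.\<close>

lemma tm_code_prefix_free:
  "tm_code s @ xs = tm_code t @ ys \<Longrightarrow> s = t \<and> xs = ys"
proof (induction s arbitrary: t xs ys)
  case Gen then show ?case by (cases t) auto
next
  case Zer then show ?case by (cases t) auto
next
  case (Add s1 s2)
  from Add.prems show ?case by (cases t) (auto dest!: Add.IH)
next
  case (Smul k s)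
  from Smul.prems show ?case by (cases t) (auto dest!: Smul.IH)
next
  case (Der s)
  from Der.prems show ?case by (cases t) (auto dest!: Der.IH)
next
  case (Nprod n s1 s2)
  from Nprod.prems show ?case by (cases t) (auto dest!: Nprod.IH)
qed

lemma ex_inj_tm: "\<exists>f :: 'k::field_char_0 tm \<Rightarrow> nat \<Rightarrow> 'k. inj f"
proof -
  \<comment> \<open>Entry 0 records the length, since values past the end of a list carry no
    information.\<close>
  define pad where "pad xs = (\<lambda>i. if i = 0 then of_nat (length xs) else xs ! (i - 1))" for xs :: "'k list"
  have "inj pad"
  proof (rule injI)
    fix xs ys assume *: "pad xs = pad ys"
    have "length xs = length ys" using fun_cong[OF *, of 0] by (simp add: pad_def)
    moreover have "xs ! i = ys ! i" for i using fun_cong[OF *, of "Suc i"] by (simp add: pad_def)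
    ultimately show "xs = ys" by (simp add: nth_equalityI)
  qed
  moreover have "inj (tm_code :: 'k tm \<Rightarrow> _)"
    by (rule injI) (use tm_code_prefix_free[of _ "[]" _ "[]"] in auto)
  ultimately have "inj (pad \<circ> (tm_code :: 'k tm \<Rightarrow> _))" by (intro inj_compose)
  then show ?thesis by blast
qed

text \<open>The universal property quantifies only over algebras on \<^typ>\<open>nat \<Rightarrow> 'k\<close>; the
  subalgebra generated by \<^term>\<open>w\<close> consists of values of terms, so it has a copy there.\<close>

lemma is_U3_lift:
  fixes C :: "('k::field_char_0, 'c) confalg" and D :: "('k, 'd) confalg"
  assumes U: "is_U3 C v" and D: "assoc_confalg D" and rel: "U3_rel D w"
  shows "\<exists>f. conf_hom C D f \<and> f v = w"
proof -
  interpret D: assoc_conf D by unfold_locales (rule D)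
  have w: "w \<in> carr D" using rel by (simp add: U3_rel_def)
  obtain code :: "'k tm \<Rightarrow> nat \<Rightarrow> 'k" where code: "inj code" using ex_inj_tm by blast
  define S where "S = range (tm_eval D w)"
  have S_sub: "x \<in> carr D" if "x \<in> S" for x
  proof -
    have "tm_eval D w t \<in> carr D" for t by (induction t) (auto simp: w)
    then show ?thesis using that by (auto simp: S_def)
  qed
  have S: "w \<in> S" "zer D \<in> S" "\<And>x y. x \<in> S \<Longrightarrow> y \<in> S \<Longrightarrow> add D x y \<in> S"
    "\<And>k x. x \<in> S \<Longrightarrow> smul D k x \<in> S" "\<And>x. x \<in> S \<Longrightarrow> der D x \<in> S"
    "\<And>n x y. x \<in> S \<Longrightarrow> y \<in> S \<Longrightarrow> nprod D n x y \<in> S"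
    unfolding S_def using rangeI[of "tm_eval D w"]
    by (metis tm_eval.simps(1), metis tm_eval.simps(2), (clarsimp, metis tm_eval.simps)+)
  \<comment> \<open>Several terms may have the same value; \<open>SOME\<close> fixes one for each
    element of \<open>S\<close>, so that injectivity of \<open>code\<close> embeds \<open>S\<close>
    into the type over which the universal property quantifies.\<close>
  define g where "g x = code (SOME t. tm_eval D w t = x)" for x
  have g: "inj_on g S"
  proof (rule inj_onI)
    fix x y assume xy: "x \<in> S" "y \<in> S" "g x = g y"
    then have "(SOME t. tm_eval D w t = x) = (SOME t. tm_eval D w t = y)"
      using code by (simp add: g_def inj_eq)
    moreover have "tm_eval D w (SOME t. tm_eval D w t = z) = z" if "z \<in> S" for z
      using that by (metis (mono_tags, lifting) S_def rangeE someI)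
    ultimately show "x = y" using xy by metis
  qed
  define h where "h = inv_into S g"
  have hg: "h (g x) = x" if "x \<in> S" for x using that g by (simp add: h_def)
  have hS: "h z \<in> S" if "z \<in> g ` S" for z using that by (auto simp: hg)
  define B :: "('k, nat \<Rightarrow> 'k) confalg" where
    "B = \<lparr>carr = g ` S, zer = g (zer D), add = \<lambda>x y. g (add D (h x) (h y)),
          smul = \<lambda>k x. g (smul D k (h x)), der = \<lambda>x. g (der D (h x)),
          nprod = \<lambda>n x y. g (nprod D n (h x) (h y))\<rparr>"
  have hom: "conf_hom B D h"
    by (auto simp: conf_hom_def B_def hg S S_sub)
  have "assoc_confalg B"
    by (rule assoc_confalg_embed[OF D hom]) (auto simp: B_def hg S hS inj_on_def)
  moreover have "U3_rel B (g w)"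
    using rel by (auto simp: U3_rel_def B_def hg S)
  ultimately obtain f where f: "conf_hom C B f" "f v = g w"
    using U by (auto simp: is_U3_def)
  have "conf_hom C D (h \<circ> f)"
    using f(1) hom by (auto simp: conf_hom_def)
  moreover have "(h \<circ> f) v = w" using f(2) S by (simp add: hg)
  ultimately show ?thesis by blast
qed

section \<open>Null extensions\<close>

locale conf_mod = assoc_conf C for C :: "('k::field_char_0, 'c) confalg" +
  fixes act :: "nat \<Rightarrow> 'c \<Rightarrow> 'k poly \<Rightarrow> 'k poly"
  assumes cm: "conf_module C act"
begin

lemmas mod_axioms = cm[unfolded conf_module_def]

lemmas
  act_add = mod_axioms[THEN conjunct1, rule_format]
  and act_smult = mod_axioms[THEN conjunct2, THEN conjunct1, rule_format]
  and act_add_left = mod_axioms[THEN conjunct2, THEN conjunct2, THEN conjunct1, rule_format]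
  and act_smul_left = mod_axioms[THEN conjunct2, THEN conjunct2, THEN conjunct2, THEN conjunct1,
    rule_format]
  and act_finite = mod_axioms[THEN conjunct2, THEN conjunct2, THEN conjunct2, THEN conjunct2,
    THEN conjunct1, rule_format]
  and act_der = mod_axioms[THEN conjunct2, THEN conjunct2, THEN conjunct2, THEN conjunct2,
    THEN conjunct2, THEN conjunct1, rule_format]
  and act_polyX = mod_axioms[THEN conjunct2, THEN conjunct2, THEN conjunct2, THEN conjunct2,
    THEN conjunct2, THEN conjunct2, THEN conjunct1, rule_format]
  and act_assoc = mod_axioms[THEN conjunct2, THEN conjunct2, THEN conjunct2, THEN conjunct2,
    THEN conjunct2, THEN conjunct2, THEN conjunct2, rule_format]

lemma act_zero [simp]: "a \<in> carr C \<Longrightarrow> act n a 0 = 0"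
  using act_smult[of a n 0 0] by simp

end

text \<open>The conditions on a reduced 2-cochain once \<lambda>_2 is eliminated: putting
  \<lambda>_2 = -\<partial> - \<lambda>_1 turns the factor -\<lambda>_2 for \<partial> in the second
  argument into \<partial> + \<lambda>_1, whence \<open>coc_der_right\<close>.\<close>

locale null_bilinear = conf_mod C act
  for C :: "('k::field_char_0, 'c) confalg" and act +
  fixes \<Phi> :: "nat \<Rightarrow> 'c \<Rightarrow> 'c \<Rightarrow> 'k poly"
  assumes coc_add_left: "a \<in> carr C \<Longrightarrow> b \<in> carr C \<Longrightarrow> c \<in> carr C \<Longrightarrow>
      \<Phi> n (add C a b) c = \<Phi> n a c + \<Phi> n b c"
    and coc_add_right: "a \<in> carr C \<Longrightarrow> b \<in> carr C \<Longrightarrow> c \<in> carr C \<Longrightarrow>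
      \<Phi> n a (add C b c) = \<Phi> n a b + \<Phi> n a c"
    and coc_smul_left: "a \<in> carr C \<Longrightarrow> b \<in> carr C \<Longrightarrow> \<Phi> n (smul C k a) b = smult k (\<Phi> n a b)"
    and coc_smul_right: "a \<in> carr C \<Longrightarrow> b \<in> carr C \<Longrightarrow> \<Phi> n a (smul C k b) = smult k (\<Phi> n a b)"
    and coc_finite: "a \<in> carr C \<Longrightarrow> b \<in> carr C \<Longrightarrow> finite {n. \<Phi> n a b \<noteq> 0}"
    and coc_der_left: "a \<in> carr C \<Longrightarrow> b \<in> carr C \<Longrightarrow>
      \<Phi> n (der C a) b = smult (- of_nat n) (\<Phi> (n - 1) a b)"
    and coc_der_right: "a \<in> carr C \<Longrightarrow> b \<in> carr C \<Longrightarrow>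
      \<Phi> n a (der C b) = polyX * \<Phi> n a b + smult (of_nat n) (\<Phi> (n - 1) a b)"

locale null_cocycle = null_bilinear C act \<Phi>
  for C :: "('k::field_char_0, 'c) confalg" and act \<Phi> +
  assumes coc_assoc: "a \<in> carr C \<Longrightarrow> b \<in> carr C \<Longrightarrow> c \<in> carr C \<Longrightarrow>
      act n a (\<Phi> m b c) + \<Phi> n a (nprod C m b c) =
      (\<Sum>s\<le>n. smult (of_nat (n choose s)) (\<Phi> (n + m - s) (nprod C s a b) c))"
begin

text \<open>The \<open>M\<close>-component of the left factor does not enter the product:
  \<open>M\<close> is an ideal of square zero on which \<open>C\<close> acts by zero from the
  right.\<close>

definition null_ext :: "('k, 'c \<times> 'k poly) confalg" where
  "null_ext = \<lparr>carr = carr C \<times> UNIV, zer = (zer C, 0),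
     add = \<lambda>x y. (add C (fst x) (fst y), snd x + snd y),
     smul = \<lambda>k x. (smul C k (fst x), smult k (snd x)),
     der = \<lambda>x. (der C (fst x), polyX * snd x),
     nprod = \<lambda>n x y. (nprod C n (fst x) (fst y), act n (fst x) (snd y) + \<Phi> n (fst x) (fst y))\<rparr>"

lemma null_ext_simps [simp]:
  "carr null_ext = carr C \<times> UNIV" "zer null_ext = (zer C, 0)"
  "add null_ext x y = (add C (fst x) (fst y), snd x + snd y)"
  "smul null_ext k x = (smul C k (fst x), smult k (snd x))"
  "der null_ext x = (der C (fst x), polyX * snd x)"
  "nprod null_ext n x y = (nprod C n (fst x) (fst y), act n (fst x) (snd y) + \<Phi> n (fst x) (fst y))"
  by (simp_all add: null_ext_def)

lemma csumn_null_ext: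
  "csumn null_ext f n = (csumn C (\<lambda>i. fst (f i)) n, \<Sum>i<n. snd (f i))"
proof -
  have "foldr (\<lambda>i. add null_ext (f i)) xs (zer C, 0) =
        (foldr (\<lambda>i. add C (fst (f i))) xs (zer C), \<Sum>i\<leftarrow>xs. snd (f i))" for xs
    by (induction xs) auto
  from this[of "[0..<n]"] show ?thesis
    by (simp add: csumn_def interv_sum_list_conv_sum_set_nat atLeast0LessThan
        del: null_ext_simps(3))
qed

lemma kspace_null_ext: "kspace null_ext"
  unfolding kspace_def
proof (intro conjI ballI allI)
  fix x assume "x \<in> carr null_ext"
  moreover from this obtain y where "y \<in> carr C" "add C (fst x) y = zer C"
    using add_inverse[of "fst x"] by auto
  ultimately show "\<exists>y\<in>carr null_ext. add null_ext x y = zer null_ext"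
    by (intro bexI[of _ "(y, - snd x)"]) auto
qed (auto simp: add_assoc smul_add smul_plus smul_mult smult_add_right smult_add_left algebra_simps
  intro: add_comm)

lemma assoc_confalg_null_ext: "assoc_confalg null_ext"
  unfolding assoc_confalg_def
proof (intro conjI ballI allI kspace_null_ext)
  fix x y assume "x \<in> carr null_ext" "y \<in> carr null_ext"
  then have *: "fst x \<in> carr C" "fst y \<in> carr C" by auto
  have "{n. nprod null_ext n x y \<noteq> zer null_ext} \<subseteq> {n. nprod C n (fst x) (fst y) \<noteq> zer C} \<union>
      {n. act n (fst x) (snd y) \<noteq> 0} \<union> {n. \<Phi> n (fst x) (fst y) \<noteq> 0}"
    by auto
  then show "finite {n. nprod null_ext n x y \<noteq> zer null_ext}"
    by (rule finite_subset) (use * in \<open>simp add: nprod_finite act_finite coc_finite\<close>)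
next
  fix n m x y z
  assume "x \<in> carr null_ext" "y \<in> carr null_ext" "z \<in> carr null_ext"
  then have "fst x \<in> carr C" "fst y \<in> carr C" "fst z \<in> carr C" by auto
  then show "nprod null_ext n x (nprod null_ext m y z) = csumn null_ext
      (\<lambda>s. smul null_ext (of_nat (n choose s))
        (nprod null_ext (n + m - s) (nprod null_ext s x y) z)) (Suc n)"
    using coc_assoc[of "fst x" "fst y" "fst z" n m]
    by (simp add: csumn_null_ext nprod_assoc act_add act_assoc smult_add_right sum.distrib
      lessThan_Suc_atMost add.assoc del: sum.lessThan_Suc)
qed (auto simp: der_add der_smul nprod_add nprod_smul nprod_der_left nprod_der_right
  act_add act_smult act_add_left act_smul_left act_der act_polyX[simplified] coc_add_left coc_add_right
  coc_smul_left coc_smul_right coc_der_left coc_der_right smult_add_right algebra_simps)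

text \<open>A lift of the generator that still satisfies the defining relations splits the null
  extension, so the cocycle is the coboundary of the second component of the splitting.\<close>

lemma splitting:
  assumes U: "is_U3 C v"
    and high: "\<And>n. n \<ge> 3 \<Longrightarrow> act n v q + \<Phi> n v v = 0"
    and rel: "smult 2 (act 1 v q + \<Phi> 1 v v) - polyX * (act 2 v q + \<Phi> 2 v v) = smult 2 q"
  obtains t where "t v = q"
    "\<And>a b. a \<in> carr C \<Longrightarrow> b \<in> carr C \<Longrightarrow> t (add C a b) = t a + t b"
    "\<And>k a. a \<in> carr C \<Longrightarrow> t (smul C k a) = smult k (t a)"
    "\<And>a. a \<in> carr C \<Longrightarrow> t (der C a) = polyX * t a"
    "\<And>n a b. a \<in> carr C \<Longrightarrow> b \<in> carr C \<Longrightarrow> t (nprod C n a b) = act n a (t b) + \<Phi> n a b"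
proof -
  have v: "v \<in> carr C" "U3_rel C v" using U by (auto simp: is_U3_def U3_rel_def)
  have "smult 2 (act 1 v q + \<Phi> 1 v v) + smult (-1) (polyX * (act 2 v q + \<Phi> 2 v v)) = smult 2 q"
    using rel by (simp only: smult_minus_left smult_1_left diff_conv_add_uminus)
  then have "U3_rel null_ext (v, q)"
    using v high by (simp add: U3_rel_def)
  then obtain f where f: "conf_hom C null_ext f" "f v = (v, q)"
    using is_U3_lift[OF U assoc_confalg_null_ext] by blast
  have f': "\<And>a b. a \<in> carr C \<Longrightarrow> b \<in> carr C \<Longrightarrow> f (add C a b) = add null_ext (f a) (f b)"
    "\<And>k a. a \<in> carr C \<Longrightarrow> f (smul C k a) = smul null_ext k (f a)"
    "\<And>a. a \<in> carr C \<Longrightarrow> f (der C a) = der null_ext (f a)"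
    "\<And>n a b. a \<in> carr C \<Longrightarrow> b \<in> carr C \<Longrightarrow> f (nprod C n a b) = nprod null_ext n (f a) (f b)"
    using f(1) by (auto simp: conf_hom_def)
  have z: "f (zer C) = (zer C, 0)" using f'(2)[of v 0] v f by simp
  have "generated_by C v" using U by (simp add: is_U3_def)
  \<comment> \<open>The first component of \<open>f\<close> respects all operations and fixes
    \<open>v\<close>, and \<open>v\<close> generates \<open>C\<close>; so it is the identity, and
    the second component can serve as \<open>t\<close>.\<close>
  then have "{a \<in> carr C. fst (f a) = a} = carr C"
    unfolding generated_by_def
    by (elim allE[of _ "{a \<in> carr C. fst (f a) = a}"] impE) (use v z f(2) in \<open>auto simp: f'\<close>)
  then have fst: "fst (f a) = a" if "a \<in> carr C" for a using that by blast
  show ?thesis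
    by (rule that[of "\<lambda>a. snd (f a)"]) (auto simp: f' fst f(2))
qed

end

section \<open>Normal form of a cocycle on the generator\<close>

lemma ex_poly_coeff:
  assumes "finite {j::nat. c j \<noteq> (0::'a::zero)}"
  obtains p where "\<And>j. poly.coeff p j = c j"
proof -
  obtain N where "\<And>j. c j \<noteq> 0 \<Longrightarrow> j < N"
    using assms finite_nat_set_iff_bounded by fastforce
  then have "poly.coeff (Poly (map c [0..<N])) j = c j" for j
    by (auto simp: coeff_Poly_eq nth_default_def not_less[symmetric])
  then show ?thesis by (rule that)
qed

text \<open>Sesquilinearity gives v_\<lambda> p(\<partial>)u = p(\<partial> + \<lambda>)(\<partial>
  + \<Delta>\<lambda>)u; this is its coefficient of \<lambda>^n/n! and \<partial>^j. For
  \<open>n = j = 0\<close> the last factor vanishes, so the truncated subtraction does no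
  harm.\<close>

lemma (in conf_mod) act_generator:
  assumes v: "v \<in> carr C" and M: "M0Delta_action act v \<Delta>"
  shows "poly.coeff (act n v p) j =
    poly.coeff p (n + j - 1) * fact (n + j - 1) / fact j * (of_nat j + \<Delta> * of_nat n)"
proof (induction p arbitrary: n j)
  case 0
  then show ?case using v by simp
next
  case (pCons a p)
  have one: "poly.coeff (act n v 1) j = (if n = 0 \<and> j = 1 then 1 else if n = 1 \<and> j = 0 then \<Delta> else 0)"
    using M by (cases "n = 0"; cases "n = 1")
      (auto simp: M0Delta_action_def coeff_pCons split: nat.splits)
  have "pCons a p = smult a 1 + polyX * p" by simp
  then have "act n v (pCons a p) =
      smult a (act n v 1) + (polyX * act n v p + smult (of_nat n) (act (n - 1) v p))"
    using v by (simp only: act_add act_smult act_polyX)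
  then have *: "poly.coeff (act n v (pCons a p)) j = a * poly.coeff (act n v 1) j +
      (if j = 0 then 0 else poly.coeff (act n v p) (j - 1)) + of_nat n * poly.coeff (act (n - 1) v p) j"
    by (auto simp: coeff_pCons split: nat.splits)
  show ?case
  proof (cases "n + j \<le> 1")
    case True
    then consider "n = 0" "j = 0" | "n = 1" "j = 0" | "n = 0" "j = 1" by linarith
    then show ?thesis using * one by cases (simp_all add: pCons.IH)
  next
    case False
    then obtain k where k: "n + j = Suc (Suc k)" 
      by (cases "n + j"; cases "n + j - 1") auto
    have "poly.coeff (act n v 1) j = 0" using k by (auto simp: one)
    moreover have "(if j = 0 then 0 else poly.coeff (act n v p) (j - 1)) =
      poly.coeff p k * fact k / fact j * (of_nat j * (of_nat j - 1 + \<Delta> * of_nat n))"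
    proof (cases j)
      case (Suc i)
      then have "n + i - 1 = k" using k by simp
      moreover have "fact j = (of_nat j :: 'k) * fact i" "of_nat j \<noteq> (0 :: 'k)"
        by (simp_all add: Suc del: of_nat_Suc)
      ultimately show ?thesis using Suc by (simp add: pCons.IH del: fact_Suc)
    qed simp
    moreover have "of_nat n * poly.coeff (act (n - 1) v p) j =
      poly.coeff p k * fact k / fact j * (of_nat n * (of_nat j + \<Delta> * (of_nat n - 1)))"
      using k by (cases n) (auto simp: pCons.IH)
    ultimately have "poly.coeff (act n v (pCons a p)) j = poly.coeff p k * fact k / fact j *
        (of_nat j * (of_nat j - 1 + \<Delta> * of_nat n) + of_nat n * (of_nat j + \<Delta> * (of_nat n - 1)))"
      using * by (simp add: distrib_left)
    also have "of_nat j * (of_nat j - 1 + \<Delta> * of_nat n) + of_nat n * (of_nat j + \<Delta> * (of_nat n - 1)) =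
      (of_nat (n + j) - 1) * (of_nat j + \<Delta> * of_nat n)"
      by (simp add: algebra_simps)
    also have "of_nat (n + j) - 1 = (of_nat (Suc k) :: 'k)" by (simp add: k)
    finally show ?thesis using k by (simp add: field_simps)
  qed
qed

context null_bilinear begin

lemma coc_zero_left [simp]: "b \<in> carr C \<Longrightarrow> \<Phi> n (zer C) b = 0"
  using coc_smul_left[of "zer C" b n 0] by simp

lemma coc_zero_right [simp]: "a \<in> carr C \<Longrightarrow> \<Phi> n a (zer C) = 0"
  using coc_smul_right[of a "zer C" n 0] by simp

end

context null_cocycle begin

text \<open>Constant terms of associativity at \<open>(v, v, v)\<close>: the outer index
  \<open>Suc n\<close> reads off the \<open>n\<close>-th coefficient of the inner product.
  \<open>A\<close>, \<open>B\<close> and \<open>K\<close> are auxiliary unknowns, to be eliminated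
  later; products with v_(1) v do not appear because the defining relation expresses v_(1) v by
  \<open>v\<close> and \<partial>(v_(2) v).\<close>

lemma coc_equation:
  assumes U: "U3_rel C v" and M: "M0Delta_action act v \<Delta>"
  defines "A \<equiv> \<lambda>k. poly.coeff (\<Phi> k (nprod C 0 v v) v) 0"
    and "B \<equiv> \<lambda>k. poly.coeff (\<Phi> k (nprod C 2 v v) v) 0"
    and "K \<equiv> \<lambda>k. poly.coeff (\<Phi> k v (nprod C 2 v v)) 0"
    and "p \<equiv> \<lambda>m. poly.coeff (\<Phi> m v v)"
  shows
    "m \<ge> 3 \<Longrightarrow> \<Delta> * fact (Suc n) * p m n =
       A (Suc n + m) + of_nat (Suc n) * p (n + m) 0 - of_nat (Suc n) * of_nat m / 2 * B (n + m - 1)"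
      (is "_ \<Longrightarrow> ?G1")
    and "m \<ge> 3 \<Longrightarrow> A m = 0"
    and "\<Delta> * fact (Suc n) * p 1 n + p (Suc n) 0 + of_nat (Suc n) / 2 * K n =
       A (Suc n + 1) + of_nat (Suc n) * p (Suc n) 0 - of_nat (Suc n) / 2 * B n"
    and "\<Delta> * fact (Suc n) * p 2 n + K (Suc n) =
       A (Suc n + 2) + of_nat (Suc n) * p (n + 2) 0 - of_nat (Suc n) * B (Suc n)"
proof -
  define e where "e = nprod C 2 v v"
  have v [simp]: "v \<in> carr C" using U by (simp add: U3_rel_def)
  have e [simp]: "e \<in> carr C" by (simp add: e_def)
  have e0 [simp]: "nprod C 0 v v \<in> carr C" and e1 [simp]: "nprod C 1 v v \<in> carr C"
    by (simp_all del: One_nat_def)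
  have z: "nprod C s v v = zer C" if "s \<ge> 3" for s using U that by (simp add: U3_rel_def)
  have rel: "add C (smul C 2 (nprod C 1 v v)) (smul C (-1) (der C e)) = smul C 2 v"
    using U by (simp add: U3_rel_def e_def)
  have "smult 2 (\<Phi> k (nprod C 1 v v) v) - \<Phi> k (der C e) v = smult 2 (\<Phi> k v v)" for k
    using arg_cong[OF rel, of "\<lambda>x. \<Phi> k x v"]
    by (simp add: coc_add_left coc_smul_left del: One_nat_def)
  from arg_cong[OF this, of "\<lambda>q. poly.coeff q 0"]
  have L: "poly.coeff (\<Phi> k (nprod C 1 v v) v) 0 = p k 0 - of_nat k / 2 * B (k - 1)" for k
    by (simp add: coc_der_left p_def B_def e_def field_simps del: One_nat_def)
       (simp add: algebra_simps)?
  have "smult 2 (\<Phi> k v (nprod C 1 v v)) - \<Phi> k v (der C e) = smult 2 (\<Phi> k v v)" for k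
    using arg_cong[OF rel, of "\<lambda>x. \<Phi> k v x"]
    by (simp add: coc_add_right coc_smul_right del: One_nat_def)
  from arg_cong[OF this, of "\<lambda>q. poly.coeff q 0"]
  have R: "poly.coeff (\<Phi> k v (nprod C 1 v v)) 0 = p k 0 + of_nat k / 2 * K (k - 1)" for k
    by (simp add: coc_der_right p_def K_def e_def field_simps del: One_nat_def)
       (simp add: algebra_simps)?
  define S where "S n m = poly.coeff (\<Phi> n v (nprod C m v v)) 0" for n m
  define T where "T n m = poly.coeff (act n v (\<Phi> m v v)) 0" for n m
  have T: "T 0 m = 0" "T (Suc n) m = \<Delta> * fact (Suc n) * p m n" for n m
    by (simp_all add: T_def act_generator[OF v M] p_def algebra_simps)
  \<comment> \<open>Only \<open>s = 0, 1, 2\<close> contribute, as the higher products of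
    \<open>v\<close> vanish. The two terms with \<open>B\<close> combine by n(n - 1)/2 - n(n + m -
    1)/2 = -nm/2.\<close>
  have G: "T n m + S n m = A (n + m) + of_nat n * p (n + m - 1) 0 -
      of_nat n * of_nat m / 2 * B (n + m - 2)" for n m
  proof -
    let ?g = "\<lambda>s. of_nat (n choose s) * poly.coeff (\<Phi> (n + m - s) (nprod C s v v) v) 0"
    have "T n m + S n m = (\<Sum>s\<le>n. ?g s)"
      using arg_cong[OF coc_assoc[of v v v n m], of "\<lambda>q. poly.coeff q 0"]
      by (simp add: T_def S_def coeff_sum)
    also have "\<dots> = (\<Sum>s<3. ?g s)"
      by (rule sum.mono_neutral_cong) (auto simp: z)
    also have "\<dots> = A (n + m) + of_nat n * (p (n + m - 1) 0 - of_nat (n + m - 1) / 2 * B (n + m - 2))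
        + of_nat (n choose 2) * B (n + m - 2)"
      using L[of "n + m - 1"] by (simp add: eval_nat_numeral A_def B_def numeral_2_eq_2 diff_diff_left)
    also have "of_nat (n choose 2) = (of_nat n * (of_nat n - 1) / 2 :: 'k)"
      by (simp add: binomial_gbinomial gbinomial_prod_rev numeral_2_eq_2 field_simps)
    finally show ?thesis
      by (cases n) (simp_all add: algebra_simps add_divide_distrib diff_divide_distrib)
  qed
  show "A m = 0" if "m \<ge> 3" using G[of 0 m] that by (simp add: T S_def z)
  show ?G1 if "m \<ge> 3" using G[of "Suc n" m] that by (simp add: T S_def z)
  show "\<Delta> * fact (Suc n) * p 1 n + p (Suc n) 0 + of_nat (Suc n) / 2 * K n =
       A (Suc n + 1) + of_nat (Suc n) * p (Suc n) 0 - of_nat (Suc n) / 2 * B n"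
    using G[of "Suc n" 1] R[of "Suc n"] by (simp add: T S_def algebra_simps)
  show "\<Delta> * fact (Suc n) * p 2 n + K (Suc n) =
       A (Suc n + 2) + of_nat (Suc n) * p (n + 2) 0 - of_nat (Suc n) * B (Suc n)"
    using G[of "Suc n" 2] by (simp add: T S_def K_def algebra_simps add_divide_distrib)
qed

text \<open>Once \<open>q\<close> is chosen, both claims are checked coefficient by coefficient: the
  equations eliminate \<open>A\<close>, \<open>B\<close> and \<open>K\<close>, and \<Delta> is
  cancelled from what is left. The excess \<open>c\<close> is the coordinate of the cocycle in
  cohomology when \<Delta> = 1.\<close>

lemma normal_form:
  assumes U: "U3_rel C v" and M: "M0Delta_action act v \<Delta>" and nz: "\<Delta> \<noteq> 0"
  obtains q c where "\<And>m. m \<ge> 3 \<Longrightarrow> act m v q + \<Phi> m v v = 0"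
    "smult 2 (act 1 v q + \<Phi> 1 v v) - polyX * (act 2 v q + \<Phi> 2 v v) = smult 2 (q + [:c:])"
    "\<Delta> \<noteq> 1 \<Longrightarrow> c = 0"
proof -
  have v: "v \<in> carr C" using U by (simp add: U3_rel_def)
  define A where "A k = poly.coeff (\<Phi> k (nprod C 0 v v) v) 0" for k
  define B where "B k = poly.coeff (\<Phi> k (nprod C 2 v v) v) 0" for k
  define K where "K k = poly.coeff (\<Phi> k v (nprod C 2 v v)) 0" for k
  define p where "p m = poly.coeff (\<Phi> m v v)" for m
  note E = coc_equation[OF U M, folded A_def B_def K_def p_def]
  define c where "c = (if \<Delta> = 1 then p 1 0 else 0)"
  \<comment> \<open>For \<open>j \<ge> 2\<close> the value is forced by the constant term of the
    condition with \<open>m = Suc j\<close>. The coefficient of \<partial> in \<open>q\<close>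
    cancels from all conditions, so 0 is a free choice. For \<open>j = 0\<close> the equation is
    \<Delta> q_0 + \<open>p 1 0\<close> = q_0; if \<Delta> = 1, division by zero yields q_0 = 0 and
    \<open>p 1 0\<close> survives as \<open>c\<close>.\<close>
  define g where "g j = (if j = 0 then p 1 0 / (1 - \<Delta>) else if j = 1 then 0
    else - p (Suc j) 0 / (fact (Suc j) * \<Delta>))" for j
  have "finite (insert 0 (insert 1 {j. \<Phi> (Suc j) v v \<noteq> 0}))"
    using finite_vimageI[OF coc_finite[OF v v], of Suc] by (simp add: vimage_def)
  then have "finite {j. g j \<noteq> 0}"
    by (rule rev_finite_subset) (auto simp: g_def p_def split: if_splits)
  then obtain q where q: "poly.coeff q j = g j" for j using ex_poly_coeff by blast
  note act = act_generator[OF v M]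
  \<comment> \<open>The case \<open>n = 0\<close> of the first equation, in which
    \<open>A (Suc m)\<close> vanishes.\<close>
  have B: "of_nat m * B (m - 1) = 2 * (1 - \<Delta>) * p m 0" if "m \<ge> 3" for m
    using E(1)[of m 0] E(2)[of "Suc m"] that by (simp add: field_simps)
  show ?thesis
  proof
    fix m :: nat assume m: "m \<ge> 3"
    show "act m v q + \<Phi> m v v = 0"
    proof (rule poly_eqI)
      fix j
      have nz': "of_nat (m + j) \<noteq> (0 :: 'k)" "fact j \<noteq> (0 :: 'k)"
        using m by (simp_all del: of_nat_add)
      define x y F where "x = (of_nat j :: 'k)" and "y = (of_nat m :: 'k)" and "F = (fact j :: 'k)"
      have "\<Delta> * ((x + 1) * F) * p m j = (x + 1) * p (j + m) 0 - (x + 1) * y / 2 * B (j + m - 1)"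
        using E(1)[of m j] E(2)[of "Suc j + m"] m by (simp add: x_def y_def F_def add.commute)
      then have "2 * (\<Delta> * ((x + 1) * F) * p m j) = 2 * (x + 1) * p (j + m) 0 - (x + 1) * y * B (j + m - 1)"
        by (simp add: right_diff_distrib)
      moreover have "(x + y) * B (j + m - 1) = 2 * (1 - \<Delta>) * p (j + m) 0"
        using B[of "j + m"] m by (simp add: x_def y_def)
      ultimately have "2 * (x + 1) * (\<Delta> * F * p m j * (x + y)) = 2 * (x + 1) * (p (j + m) 0 * (x + \<Delta> * y))"
        by algebra
      moreover have "2 * (x + 1) \<noteq> 0"
        using of_nat_neq_0[of j, where 'a = 'k] unfolding mult_eq_0_iff by (simp add: x_def add.commute)
      ultimately have "\<Delta> * fact j * p m j * of_nat (m + j) = p (j + m) 0 * (of_nat j + \<Delta> * of_nat m)"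
        by (simp add: x_def y_def F_def add.commute)
      then have "p m j = p (j + m) 0 * (of_nat j + \<Delta> * of_nat m) / (\<Delta> * fact j * of_nat (m + j))"
        using nz nz' by (subst nonzero_eq_divide_eq) (simp_all add: mult.assoc mult.left_commute[of _ "fact j"] mult.commute[of "p m j"] del: of_nat_add)
      moreover obtain k where k: "m + j = Suc k" "k \<ge> 2" using m by (cases "m + j") auto
      moreover have "poly.coeff (act m v q) j =
          - (p (j + m) 0 * (of_nat j + \<Delta> * of_nat m) / (\<Delta> * fact j * of_nat (m + j)))"
        using k by (simp add: act q g_def add.commute[of j m] mult_ac del: of_nat_Suc of_nat_add)
      ultimately show "poly.coeff (act m v q + \<Phi> m v v) j = poly.coeff 0 j"
        by (simp add: p_def)
    qed
  next
    show "smult 2 (act 1 v q + \<Phi> 1 v v) - polyX * (act 2 v q + \<Phi> 2 v v) = smult 2 (q + [:c:])"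
    proof (rule poly_eqI)
      fix j
      consider "j = 0" | "j = 1" | n where "j = Suc (Suc n)"
        by (metis One_nat_def not0_implies_Suc)
      then show "poly.coeff (smult 2 (act 1 v q + \<Phi> 1 v v) - polyX * (act 2 v q + \<Phi> 2 v v)) j =
          poly.coeff (smult 2 (q + [:c:])) j"
      proof cases
        case 1
        then show ?thesis
          by (simp add: act q g_def p_def c_def field_simps)
      next
        case 2
        \<comment> \<open>\<open>B 1\<close>, \<open>K 1\<close>, \<open>A 3\<close> and
          \<open>p 2 0\<close> occur in the same way in both equations except for the terms with
          \<Delta>, so the difference is \<Delta> times the relation wanted in degree 1.\<close>
        have "B 1 + (K 1 + \<Delta> * (2 * p 1 1)) = A 3 + p 2 0"
          and "B 1 + (K 1 + \<Delta> * p 2 0) = A 3 + p 2 0"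
          using E(3)[of 1] E(4)[of 0] by (simp_all add: field_simps numeral_3_eq_3 numeral_2_eq_2)
        then have "\<Delta> * (2 * p 1 1) = \<Delta> * p 2 0" by algebra
        then have "2 * p 1 1 = p 2 0" using nz by simp
        then show ?thesis using 2 nz by (simp add: act q g_def p_def algebra_simps)
      next
        case (3 n)
        define x F P where "x = (of_nat n :: 'k)" and "F = (fact (Suc (Suc n)) :: 'k)"
          and "P = p (Suc (Suc (Suc n))) 0"
        have F: "fact (Suc (Suc (Suc n))) = (x + 3) * F" "fact (Suc (Suc n)) = (x + 2) * fact (Suc n)"
          by (simp_all add: x_def F_def algebra_simps)
        have nz': "F \<noteq> 0" "fact (Suc n) \<noteq> (0 :: 'k)" "x + 3 \<noteq> 0"
          using of_nat_neq_0[of "n + 2", where 'a = 'k] by (simp_all add: F_def x_def algebra_simps del: fact_Suc)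
        have A: "A (Suc (Suc (Suc (Suc n)))) = 0" by (rule E(2)) simp
        \<comment> \<open>With \<open>2 * h = x + 3\<close> in place of a fraction, all four
          equations \<open>e\<close> are polynomial; eliminating \<open>K j\<close> and
          \<open>B j\<close> leaves only \<open>P\<close>.\<close>
        define h where "h = (x + 3) / 2"
        have nat: "of_nat (Suc j) = x + 3" "of_nat (Suc (Suc n)) = x + 2" by (simp_all add: 3 x_def)
        have e: "\<Delta> * ((x + 3) * F) * p 1 j + P + h * K j = (x + 3) * P - h * B j"
          "\<Delta> * F * p 2 (Suc n) + K j = (x + 2) * P - (x + 2) * B j"
          "(x + 3) * B j = 2 * (1 - \<Delta>) * P" "2 * h = x + 3"
          using E(3)[of j, unfolded nat] E(4)[of "Suc n", unfolded nat] B[of "Suc j", unfolded nat] A F(1)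
          by (simp_all add: 3 h_def P_def F_def del: fact_Suc)
        have "\<Delta> * ((x + 3) * F) * (2 * p 1 j - p 2 (Suc n)) = - ((x + 1) * (x + 2 * \<Delta>) * P)"
          using e by algebra
        moreover have "g j * (\<Delta> * ((x + 3) * F)) = - P"
          using nz nz' F(1) by (simp add: g_def 3 P_def mult.commute[of \<Delta>] del: fact_Suc)
        ultimately have "\<Delta> * ((x + 3) * F) * (2 * p 1 j - p 2 (Suc n)) =
            \<Delta> * ((x + 3) * F) * (g j * (x + 1) * (x + 2 * \<Delta>))"
          by algebra
        then have "2 * p 1 j - p 2 (Suc n) = g j * (x + 1) * (x + 2 * \<Delta>)"
          using nz nz' by simp
        moreover have "poly.coeff (act 1 v q) j = g j * (x + 2 + \<Delta>)"
          by (simp add: act q 3 x_def algebra_simps del: fact_Suc)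
        moreover have "poly.coeff (act 2 v q) (Suc n) = g j * ((x + 2) * (x + 1 + 2 * \<Delta>))"
          using nz' by (simp add: act q 3 F(2) x_def field_simps del: fact_Suc)
        ultimately have "2 * (poly.coeff (act 1 v q) j + p 1 j) - (poly.coeff (act 2 v q) (Suc n) + p 2 (Suc n))
            = 2 * g j"
          by algebra
        then show ?thesis by (simp add: q 3 p_def)
      qed
    qed
  qed (simp add: c_def)
qed

end

section \<open>Polynomial functions and generating functions\<close>

lemma polyfun_cong:
  assumes "\<And>ls. length ls = n \<Longrightarrow> g ls = h ls"
  shows "polyfun n g \<longleftrightarrow> polyfun n h"
  using assms by (simp add: polyfun_def cong: imp_cong)

lemma polyfun_monom: "polyfun n (\<lambda>ls. smult (\<Prod>i<n. (ls ! i) ^ e i) p)"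
proof -
  define N where "N = Suc (\<Sum>i<n. e i)"
  let ?E = "{..<n} \<rightarrow>\<^sub>E {..<N}"
  let ?e = "restrict e {..<n}"
  have "e i < N" if "i < n" for i
    unfolding N_def less_Suc_eq_le by (rule member_le_sum) (use that in auto)
  then have mem: "?e \<in> ?E" by auto
  have "smult (\<Prod>i<n. (ls ! i) ^ e i) p =
      (\<Sum>f\<in>?E. smult (\<Prod>i<n. (ls ! i) ^ f i) (if f = ?e then p else 0))" for ls :: "'a list"
  proof -
    have "(\<Sum>f\<in>?E. smult (\<Prod>i<n. (ls ! i) ^ f i) (if f = ?e then p else 0)) =
        (\<Sum>f\<in>?E. if f = ?e then smult (\<Prod>i<n. (ls ! i) ^ ?e i) p else 0)"
      by (rule sum.cong) auto
    also have "\<dots> = smult (\<Prod>i<n. (ls ! i) ^ ?e i) p"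
      using mem by (simp add: finite_PiE)
    also have "(\<Prod>i<n. (ls ! i) ^ ?e i) = (\<Prod>i<n. (ls ! i) ^ e i)"
      by (rule prod.cong) auto
    finally show ?thesis by (rule sym)
  qed
  then show ?thesis unfolding polyfun_def
    by (intro exI[of _ N] exI[of _ "\<lambda>f. if f = ?e then p else 0"]) blast
qed

lemma polyfun_add:
  assumes "polyfun n g" "polyfun n h"
  shows "polyfun n (\<lambda>ls. g ls + h ls)"
proof -
  have ext: "\<exists>d. \<forall>ls. length ls = n \<longrightarrow> g ls =
      (\<Sum>e\<in>({..<n} \<rightarrow>\<^sub>E {..<N + M}). smult (\<Prod>i<n. (ls ! i) ^ e i) (d e))"
    if "\<forall>ls. length ls = n \<longrightarrow> g ls =
      (\<Sum>e\<in>({..<n} \<rightarrow>\<^sub>E {..<N}). smult (\<Prod>i<n. (ls ! i) ^ e i) (c e))"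
    for g :: "'a list \<Rightarrow> 'a poly" and N M c
  proof (intro exI allI impI)
    fix ls :: "'a list" assume "length ls = n"
    then have "g ls = (\<Sum>e\<in>({..<n} \<rightarrow>\<^sub>E {..<N}). smult (\<Prod>i<n. (ls ! i) ^ e i) (c e))"
      using that by blast
    also have "\<dots> = (\<Sum>e\<in>({..<n} \<rightarrow>\<^sub>E {..<N + M}). smult (\<Prod>i<n. (ls ! i) ^ e i)
        (if e \<in> {..<n} \<rightarrow>\<^sub>E {..<N} then c e else 0))"
    proof (rule sum.mono_neutral_cong_left)
      show "{..<n} \<rightarrow>\<^sub>E {..<N} \<subseteq> {..<n} \<rightarrow>\<^sub>E {..<N + M}" by (rule PiE_mono) auto
    qed (simp_all add: finite_PiE)
    finally show "g ls = (\<Sum>e\<in>({..<n} \<rightarrow>\<^sub>E {..<N + M}). smult (\<Prod>i<n. (ls ! i) ^ e i)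
        (if e \<in> {..<n} \<rightarrow>\<^sub>E {..<N} then c e else 0))" .
  qed
  obtain N c M d where
    "\<forall>ls. length ls = n \<longrightarrow> g ls =
      (\<Sum>e\<in>({..<n} \<rightarrow>\<^sub>E {..<N}). smult (\<Prod>i<n. (ls ! i) ^ e i) (c e))"
    "\<forall>ls. length ls = n \<longrightarrow> h ls =
      (\<Sum>e\<in>({..<n} \<rightarrow>\<^sub>E {..<M}). smult (\<Prod>i<n. (ls ! i) ^ e i) (d e))"
    using assms unfolding polyfun_def by blast
  from ext[OF this(1), of M] ext[OF this(2), of N] obtain c' d' where
    "\<forall>ls. length ls = n \<longrightarrow> g ls =
      (\<Sum>e\<in>({..<n} \<rightarrow>\<^sub>E {..<N + M}). smult (\<Prod>i<n. (ls ! i) ^ e i) (c' e))"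
    "\<forall>ls. length ls = n \<longrightarrow> h ls =
      (\<Sum>e\<in>({..<n} \<rightarrow>\<^sub>E {..<N + M}). smult (\<Prod>i<n. (ls ! i) ^ e i) (d' e))"
    by (auto simp: add.commute)
  then show ?thesis unfolding polyfun_def
    by (intro exI[of _ "N + M"] exI[of _ "\<lambda>e. c' e + d' e"])
      (simp add: smult_add_right sum.distrib)
qed

lemma polyfun_const: "polyfun n (\<lambda>ls. p)"
  using polyfun_monom[of n "\<lambda>_. 0" p] by simp

lemma polyfun_sum:
  "(\<And>i. i \<in> I \<Longrightarrow> polyfun n (g i)) \<Longrightarrow> polyfun n (\<lambda>ls. \<Sum>i\<in>I. g i ls)"
  by (induction I rule: infinite_finite_induct) (auto intro: polyfun_add polyfun_const)

text \<open>An operation that is linear over the scalars, even one that itself depends on the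
  variables, needs to be examined on monomials only. The map \<open>ls'\<close> allows for a change
  of variables.\<close>

lemma polyfun_linear:
  assumes g: "polyfun n g"
    and add: "\<And>ls p q. length ls = n \<Longrightarrow> L ls (p + q) = L ls p + L ls q"
    and smult: "\<And>ls k p. length ls = n \<Longrightarrow> L ls (smult k p) = smult k (L ls p)"
    and mult: "\<And>p e. polyfun m (\<lambda>ls. smult (\<Prod>i<n. (ls' ls ! i) ^ e i) (L (ls' ls) p))"
    and len: "\<And>ls. length ls = m \<Longrightarrow> length (ls' ls) = n"
  shows "polyfun m (\<lambda>ls. L (ls' ls) (g (ls' ls)))"
proof -
  obtain N c where c: "\<And>ls. length ls = n \<Longrightarrow> g ls =
      (\<Sum>e\<in>({..<n} \<rightarrow>\<^sub>E {..<N}). smult (\<Prod>i<n. (ls ! i) ^ e i) (c e))"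
    using g unfolding polyfun_def by blast
  have L_sum: "L ls (\<Sum>e\<in>I. f e) = (\<Sum>e\<in>I. L ls (f e))"
    if "length ls = n" for ls I and f :: "(nat \<Rightarrow> nat) \<Rightarrow> 'a poly"
    using that add smult[of ls 0 0]
    by (induction I rule: infinite_finite_induct) auto
  have "polyfun m (\<lambda>ls. \<Sum>e\<in>({..<n} \<rightarrow>\<^sub>E {..<N}).
      smult (\<Prod>i<n. (ls' ls ! i) ^ e i) (L (ls' ls) (c e)))"
    by (rule polyfun_sum) (rule mult)
  then show ?thesis
    by (subst polyfun_cong, subst c) (auto simp: len L_sum smult)
qed

lemma polyfun_mult:
  assumes g: "polyfun n g" and h: "polyfun n h"
  shows "polyfun n (\<lambda>ls. g ls * h ls)"
proof -
  have "polyfun n (\<lambda>ls. smult (\<Prod>i<n. (ls ! i) ^ e i) (p * h ls))" for e p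
  proof (rule polyfun_linear[OF h, of "\<lambda>ls q. smult (\<Prod>i<n. (ls ! i) ^ e i) (p * q)" n "\<lambda>ls. ls"])
    fix q :: "'a poly" and f :: "nat \<Rightarrow> nat"
    show "polyfun n (\<lambda>ls. smult (\<Prod>i<n. ls ! i ^ f i) (smult (\<Prod>i<n. ls ! i ^ e i) (p * q)))"
      using polyfun_monom[of n "\<lambda>i. f i + e i" "p * q"]
      by (simp add: power_add prod.distrib)
  qed (auto simp: distrib_left smult_add_right mult_ac)
  then show ?thesis
    by (intro polyfun_linear[OF g, of "\<lambda>ls p. p * h ls" n "\<lambda>ls. ls"])
      (auto simp: distrib_right)
qed

lemma polyfun_nth: "i < n \<Longrightarrow> polyfun n (\<lambda>ls. [:ls ! i:])"
  using polyfun_monom[of n "\<lambda>j. if j = i then 1 else 0" 1]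
  by (simp add: if_distrib[of "\<lambda>e. _ ^ e"] prod.delta cong: if_cong)

lemma polyfun_smult: "polyfun n g \<Longrightarrow> polyfun n (\<lambda>ls. smult k (g ls))"
  using polyfun_mult[OF polyfun_const[of n "[:k:]"]] by simp

lemma polyfun_diff: "polyfun n g \<Longrightarrow> polyfun n h \<Longrightarrow> polyfun n (\<lambda>ls. g ls - h ls)"
  using polyfun_add[OF _ polyfun_smult[of n h "-1"]] by simp

lemma polyfun_scalar_mult:
  "polyfun n (\<lambda>ls. [:r ls:]) \<Longrightarrow> polyfun n g \<Longrightarrow> polyfun n (\<lambda>ls. smult (r ls) (g ls))"
  using polyfun_mult[of n "\<lambda>ls. [:r ls:]" g] by simp

lemma polyfun_scalar_prod:
  "(\<And>i. i \<in> I \<Longrightarrow> polyfun n (\<lambda>ls. [:r i ls:])) \<Longrightarrow> polyfun n (\<lambda>ls. [:\<Prod>i\<in>I. r i ls:])"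
proof (induction I rule: infinite_finite_induct)
  case (insert i I)
  then show ?case using polyfun_mult[of n "\<lambda>ls. [:r i ls:]" "\<lambda>ls. [:\<Prod>i\<in>I. r i ls:]"]
    by (simp add: mult.commute)
qed (simp_all add: polyfun_const)

lemma polyfun_scalar_power:
  "polyfun n (\<lambda>ls. [:r ls:]) \<Longrightarrow> polyfun n (\<lambda>ls. [:r ls ^ k:])"
  using polyfun_scalar_prod[of "{..<k}" n "\<lambda>_. r"] by simp

lemma polyfun_linear':
  assumes g: "polyfun n g"
    and add: "\<And>ls p q. length ls = n \<Longrightarrow> L ls (p + q) = L ls p + L ls q"
    and smult: "\<And>ls k p. length ls = n \<Longrightarrow> L ls (smult k p) = smult k (L ls p)"
    and const: "\<And>p. polyfun n (\<lambda>ls. L ls p)"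
  shows "polyfun n (\<lambda>ls. L ls (g ls))"
proof (rule polyfun_linear[OF g add smult, where ls' = "\<lambda>ls. ls"])
  show "polyfun n (\<lambda>ls. smult (\<Prod>i<n. ls ! i ^ e i) (L ls p))" for p e
    by (intro polyfun_scalar_mult polyfun_scalar_prod polyfun_scalar_power polyfun_nth const) simp
qed

lemma polyfun_tl:
  assumes "polyfun n g"
  shows "polyfun (Suc n) (\<lambda>ls. g (tl ls))"
proof (rule polyfun_linear[OF assms, of "\<lambda>_ p. p" "Suc n" tl])
  fix p :: "'a poly" and e :: "nat \<Rightarrow> nat"
  have "polyfun (Suc n) (\<lambda>ls. smult (\<Prod>i<n. ls ! Suc i ^ e i) p)"
    by (intro polyfun_scalar_mult polyfun_scalar_prod polyfun_scalar_power polyfun_nth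
        polyfun_const) simp
  then show "polyfun (Suc n) (\<lambda>ls. smult (\<Prod>i<n. tl ls ! i ^ e i) p)"
    by (subst polyfun_cong) (auto simp: nth_tl)
qed auto

lemma polyfun_neg_sum_list: "polyfun n (\<lambda>ls. [:- sum_list ls:])"
proof -
  have "polyfun n (\<lambda>ls. smult (-1) (\<Sum>i<n. [:ls ! i:]))"
    by (intro polyfun_smult polyfun_sum polyfun_nth) auto
  moreover have "(\<Sum>i\<in>I. [:f i:]) = [:\<Sum>i\<in>I. f i:]" for I and f :: "nat \<Rightarrow> 'a"
    by (induction I rule: infinite_finite_induct) auto
  ultimately show ?thesis
    by (subst polyfun_cong) (auto simp: sum_list_sum_nth atLeast0LessThan)
qed

section \<open>Substitution for \<partial> and division by a linear factor\<close>

lemma synthetic_div_add: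
  "synthetic_div (p + q) c = synthetic_div p c + synthetic_div q (c :: 'a::field)"
proof (rule synthetic_div_unique[THEN conjunct2, symmetric])
  show "p + q + smult c (synthetic_div p c + synthetic_div q c) =
      pCons (poly (p + q) c) (synthetic_div p c + synthetic_div q c)"
  proof -
    have "p + q + smult c (synthetic_div p c + synthetic_div q c) =
        (p + smult c (synthetic_div p c)) + (q + smult c (synthetic_div q c))"
      by (simp add: smult_add_right)
    then show ?thesis by (simp add: synthetic_div_correct)
  qed
qed

lemma synthetic_div_smult:
  "synthetic_div (smult k p) c = smult k (synthetic_div p (c :: 'a::field))"
proof (rule synthetic_div_unique[THEN conjunct2, symmetric])
  show "smult k p + smult c (smult k (synthetic_div p c)) =
      pCons (poly (smult k p) c) (smult k (synthetic_div p c))"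
    using arg_cong[OF synthetic_div_correct[of p c], of "smult k"]
    by (simp add: smult_add_right mult.commute)
qed

lemma polyfun_poly:
  assumes g: "polyfun n g" and r: "polyfun n (\<lambda>ls. [:r ls:])"
  shows "polyfun n (\<lambda>ls. [:poly (g ls) (r ls):])"
proof (rule polyfun_linear'[OF g, of "\<lambda>ls p. [:poly p (r ls):]"])
  show "polyfun n (\<lambda>ls. [:poly p (r ls):])" for p
  proof (induction p)
    case (pCons a p)
    then show ?case using polyfun_add[OF polyfun_const polyfun_mult[OF r pCons.IH], of "[:a:]"]
      by (simp add: mult.commute)
  qed (simp add: polyfun_const)
qed auto

lemma polyfun_synthetic_div:
  assumes g: "polyfun n g" and r: "polyfun n (\<lambda>ls. [:r ls:])"
  shows "polyfun n (\<lambda>ls. synthetic_div (g ls) (r ls))"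
proof (rule polyfun_linear'[OF g, of "\<lambda>ls p. synthetic_div p (r ls)"])
  show "polyfun n (\<lambda>ls. synthetic_div p (r ls))" for p
  proof (induction p)
    case (pCons a p)
    have "synthetic_div (pCons a p) c = [:poly p c:] + polyX * synthetic_div p c" for c
      by (simp add: synthetic_div_pCons)
    then show ?case
      using polyfun_add[OF polyfun_poly[OF polyfun_const r] polyfun_mult[OF polyfun_const pCons.IH], of p polyX]
      by simp
  qed (simp add: polyfun_const)
qed (auto simp: synthetic_div_add synthetic_div_smult)

lemma sum_triangle:
  fixes f :: "nat \<Rightarrow> nat \<Rightarrow> 'a::comm_monoid_add"
  assumes "\<And>i j. i + j \<ge> L \<Longrightarrow> f i j = 0"
  shows "(\<Sum>k<L. \<Sum>i\<le>k. f i (k - i)) = (\<Sum>i<L. \<Sum>j<L. f i j)"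
proof -
  have "(\<Sum>k<L. \<Sum>i\<le>k. f i (k - i)) = (\<Sum>(i, j)\<in>{(i, j). i + j < L}. f i j)"
    by (rule sum.triangle_reindex[symmetric])
  also have "\<dots> = (\<Sum>(i, j)\<in>{..<L} \<times> {..<L}. f i j)"
    using assms by (intro sum.mono_neutral_left) (auto simp flip: not_less)
  finally show ?thesis by (simp add: sum.cartesian_product)
qed

text \<open>Expand (l + m)^k / k! and collect powers of l: the product of l^s / s! and l^(n - s) /
  (n - s)! is l^n / n! times a binomial coefficient. This converts the right-hand side of
  associativity from \<lambda>-products to n-products; \<open>L\<close> lets every sum run over a
  full square.\<close>

lemma generating_function:
  fixes g :: "nat \<Rightarrow> nat \<Rightarrow> 'a::field_char_0"
  assumes g: "\<And>s k. s + k \<ge> L \<Longrightarrow> g s k = 0"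
  shows "(\<Sum>s<L. \<Sum>k<L. l ^ s / fact s * ((l + m) ^ k / fact k) * g s k) =
    (\<Sum>n<L. \<Sum>j<L. l ^ n / fact n * (m ^ j / fact j) *
       (\<Sum>s\<le>n. of_nat (n choose s) * g s (n + j - s)))"
proof -
  define t where "t s i j = l ^ s / fact s * (l ^ i / fact i) * (m ^ j / fact j) * g s (i + j)" for s i j
  have t: "s + i \<ge> L \<or> s + j \<ge> L \<or> i + j \<ge> L \<Longrightarrow> t s i j = 0" for s i j
    by (auto simp: t_def g)
  have "(\<Sum>k<L. l ^ s / fact s * ((l + m) ^ k / fact k) * g s k) =
      (\<Sum>k<L. \<Sum>i\<le>k. t s i (k - i))" for s
  proof (rule sum.cong[OF refl])
    fix k
    have "(l + m) ^ k / fact k = (\<Sum>i\<le>k. l ^ i / fact i * (m ^ (k - i) / fact (k - i)))"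
      unfolding binomial_ring sum_divide_distrib
      by (rule sum.cong) (simp_all add: binomial_fact)
    then show "l ^ s / fact s * ((l + m) ^ k / fact k) * g s k = (\<Sum>i\<le>k. t s i (k - i))"
      by (simp add: sum_distrib_left sum_distrib_right t_def mult.assoc)
  qed
  then have "(\<Sum>s<L. \<Sum>k<L. l ^ s / fact s * ((l + m) ^ k / fact k) * g s k) =
      (\<Sum>s<L. \<Sum>i<L. \<Sum>j<L. t s i j)"
    by (simp add: sum_triangle t)
  also have "\<dots> = (\<Sum>j<L. \<Sum>s<L. \<Sum>i<L. t s i j)"
    by (subst sum.swap[of _ "{..<L}" "{..<L}" , symmetric], subst sum.swap) (auto intro: sum.swap sum.cong)
  also have "\<dots> = (\<Sum>j<L. \<Sum>n<L. \<Sum>s\<le>n. t s (n - s) j)"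
    by (intro sum.cong refl sum_triangle[symmetric]) (simp add: t)
  also have "\<dots> = (\<Sum>n<L. \<Sum>j<L. \<Sum>s\<le>n. t s (n - s) j)"
    by (rule sum.swap)
  also have "\<dots> = (\<Sum>n<L. \<Sum>j<L. l ^ n / fact n * (m ^ j / fact j) *
       (\<Sum>s\<le>n. of_nat (n choose s) * g s (n + j - s)))"
    unfolding sum_distrib_left
  proof (intro sum.cong refl)
    fix n j s :: nat
    assume "s \<in> {..n}"
    then have s: "s \<le> n" by simp
    then have "l ^ s / fact s * (l ^ (n - s) / fact (n - s)) = l ^ n / fact n * of_nat (n choose s)"
      by (simp add: binomial_fact flip: power_add)
    then show "t s (n - s) j = l ^ n / fact n * (m ^ j / fact j) * (of_nat (n choose s) * g s (n + j - s))"
      using s by (simp add: t_def)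
  qed
  finally show ?thesis .
qed

lemma power_sum_eq_0:
  fixes a :: "nat \<Rightarrow> 'a::{comm_ring_1, ring_no_zero_divisors, ring_char_0}"
  assumes "\<And>x. (\<Sum>n<L. x ^ n * a n) = 0" "n < L"
  shows "a n = 0"
proof -
  define p where "p = (\<Sum>n<L. monom (a n) n)"
  have "poly p x = 0" for x
    using assms(1)[of x] by (simp add: p_def poly_sum poly_monom mult.commute)
  then have "p = 0" using poly_all_0_iff_0[of p] by blast
  then have "poly.coeff p n = 0" by simp
  then show ?thesis using assms(2) by (simp add: p_def coeff_sum)
qed

lemma power_sum2_eq_0:
  fixes u :: "nat \<Rightarrow> nat \<Rightarrow> 'a::field_char_0"
  assumes "\<And>l m. (\<Sum>n<L. \<Sum>j<L. l ^ n / fact n * (m ^ j / fact j) * u n j) = 0" "n < L" "j < L"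
  shows "u n j = 0"
proof -
  have "(\<Sum>j<L. m ^ j * (u n j / (fact n * fact j))) = 0" for m
  proof (rule power_sum_eq_0[OF _ assms(2)])
    show "(\<Sum>n<L. l ^ n * (\<Sum>j<L. m ^ j * (u n j / (fact n * fact j)))) = 0" for l
      using assms(1)[of l m] by (simp add: sum_distrib_left mult.assoc divide_inverse mult_ac)
  qed
  from power_sum_eq_0[OF this assms(3)] show ?thesis by simp
qed

lemma poly_ext: "(\<And>x. poly p x = poly q x) \<Longrightarrow> p = (q :: 'k::field_char_0 poly)"
  by (simp add: fun_eq_iff flip: poly_eq_poly_eq_iff)

lemma smult_sum_right: "smult k (\<Sum>i\<in>I. f i) = (\<Sum>i\<in>I. smult k (f i))"
  by (induction I rule: infinite_finite_induct) (auto simp: smult_add_right)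

definition gsum :: "(nat \<Rightarrow> 'k::field_char_0 poly) \<Rightarrow> 'k \<Rightarrow> 'k poly" where
  "gsum F l = (\<Sum>n | F n \<noteq> 0. smult (l ^ n / fact n) (F n))"

lemma lact_eq_gsum: "lact act l a m = gsum (\<lambda>n. act n a m) l"
  by (simp add: lact_def gsum_def)

lemma gsum_eq: "(\<And>n. n \<ge> N \<Longrightarrow> F n = 0) \<Longrightarrow> gsum F l = (\<Sum>n<N. smult (l ^ n / fact n) (F n))"
  unfolding gsum_def by (rule sum.mono_neutral_left) (auto simp flip: not_le)

lemma finite_support_bound:
  fixes F :: "nat \<Rightarrow> 'a::zero"
  assumes "finite {n. F n \<noteq> 0}"
  shows "\<exists>N. \<forall>n\<ge>N. F n = 0"
proof -
  obtain N where "\<forall>n\<in>{n. F n \<noteq> 0}. n < N" using assms finite_nat_set_iff_bounded by blast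
  then show ?thesis by (intro exI[of _ N]) (auto simp flip: not_less)
qed

text \<open>Locality bounds \<open>j\<close>, and then \<open>n\<close> for each of the finitely
  many \<open>j\<close>. A bound on \<open>n + j\<close> survives the reindexing of double
  sums.\<close>

lemma finite_pairs_bound:
  fixes F :: "nat \<Rightarrow> nat \<Rightarrow> 'z::zero"
  assumes "finite {j. P j}" "\<And>j. finite {n. F n j \<noteq> 0}" "\<And>n j. F n j \<noteq> 0 \<Longrightarrow> P j"
  shows "\<exists>L. \<forall>n j. n + j \<ge> L \<longrightarrow> F n j = 0"
proof -
  let ?S = "(\<lambda>(j, n). n + j) ` (SIGMA j:{j. P j}. {n. F n j \<noteq> 0})"
  have "finite ?S"
    using assms(1,2) by (intro finite_imageI finite_SigmaI) auto
  then obtain L where L: "\<forall>i\<in>?S. i < L"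
    using finite_nat_set_iff_bounded by blast
  have "n + j < L" if "F n j \<noteq> 0" for n j
  proof -
    have "(j, n) \<in> (SIGMA j:{j. P j}. {n. F n j \<noteq> 0})" using that assms(3) by blast
    then have "n + j \<in> ?S" by (metis (no_types, lifting) case_prod_conv imageI)
    then show ?thesis using L by blast
  qed
  then show ?thesis by (intro exI[of _ L]) (auto simp flip: not_less)
qed

lemma gsum_add:
  assumes "finite {n. F n \<noteq> 0}" "finite {n. G n \<noteq> 0}"
  shows "gsum (\<lambda>n. F n + G n) l = gsum F l + gsum G l"
proof -
  obtain N where "\<And>n. n \<ge> N \<Longrightarrow> F n = 0" using finite_support_bound[OF assms(1)] by blast
  moreover obtain M where "\<And>n. n \<ge> M \<Longrightarrow> G n = 0" using finite_support_bound[OF assms(2)] by blast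
  ultimately show ?thesis
    by (simp add: gsum_eq[of "N + M"] smult_add_right sum.distrib)
qed

lemma gsum_mult:
  assumes "finite {n. F n \<noteq> 0}"
  shows "gsum (\<lambda>n. q * F n) l = q * gsum F l"
proof -
  obtain N where "\<And>n. n \<ge> N \<Longrightarrow> F n = 0" using finite_support_bound[OF assms] by blast
  then show ?thesis by (simp add: gsum_eq[of N] sum_distrib_left)
qed

lemma gsum_smult:
  assumes "finite {n. F n \<noteq> 0}"
  shows "gsum (\<lambda>n. smult k (F n)) l = smult k (gsum F l)"
  using gsum_mult[OF assms, of "[:k:]"] by simp

lemma gsum_shift:
  assumes "finite {n. F n \<noteq> 0}"
  shows "gsum (\<lambda>n. smult (of_nat n) (F (n - 1))) l = smult l (gsum F l)"
proof -
  obtain N where N: "\<And>n. n \<ge> N \<Longrightarrow> F n = 0" using finite_support_bound[OF assms] by blast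
  have "gsum (\<lambda>n. smult (of_nat n) (F (n - 1))) l =
      (\<Sum>n<Suc N. smult (l ^ n / fact n) (smult (of_nat n) (F (n - 1))))"
    by (rule gsum_eq) (simp add: N)
  also have "\<dots> = (\<Sum>n<N. smult (l ^ Suc n / fact (Suc n) * of_nat (Suc n)) (F n))"
    by (subst sum.lessThan_Suc_shift) simp
  also have "\<dots> = (\<Sum>n<N. smult (l * (l ^ n / fact n)) (F n))"
    by (intro sum.cong refl) (simp del: of_nat_Suc)
  finally show ?thesis by (simp add: gsum_eq[OF N] smult_sum_right)
qed

lemma finite_shift:
  fixes F :: "nat \<Rightarrow> 'a::field_char_0 poly"
  assumes "finite {n. F n \<noteq> 0}"
  shows "finite {n. smult (of_nat n) (F (n - 1)) \<noteq> 0}"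
  by (rule finite_subset[OF _ finite_imageI[OF assms, of Suc]]) (auto simp: image_iff gr0_conv_Suc)

text \<open>For fixed \<open>x\<close> the difference of both sides is a polynomial in
  \<open>l\<close> that vanishes on an infinite field.\<close>

lemma gsum_inject:
  assumes "finite {n. F n \<noteq> 0}" "finite {n. G n \<noteq> 0}"
    and eq: "\<And>l x. poly (gsum F l) x = poly (gsum G l) x"
  shows "F n = G n"
proof (rule poly_ext)
  fix x
  obtain N where "\<And>n. n \<ge> N \<Longrightarrow> F n = 0" using finite_support_bound[OF assms(1)] by blast
  moreover obtain M where "\<And>n. n \<ge> M \<Longrightarrow> G n = 0" using finite_support_bound[OF assms(2)] by blast
  ultimately have gs: "\<And>l. gsum F l = (\<Sum>n<N + M + Suc n. smult (l ^ n / fact n) (F n))"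
    "\<And>l. gsum G l = (\<Sum>n<N + M + Suc n. smult (l ^ n / fact n) (G n))"
    by (intro gsum_eq; simp del: sum.lessThan_Suc)+
  have "(\<Sum>i<N + M + Suc n. l ^ i * ((poly (F i) x - poly (G i) x) / fact i)) = 0" for l
    using eq[of l x] by (simp add: gs poly_sum diff_divide_distrib right_diff_distrib sum_subtractf)
  then have "(poly (F n) x - poly (G n) x) / fact n = 0"
    by (rule power_sum_eq_0) simp
  then show "poly (F n) x = poly (G n) x" by simp
qed

section \<open>\<lambda>-products of the algebra, the module and the cocycle\<close>

context assoc_conf begin

lemma
  assumes "a \<in> carr C" "b \<in> carr C"
  shows lprod_in [simp]: "lprod C l a b \<in> carr C"
    and lprod_hom: "L (zer C) = 0 \<Longrightarrow>
      (\<And>x y. x \<in> carr C \<Longrightarrow> y \<in> carr C \<Longrightarrow> L (add C x y) = L x + L y) \<Longrightarrow>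
      (\<And>k x. x \<in> carr C \<Longrightarrow> L (smul C k x) = smult k (L x)) \<Longrightarrow>
      L (lprod C l a b) = gsum (\<lambda>n. L (nprod C n a b)) l"
proof -
  define N where "N = (LEAST N. \<forall>n\<ge>N. nprod C n a b = zer C)"
  obtain M where "\<forall>n\<in>{n. nprod C n a b \<noteq> zer C}. n < M"
    using nprod_finite[OF assms] finite_nat_set_iff_bounded by blast
  then have "\<forall>n\<ge>M. nprod C n a b = zer C" by (metis (mono_tags, lifting) mem_Collect_eq not_le)
  then have "\<forall>n\<ge>N. nprod C n a b = zer C" unfolding N_def by (rule LeastI)
  then have N: "\<And>n. n \<ge> N \<Longrightarrow> nprod C n a b = zer C" by blast
  have lprod: "lprod C l a b = csumn C (\<lambda>n. smul C (l ^ n / fact n) (nprod C n a b)) N"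
    by (simp only: lprod_def N_def)
  show "lprod C l a b \<in> carr C"
    unfolding lprod using assms by (intro csumn_in) simp
  assume L: "L (zer C) = 0"
    "\<And>x y. x \<in> carr C \<Longrightarrow> y \<in> carr C \<Longrightarrow> L (add C x y) = L x + L y"
    "\<And>k x. x \<in> carr C \<Longrightarrow> L (smul C k x) = smult k (L x)"
  have "L (lprod C l a b) = (\<Sum>n<N. L (smul C (l ^ n / fact n) (nprod C n a b)))"
    unfolding lprod by (rule csumn_hom[OF _ L(1,2)]) (use assms in auto)
  also have "\<dots> = gsum (\<lambda>n. L (nprod C n a b)) l"
    by (subst gsum_eq[of N]) (simp_all add: N L(1,3) assms)
  finally show "L (lprod C l a b) = gsum (\<lambda>n. L (nprod C n a b)) l" .
qed

end

context conf_mod begin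

lemma
  assumes "a \<in> carr C"
  shows lact_add: "lact act l a (p + q) = lact act l a p + lact act l a q"
    and lact_smult: "lact act l a (smult k p) = smult k (lact act l a p)"
    and lact_polyX: "lact act l a (polyX * p) = polyX * lact act l a p + smult l (lact act l a p)"
    and lact_der: "lact act l (der C a) p = smult (- l) (lact act l a p)"
    and lact_smul_left: "lact act l (smul C k a) p = smult k (lact act l a p)"
proof -
  note fin = act_finite[OF assms]
  show "lact act l a (p + q) = lact act l a p + lact act l a q"
    by (simp add: lact_eq_gsum act_add assms gsum_add fin)
  show "lact act l a (smult k p) = smult k (lact act l a p)"
    by (simp add: lact_eq_gsum act_smult assms gsum_smult fin)
  show "lact act l (smul C k a) p = smult k (lact act l a p)"
    by (simp add: lact_eq_gsum act_smul_left assms gsum_smult fin)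
  have "lact act l a (polyX * p) =
      gsum (\<lambda>n. polyX * act n a p) l + gsum (\<lambda>n. smult (of_nat n) (act (n - 1) a p)) l"
    unfolding lact_eq_gsum act_polyX[OF assms]
    by (rule gsum_add) (use fin finite_shift[OF fin] in auto)
  then show "lact act l a (polyX * p) = polyX * lact act l a p + smult l (lact act l a p)"
    by (simp only: gsum_mult[OF fin] gsum_shift[OF fin] lact_eq_gsum)
  have "lact act l (der C a) p = gsum (\<lambda>n. smult (- 1) (smult (of_nat n) (act (n - 1) a p))) l"
    unfolding lact_eq_gsum act_der[OF assms] by simp
  then show "lact act l (der C a) p = smult (- l) (lact act l a p)"
    by (simp only: gsum_smult[OF finite_shift[OF fin]] gsum_shift[OF fin] lact_eq_gsum) simp
qed

lemma lact_add_left: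
  "a \<in> carr C \<Longrightarrow> b \<in> carr C \<Longrightarrow> lact act l (add C a b) p = lact act l a p + lact act l b p"
  by (simp add: lact_eq_gsum act_add_left gsum_add act_finite)

lemma lact_sum:
  assumes "a \<in> carr C"
  shows "lact act l a (\<Sum>i\<in>I. f i) = (\<Sum>i\<in>I. lact act l a (f i))"
  using lact_smult[OF assms, of l 0 0]
  by (induction I rule: infinite_finite_induct) (auto simp: lact_add assms)

text \<open>This is a_\<lambda> p(\<partial>)u = p(\<partial> + \<lambda>)(a_\<lambda> u). The value
  at \<open>x\<close> sees the argument only at \<open>x + l\<close>: if \<open>x\<close> is minus
  the sum of all variables, then \<open>x + l\<close> is minus the sum of the remaining ones, which
  is why the action descends to the reduced complex.\<close>

lemma poly_lact:
  assumes "a \<in> carr C"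
  shows "poly (lact act l a p) x = poly (lact act l a 1) x * poly p (x + l)"
proof (induction p)
  case 0
  then show ?case using lact_smult[OF assms, of l 0 0] by simp
next
  case (pCons c p)
  have "pCons c p = smult c 1 + polyX * p" by simp
  then have "lact act l a (pCons c p) =
      smult c (lact act l a 1) + (polyX * lact act l a p + smult l (lact act l a p))"
    by (simp only: lact_add lact_smult lact_polyX assms)
  then show ?case by (simp add: pCons.IH algebra_simps)
qed

end

context null_bilinear begin

definition lam :: "'c \<Rightarrow> 'c \<Rightarrow> 'k \<Rightarrow> 'k poly" where
  "lam a b l = gsum (\<lambda>n. \<Phi> n a b) l"

lemma
  assumes "a \<in> carr C" "b \<in> carr C"
  shows lam_add_left: "c \<in> carr C \<Longrightarrow> lam (add C a b) c l = lam a c l + lam b c l"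
    and lam_add_right: "c \<in> carr C \<Longrightarrow> lam c (add C a b) l = lam c a l + lam c b l"
    and lam_smul_left: "lam (smul C k a) b l = smult k (lam a b l)"
    and lam_smul_right: "lam a (smul C k b) l = smult k (lam a b l)"
    and lam_der_left: "lam (der C a) b l = smult (- l) (lam a b l)"
    and lam_der_right: "lam a (der C b) l = polyX * lam a b l + smult l (lam a b l)"
proof -
  note fin = coc_finite[OF assms]
  show "lam (add C a b) c l = lam a c l + lam b c l" if "c \<in> carr C"
    using assms that by (simp add: lam_def coc_add_left gsum_add coc_finite)
  show "lam c (add C a b) l = lam c a l + lam c b l" if "c \<in> carr C"
    using assms that by (simp add: lam_def coc_add_right gsum_add coc_finite)
  show "lam (smul C k a) b l = smult k (lam a b l)"
    using assms by (simp add: lam_def coc_smul_left gsum_smult fin)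
  show "lam a (smul C k b) l = smult k (lam a b l)"
    using assms by (simp add: lam_def coc_smul_right gsum_smult fin)
  have "lam (der C a) b l = gsum (\<lambda>n. smult (- 1) (smult (of_nat n) (\<Phi> (n - 1) a b))) l"
    unfolding lam_def coc_der_left[OF assms] by simp
  then show "lam (der C a) b l = smult (- l) (lam a b l)"
    by (simp only: gsum_smult[OF finite_shift[OF fin]] gsum_shift[OF fin] lam_def) simp
  have "lam a (der C b) l =
      gsum (\<lambda>n. polyX * \<Phi> n a b) l + gsum (\<lambda>n. smult (of_nat n) (\<Phi> (n - 1) a b)) l"
    unfolding lam_def coc_der_right[OF assms]
    by (rule gsum_add) (use fin finite_shift[OF fin] in auto)
  then show "lam a (der C b) l = polyX * lam a b l + smult l (lam a b l)"
    by (simp only: gsum_mult[OF fin] gsum_shift[OF fin] lam_def)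
qed

lemma lam_lprod_left:
  assumes "a \<in> carr C" "b \<in> carr C" "c \<in> carr C"
  shows "lam (lprod C l a b) c m = gsum (\<lambda>s. lam (nprod C s a b) c m) l"
  using lam_smul_left[of "zer C" c 0 m] assms
  by (intro lprod_hom[of a b "\<lambda>x. lam x c m"]) (auto simp: lam_add_left lam_smul_left)

lemma lam_lprod_right:
  assumes "a \<in> carr C" "b \<in> carr C" "c \<in> carr C"
  shows "lam a (lprod C m b c) l = gsum (\<lambda>j. lam a (nprod C j b c) l) m"
  using lam_smul_right[of a "zer C" 0 l] assms
  by (intro lprod_hom[of b c "\<lambda>x. lam a x l"]) (auto simp: lam_add_right lam_smul_right)

text \<open>Both sides are polynomial in \<lambda> and \<mu>, so coefficients of \<lambda>^n/n!
  \<mu>^m/m! may be compared. The complex speaks of \<lambda>-products, the null extension of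
  n-products.\<close>

lemma assoc_iff_lam:
  assumes a: "a \<in> carr C" and b: "b \<in> carr C" and c: "c \<in> carr C"
  shows "(\<forall>n m. act n a (\<Phi> m b c) + \<Phi> n a (nprod C m b c) =
        (\<Sum>s\<le>n. smult (of_nat (n choose s)) (\<Phi> (n + m - s) (nprod C s a b) c))) \<longleftrightarrow>
    (\<forall>l m. lact act l a (lam b c m) + lam a (lprod C m b c) l = lam (lprod C l a b) c (l + m))"
    (is "(\<forall>n m. ?f n m = ?h n m) \<longleftrightarrow> (\<forall>l m. ?F l m = ?G l m)")
proof -
  let ?g = "\<lambda>s k. \<Phi> k (nprod C s a b) c"
  obtain L1 where L1: "\<And>j. j \<ge> L1 \<Longrightarrow> \<Phi> j b c = 0"
    using finite_support_bound[OF coc_finite[OF b c]] by blast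
  have "\<exists>L. \<forall>n j. n + j \<ge> L \<longrightarrow> act n a (\<Phi> j b c) = 0"
    by (rule finite_pairs_bound[OF coc_finite[OF b c]]) (auto simp: act_finite a)
  then obtain L2 where L2: "\<And>n j. n + j \<ge> L2 \<Longrightarrow> act n a (\<Phi> j b c) = 0" by blast
  have "\<exists>L. \<forall>n j. n + j \<ge> L \<longrightarrow> \<Phi> n a (nprod C j b c) = 0"
    by (rule finite_pairs_bound[OF nprod_finite[OF b c]]) (auto simp: coc_finite a b c)
  then obtain L3 where L3: "\<And>n j. n + j \<ge> L3 \<Longrightarrow> \<Phi> n a (nprod C j b c) = 0" by blast
  have "\<exists>L. \<forall>k s. k + s \<ge> L \<longrightarrow> ?g s k = 0"
    by (rule finite_pairs_bound[OF nprod_finite[OF a b]]) (auto simp: coc_finite a b c)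
  then obtain L4 where L4: "\<And>k s. k + s \<ge> L4 \<Longrightarrow> ?g s k = 0" by blast
  define L where "L = L1 + L2 + L3 + L4"
  have L: "\<And>j. j \<ge> L \<Longrightarrow> \<Phi> j b c = 0" "\<And>n j. n + j \<ge> L \<Longrightarrow> act n a (\<Phi> j b c) = 0"
    "\<And>n j. n + j \<ge> L \<Longrightarrow> \<Phi> n a (nprod C j b c) = 0" "\<And>s k. s + k \<ge> L \<Longrightarrow> ?g s k = 0"
    by (simp_all add: L_def L1 L2 L3 L4)
  have "?F l m = (\<Sum>n<L. \<Sum>j<L. smult (l ^ n / fact n * (m ^ j / fact j)) (?f n j))" for l m
  proof -
    have "lam b c m = (\<Sum>j<L. smult (m ^ j / fact j) (\<Phi> j b c))"
      unfolding lam_def by (rule gsum_eq) (rule L)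
    then have "lact act l a (lam b c m) = (\<Sum>j<L. smult (m ^ j / fact j) (lact act l a (\<Phi> j b c)))"
      by (simp add: lact_sum lact_smult a)
    moreover have "lact act l a (\<Phi> j b c) = (\<Sum>n<L. smult (l ^ n / fact n) (act n a (\<Phi> j b c)))" for j
      unfolding lact_eq_gsum by (rule gsum_eq) (simp add: L)
    ultimately have 1: "lact act l a (lam b c m) = (\<Sum>n<L. \<Sum>j<L.
        smult (l ^ n / fact n * (m ^ j / fact j)) (act n a (\<Phi> j b c)))"
      by (subst sum.swap) (simp add: smult_sum_right mult.commute)
    have *: "lam a (nprod C j b c) l = (\<Sum>n<L. smult (l ^ n / fact n) (\<Phi> n a (nprod C j b c)))" for j
      unfolding lam_def by (rule gsum_eq) (simp add: L)
    have "lam a (lprod C m b c) l = (\<Sum>j<L. smult (m ^ j / fact j) (lam a (nprod C j b c) l))"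
      unfolding lam_lprod_right[OF a b c] by (rule gsum_eq) (simp add: * L)
    then have 2: "lam a (lprod C m b c) l = (\<Sum>n<L. \<Sum>j<L.
        smult (l ^ n / fact n * (m ^ j / fact j)) (\<Phi> n a (nprod C j b c)))"
      by (subst sum.swap) (simp add: * smult_sum_right mult.commute)
    show ?thesis by (simp add: 1 2 smult_add_right sum.distrib)
  qed
  then have F: "poly (?F l m) x =
      (\<Sum>n<L. \<Sum>j<L. l ^ n / fact n * (m ^ j / fact j) * poly (?f n j) x)" for l m x
    by (simp add: poly_sum del: poly_add)
  have "?G l m = (\<Sum>s<L. \<Sum>k<L. smult (l ^ s / fact s * ((l + m) ^ k / fact k)) (?g s k))" for l m
  proof -
    have *: "lam (nprod C s a b) c (l + m) = (\<Sum>k<L. smult ((l + m) ^ k / fact k) (?g s k))" for s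
      unfolding lam_def by (rule gsum_eq) (simp add: L)
    have "?G l m = (\<Sum>s<L. smult (l ^ s / fact s) (lam (nprod C s a b) c (l + m)))"
      unfolding lam_lprod_left[OF a b c] by (rule gsum_eq) (simp add: * L)
    then show ?thesis by (simp add: * smult_sum_right)
  qed
  then have G': "poly (?G l m) x =
      (\<Sum>s<L. \<Sum>k<L. l ^ s / fact s * ((l + m) ^ k / fact k) * poly (?g s k) x)" for l m x
    by (simp add: poly_sum)
  have G: "poly (?G l m) x =
      (\<Sum>n<L. \<Sum>j<L. l ^ n / fact n * (m ^ j / fact j) * poly (?h n j) x)" for l m x
    by (simp only: G' poly_sum poly_smult) (rule generating_function, simp add: L)
  show ?thesis
  proof
    assume "\<forall>n m. ?f n m = ?h n m"
    then have "poly (?F l m) x = poly (?G l m) x" for l m x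
      unfolding F G by simp
    then show "\<forall>l m. ?F l m = ?G l m"
      by (intro allI poly_ext)
  next
    assume FG: "\<forall>l m. ?F l m = ?G l m"
    show "\<forall>n m. ?f n m = ?h n m"
    proof (intro allI)
      fix n j
      show "?f n j = ?h n j"
      proof (cases "n < L \<and> j < L")
        case True
        have 0: "poly (?f n j) x - poly (?h n j) x = 0" for x
        proof (rule power_sum2_eq_0[where L = L and u = "\<lambda>n j. poly (?f n j) x - poly (?h n j) x"])
          fix l m
          have "poly (?F l m) x - poly (?G l m) x = 0" using FG by simp
          then show "(\<Sum>n<L. \<Sum>j<L. l ^ n / fact n * (m ^ j / fact j) *
              (poly (?f n j) x - poly (?h n j) x)) = 0"
            unfolding F G by (simp only: right_diff_distrib sum_subtractf)
        qed (use True in auto)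
        show ?thesis using 0 by (intro poly_ext) (simp only: right_minus_eq)
      next
        case False
        then have "n + j \<ge> L" by auto
        then show ?thesis by (simp add: L)
      qed
    qed
  qed
qed

end

section \<open>The basic complex and its reduction\<close>

lemma ex_gsum:
  fixes g :: "'k::field_char_0 list \<Rightarrow> 'k poly"
  assumes "polyfun 2 g"
  shows "\<exists>F. finite {n. F n \<noteq> 0} \<and> (\<forall>l x. poly (gsum F l) x = poly (g [l, - x - l]) x)"
proof -
  obtain N and c :: "(nat \<Rightarrow> nat) \<Rightarrow> 'k poly" where c: "\<And>ls. length ls = 2 \<Longrightarrow>
      g ls = (\<Sum>e\<in>({..<2} \<rightarrow>\<^sub>E {..<N}). smult (\<Prod>i<2. (ls ! i) ^ (e i)) (c e))"
    using assms unfolding polyfun_def by blast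
  \<comment> \<open>A polynomial in \<lambda>_1 over k[\<partial>]: here \<open>[:0, 1:]\<close> is
    \<lambda>_1, and \<open>[:- polyX, - 1:]\<close> is \<lambda>_2 = -\<partial> -
    \<lambda>_1.\<close>
  define Q where "Q = (\<Sum>e\<in>({..<2} \<rightarrow>\<^sub>E {..<N}). [:0, 1:] ^ e 0 * [:- polyX, - 1:] ^ e 1 * [:c e:])"
  define F where "F n = smult (fact n) (poly.coeff Q n)" for n
  have "F n = 0" if "n \<ge> Suc (degree Q)" for n
    using that by (simp add: F_def coeff_eq_0)
  then have "gsum F l = (\<Sum>n<Suc (degree Q). smult (l ^ n / fact n) (F n))" for l
    by (rule gsum_eq)
  then have "gsum F l = poly Q [:l:]" for l
    by (simp add: F_def poly_altdef[of Q] lessThan_Suc_atMost poly_const_pow mult.commute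
        del: sum.lessThan_Suc)
  then have "poly (gsum F l) x = poly (g [l, - x - l]) x" for l x
    by (simp add: Q_def poly_sum c eval_nat_numeral lessThan_Suc mult_ac minus_diff_commute[of x l])
  moreover have "finite {n. F n \<noteq> 0}"
    by (rule finite_subset[of _ "{..degree Q}"]) (auto simp: F_def intro: le_degree)
  ultimately show ?thesis by blast
qed

lemma
  assumes "cochain C n \<phi>"
  shows cochain_zero: "\<not> (length as = n \<and> set as \<subseteq> carr C \<and> length ls = n) \<Longrightarrow> \<phi> as ls = 0"
    and cochain_polyfun: "length as = n \<Longrightarrow> set as \<subseteq> carr C \<Longrightarrow> polyfun n (\<phi> as)"
    and cochain_add: "length as = n \<Longrightarrow> set as \<subseteq> carr C \<Longrightarrow> i < n \<Longrightarrow> x \<in> carr C \<Longrightarrow> y \<in> carr C \<Longrightarrow>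
      \<phi> (as[i := add C x y]) ls = \<phi> (as[i := x]) ls + \<phi> (as[i := y]) ls"
    and cochain_smul: "length as = n \<Longrightarrow> set as \<subseteq> carr C \<Longrightarrow> i < n \<Longrightarrow> x \<in> carr C \<Longrightarrow>
      \<phi> (as[i := smul C k x]) ls = smult k (\<phi> (as[i := x]) ls)"
    and cochain_der: "length as = n \<Longrightarrow> set as \<subseteq> carr C \<Longrightarrow> i < n \<Longrightarrow> x \<in> carr C \<Longrightarrow> length ls = n \<Longrightarrow>
      \<phi> (as[i := der C x]) ls = smult (- (ls ! i)) (\<phi> (as[i := x]) ls)"
proof -
  note c = assms[unfolded cochain_def]
  show "\<not> (length as = n \<and> set as \<subseteq> carr C \<and> length ls = n) \<Longrightarrow> \<phi> as ls = 0"
    using c[THEN conjunct1] by blast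
  show "length as = n \<Longrightarrow> set as \<subseteq> carr C \<Longrightarrow> polyfun n (\<phi> as)"
    using c[THEN conjunct2, THEN conjunct1] by blast
  show "length as = n \<Longrightarrow> set as \<subseteq> carr C \<Longrightarrow> i < n \<Longrightarrow> x \<in> carr C \<Longrightarrow> y \<in> carr C \<Longrightarrow>
      \<phi> (as[i := add C x y]) ls = \<phi> (as[i := x]) ls + \<phi> (as[i := y]) ls"
    using c[THEN conjunct2, THEN conjunct2, THEN conjunct1] by blast
  show "length as = n \<Longrightarrow> set as \<subseteq> carr C \<Longrightarrow> i < n \<Longrightarrow> x \<in> carr C \<Longrightarrow>
      \<phi> (as[i := smul C k x]) ls = smult k (\<phi> (as[i := x]) ls)"
    using c[THEN conjunct2, THEN conjunct2, THEN conjunct2, THEN conjunct1] by blast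
  show "length as = n \<Longrightarrow> set as \<subseteq> carr C \<Longrightarrow> i < n \<Longrightarrow> x \<in> carr C \<Longrightarrow> length ls = n \<Longrightarrow>
      \<phi> (as[i := der C x]) ls = smult (- (ls ! i)) (\<phi> (as[i := x]) ls)"
    using c[THEN conjunct2, THEN conjunct2, THEN conjunct2, THEN conjunct2] by blast
qed

lemma cochainI:
  assumes "\<And>as ls. \<not> (length as = n \<and> set as \<subseteq> carr C \<and> length ls = n) \<Longrightarrow> \<phi> as ls = 0"
    and "\<And>as. length as = n \<Longrightarrow> set as \<subseteq> carr C \<Longrightarrow> polyfun n (\<phi> as)"
    and "\<And>as ls i x y. length as = n \<Longrightarrow> set as \<subseteq> carr C \<Longrightarrow> i < n \<Longrightarrow> x \<in> carr C \<Longrightarrow> y \<in> carr C \<Longrightarrow>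
      length ls = n \<Longrightarrow> \<phi> (as[i := add C x y]) ls = \<phi> (as[i := x]) ls + \<phi> (as[i := y]) ls"
    and "\<And>as ls i k x. length as = n \<Longrightarrow> set as \<subseteq> carr C \<Longrightarrow> i < n \<Longrightarrow> x \<in> carr C \<Longrightarrow>
      length ls = n \<Longrightarrow> \<phi> (as[i := smul C k x]) ls = smult k (\<phi> (as[i := x]) ls)"
    and "\<And>as ls i x. length as = n \<Longrightarrow> set as \<subseteq> carr C \<Longrightarrow> i < n \<Longrightarrow> x \<in> carr C \<Longrightarrow>
      length ls = n \<Longrightarrow> \<phi> (as[i := der C x]) ls = smult (- (ls ! i)) (\<phi> (as[i := x]) ls)"
  shows "cochain C n \<phi>"
  unfolding cochain_def
proof (intro conjI allI impI; (elim conjE)?)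
  fix as ls i x y assume *: "length as = n" "set as \<subseteq> carr C" "i < n" "x \<in> carr C" "y \<in> carr C"
  show "\<phi> (as[i := add C x y]) ls = \<phi> (as[i := x]) ls + \<phi> (as[i := y]) ls"
    using assms(3)[OF *] assms(1)[of _ ls] by (cases "length ls = n") simp_all
next
  fix as ls i k x assume *: "length as = n" "set as \<subseteq> carr C" "i < n" "x \<in> carr C"
  show "\<phi> (as[i := smul C k x]) ls = smult k (\<phi> (as[i := x]) ls)"
    using assms(4)[OF *] assms(1)[of _ ls] by (cases "length ls = n") simp_all
qed (use assms in auto)

lemma cochain_diff_smult:
  assumes \<phi>: "cochain C n \<phi>" and \<psi>: "cochain C n \<psi>"
  shows "cochain C n (\<lambda>as ls. \<phi> as ls - smult c (\<psi> as ls))"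
proof (rule cochainI)
  fix as assume "length as = n" "set as \<subseteq> carr C"
  then show "polyfun n (\<lambda>ls. \<phi> as ls - smult c (\<psi> as ls))"
    by (intro polyfun_diff polyfun_smult cochain_polyfun[OF \<phi>] cochain_polyfun[OF \<psi>])
qed (simp_all add: cochain_zero[OF \<phi>] cochain_zero[OF \<psi>] cochain_add[OF \<phi>] cochain_add[OF \<psi>]
  cochain_smul[OF \<phi>] cochain_smul[OF \<psi>] cochain_der[OF \<phi>] cochain_der[OF \<psi>]
  smult_diff_right smult_add_right mult.commute)

text \<open>Division by \<open>\<partial> + \<lambda>\<^sub>1 + \<dots> + \<lambda>\<^sub>n\<close>, which identifies the reduced complex with the
  restriction to \<open>\<partial> = - \<lambda>\<^sub>1 - \<dots> - \<lambda>\<^sub>n\<close>.\<close>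

definition quot_cochain :: "('c, 'k::field_char_0) cochain \<Rightarrow> ('c, 'k) cochain" where
  "quot_cochain \<phi> = (\<lambda>as ls. synthetic_div (\<phi> as ls) (- sum_list ls))"

lemma cdel_synthetic_div:
  "polyX * synthetic_div p (- r) + smult r (synthetic_div p (- r)) = p - [:poly p (- r):]"
  using synthetic_div_correct'[of "- r" p] by (simp add: algebra_simps)

lemma cdel_quot_cochain: "cdel (quot_cochain \<phi>) as ls = \<phi> as ls - [:poly (\<phi> as ls) (- sum_list ls):]"
  unfolding cdel_def quot_cochain_def by (rule cdel_synthetic_div)

lemma cochain_quot_cochain:
  assumes "cochain C n \<phi>"
  shows "cochain C n (quot_cochain \<phi>)"
proof (rule cochainI)
  fix as assume "length as = n" "set as \<subseteq> carr C"
  then show "polyfun n (quot_cochain \<phi> as)"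
    unfolding quot_cochain_def
    by (intro polyfun_synthetic_div cochain_polyfun[OF assms] polyfun_neg_sum_list)
qed (simp_all add: quot_cochain_def cochain_zero[OF assms] cochain_add[OF assms]
  cochain_smul[OF assms] cochain_der[OF assms] synthetic_div_add synthetic_div_smult
  del: smult_minus_left)

lemma list2E:
  assumes "length xs = 2" obtains x y where "xs = [x, y]"
  using assms by (auto simp: numeral_2_eq_2 length_Suc_conv)

lemma list3E:
  assumes "length xs = Suc 2" obtains x y z where "xs = [x, y, z]"
  using assms by (auto simp: numeral_2_eq_2 length_Suc_conv)

section \<open>Reduced 2-cochains as families of n-products\<close>

context conf_mod begin

text \<open>Even if the values of \<open>\<omega>\<close> are free of \<partial>, those of
  a_\<lambda> \<open>\<omega>\<close> are not. For such \<open>\<omega>\<close>,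
  \<open>twist\<close> is the quotient of a_\<lambda> \<open>\<omega>\<close> by \<partial> plus the
  sum of the variables; subtracting \<open>cdel\<close> of it makes the values free of \<partial>
  again.\<close>

definition twist :: "nat \<Rightarrow> ('c, 'k) cochain \<Rightarrow> ('c, 'k) cochain" where
  "twist n \<omega> = (\<lambda>as ls. if length as = Suc n \<and> set as \<subseteq> carr C \<and> length ls = Suc n
     then synthetic_div (lact act (hd ls) (hd as) 1) (- sum_list ls) * \<omega> (tl as) (tl ls) else 0)"

lemma cochain_twist:
  assumes \<omega>: "cochain C n \<omega>"
  shows "cochain C (Suc n) (twist n \<omega>)"
proof (rule cochainI)
  fix as assume as: "length as = Suc n" "set as \<subseteq> carr C"
  then obtain a as' where a: "as = a # as'" "a \<in> carr C" "length as' = n" "set as' \<subseteq> carr C"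
    by (cases as) auto
  obtain N where N: "\<And>n. n \<ge> N \<Longrightarrow> act n a 1 = 0"
    using finite_support_bound[OF act_finite[OF a(2)]] by blast
  have "polyfun (Suc n) (\<lambda>ls. \<Sum>k<N. smult (ls ! 0 ^ k) (smult (1 / fact k) (act k a 1)))"
    by (intro polyfun_sum polyfun_scalar_mult polyfun_scalar_power polyfun_nth polyfun_const) simp
  then have "polyfun (Suc n) (\<lambda>ls. lact act (ls ! 0) a 1)"
    by (simp add: lact_eq_gsum gsum_eq[OF N])
  then have "polyfun (Suc n) (\<lambda>ls. synthetic_div (lact act (ls ! 0) a 1) (- sum_list ls) * \<omega> as' (tl ls))"
    by (intro polyfun_mult polyfun_synthetic_div polyfun_neg_sum_list polyfun_tl
        cochain_polyfun[OF \<omega>] a)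
  moreover have "hd ls = ls ! 0" if "length ls = Suc n" for ls :: "'k list"
    using that by (cases ls) auto
  ultimately show "polyfun (Suc n) (twist n \<omega> as)"
    by (subst polyfun_cong) (use a in \<open>auto simp: twist_def\<close>)
next
  fix as :: "'c list" and ls :: "'k list" and i x y
  assume as: "length as = Suc n" "set as \<subseteq> carr C" "length ls = Suc n"
    and i: "i < Suc n" and x: "x \<in> carr C" "y \<in> carr C"
  obtain a as' where a: "as = a # as'" "a \<in> carr C" "length as' = n" "set as' \<subseteq> carr C"
    using as by (cases as) auto
  obtain l ls' where l: "ls = l # ls'" "length ls' = n" using as by (cases ls) auto
  have sub: "set (as'[j := z]) \<subseteq> carr C" if "z \<in> carr C" for j z
    using a(4) that set_update_subset_insert[of as' j z] by blast
  show "twist n \<omega> (as[i := add C x y]) ls = twist n \<omega> (as[i := x]) ls + twist n \<omega> (as[i := y]) ls"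
    using a l x i by (cases i) (simp_all add: twist_def sub lact_add_left synthetic_div_add
      cochain_add[OF \<omega>] algebra_simps)
next
  fix as :: "'c list" and ls :: "'k list" and i k x
  assume as: "length as = Suc n" "set as \<subseteq> carr C" "length ls = Suc n"
    and i: "i < Suc n" and x: "x \<in> carr C"
  obtain a as' where a: "as = a # as'" "a \<in> carr C" "length as' = n" "set as' \<subseteq> carr C"
    using as by (cases as) auto
  obtain l ls' where l: "ls = l # ls'" "length ls' = n" using as by (cases ls) auto
  have sub: "set (as'[j := z]) \<subseteq> carr C" if "z \<in> carr C" for j z
    using a(4) that set_update_subset_insert[of as' j z] by blast
  show "twist n \<omega> (as[i := smul C k x]) ls = smult k (twist n \<omega> (as[i := x]) ls)"
    using a l x i by (cases i) (simp_all add: twist_def sub lact_smul_left synthetic_div_smult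
      cochain_smul[OF \<omega>])
  show "twist n \<omega> (as[i := der C x]) ls = smult (- (ls ! i)) (twist n \<omega> (as[i := x]) ls)"
    using a l x i by (cases i) (simp_all add: twist_def sub lact_der synthetic_div_smult
      cochain_der[OF \<omega>] del: smult_minus_left)
qed (auto simp: twist_def)

lemma cdel_twist:
  assumes "length as = Suc n" "set as \<subseteq> carr C" "length ls = Suc n" "\<omega> (tl as) (tl ls) = [:r:]"
  shows "cdel (twist n \<omega>) as ls =
    lact act (hd ls) (hd as) [:r:] - [:poly (lact act (hd ls) (hd as) [:r:]) (- sum_list ls):]"
proof -
  have "hd as \<in> carr C" using assms by (cases as) auto
  then have *: "lact act (hd ls) (hd as) [:r:] = smult r (lact act (hd ls) (hd as) 1)"
    using lact_smult[of "hd as" "hd ls" r 1] by simp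
  let ?s = "synthetic_div (lact act (hd ls) (hd as) 1) (- sum_list ls)"
  have "cdel (twist n \<omega>) as ls = smult r (polyX * ?s + smult (sum_list ls) ?s)"
    using assms by (simp add: cdel_def twist_def smult_add_right mult.commute)
  then show ?thesis by (simp only: cdel_synthetic_div) (simp add: * smult_diff_right)
qed

lemma hdiff_2:
  assumes "a \<in> carr C" "b \<in> carr C" "c \<in> carr C"
  shows "hdiff C act 2 \<phi> [a, b, c] [l, m, n] = lact act l a (\<phi> [b, c] [m, n]) -
    \<phi> [lprod C l a b, c] [l + m, n] + \<phi> [a, lprod C m b c] [l, m + n]"
  using assms by (simp add: hdiff_def numeral_2_eq_2 mergeC_def mergeL_def)

lemma hdiff_1:
  assumes "a \<in> carr C" "b \<in> carr C"
  shows "hdiff C act 1 \<phi> [a, b] [l, m] = lact act l a (\<phi> [b] [m]) - \<phi> [lprod C l a b] [l + m]"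
  using assms by (simp add: hdiff_def mergeC_def mergeL_def)

text \<open>\<^term>\<open>\<Phi>\<close> collects the coefficients of the reduction of \<^term>\<open>\<phi>\<close>, in the normalization
  \<open>\<Phi>\<^sub>\<lambda> = \<Sum>\<^sub>n \<lambda>\<^sup>n/n! \<Phi>\<^sub>n\<close>.\<close>

definition reduces_to :: "('c, 'k) cochain \<Rightarrow> (nat \<Rightarrow> 'c \<Rightarrow> 'c \<Rightarrow> 'k poly) \<Rightarrow> bool" where
  "reduces_to \<phi> \<Phi> \<longleftrightarrow> (\<forall>a\<in>carr C. \<forall>b\<in>carr C. \<forall>l x.
     poly (\<phi> [a, b] [l, - x - l]) x = poly (gsum (\<lambda>n. \<Phi> n a b) l) x)"

lemma reduces_toD:
  assumes "reduces_to \<phi> \<Phi>" "a \<in> carr C" "b \<in> carr C" "x + l + m = 0"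
  shows "poly (\<phi> [a, b] [l, m]) x = poly (gsum (\<lambda>n. \<Phi> n a b) l) x"
proof -
  have "m = - x - l" using assms(4) by (simp add: eq_neg_iff_add_eq_0 algebra_simps)
  then show ?thesis using assms by (simp add: reduces_to_def)
qed

lemma red_cocycle_reduces:
  assumes "\<phi> \<in> red_cocycles C act 2"
  obtains \<Phi> where "null_cocycle C act \<Phi>" "reduces_to \<phi> \<Phi>"
proof -
  from assms obtain \<chi> where \<phi>: "cochain C 2 \<phi>" and \<chi>: "hdiff C act 2 \<phi> = cdel \<chi>"
    by (auto simp: red_cocycles_def)
  have "\<exists>F. finite {n. F n \<noteq> 0} \<and> (\<forall>l x. poly (gsum F l) x = poly (\<phi> [a, b] [l, - x - l]) x)"
    if "a \<in> carr C" "b \<in> carr C" for a b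
    by (rule ex_gsum, rule cochain_polyfun[OF \<phi>]) (use that in auto)
  then obtain F where F: "\<And>a b. a \<in> carr C \<Longrightarrow> b \<in> carr C \<Longrightarrow> finite {n. F a b n \<noteq> 0}"
    "\<And>a b l x. a \<in> carr C \<Longrightarrow> b \<in> carr C \<Longrightarrow>
      poly (gsum (F a b) l) x = poly (\<phi> [a, b] [l, - x - l]) x"
    by metis
  note add = cochain_add[OF \<phi>, of "[_, _]" 0, simplified] cochain_add[OF \<phi>, of "[_, _]" 1, simplified]
  note smul = cochain_smul[OF \<phi>, of "[_, _]" 0, simplified] cochain_smul[OF \<phi>, of "[_, _]" 1, simplified]
  note der = cochain_der[OF \<phi>, of "[_, _]" 0 _ "[_, _]", simplified]
    cochain_der[OF \<phi>, of "[_, _]" 1 _ "[_, _]", simplified]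
  define \<Phi> where "\<Phi> n a b = F a b n" for n a b
  have fin: "finite {n. \<Phi> n a b \<noteq> 0}" if "a \<in> carr C" "b \<in> carr C" for a b
    using F(1)[OF that] by (simp add: \<Phi>_def)
  have red: "reduces_to \<phi> \<Phi>" by (simp add: reduces_to_def \<Phi>_def F(2))
  \<comment> \<open>Coefficients of finite support are determined by the values of their generating
    function, so each property of \<open>\<phi>\<close> passes to \<open>\<Phi>\<close>.\<close>
  have eqI: "\<Phi> n a b = G n" if "a \<in> carr C" "b \<in> carr C" "finite {n. G n \<noteq> 0}"
    "\<And>l x. poly (gsum G l) x = poly (\<phi> [a, b] [l, - x - l]) x" for a b n G
    unfolding \<Phi>_def by (rule gsum_inject) (use that F in simp_all)
  have fin2: "finite {n. G n + H n \<noteq> 0}" if "finite {n. G n \<noteq> 0}" "finite {n. H n \<noteq> 0}"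
    for G H :: "nat \<Rightarrow> 'k poly"
    by (rule finite_subset[OF _ finite_UnI[OF that]]) auto
  have fin1: "finite {n. q * G n \<noteq> 0}" if "finite {n. G n \<noteq> 0}" for G :: "nat \<Rightarrow> 'k poly" and q
    by (rule finite_subset[OF _ that]) auto
  have fin1': "finite {n. smult k (G n) \<noteq> 0}" if "finite {n. G n \<noteq> 0}" for G :: "nat \<Rightarrow> 'k poly" and k
    by (rule finite_subset[OF _ that]) auto
  have gs: "poly (gsum (\<lambda>n. \<Phi> n a b) l) x = poly (\<phi> [a, b] [l, - x - l]) x"
    if "a \<in> carr C" "b \<in> carr C" for a b l x
    using F(2)[OF that] by (simp add: \<Phi>_def)
  interpret null_bilinear C act \<Phi>
  proof unfold_locales
    fix a b c n k assume a: "a \<in> carr C" and b: "b \<in> carr C"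
    note f = fin[OF a b]
    show "finite {n. \<Phi> n a b \<noteq> 0}" by (rule f)
    show "\<Phi> n (smul C k a) b = smult k (\<Phi> n a b)" "\<Phi> n a (smul C k b) = smult k (\<Phi> n a b)"
      by (rule eqI; use a b f in \<open>simp add: gsum_smult gs smul fin1'\<close>)+
    show "\<Phi> n (der C a) b = smult (- of_nat n) (\<Phi> (n - 1) a b)"
    proof (rule eqI)
      have 1: "smult (- of_nat n) p = smult (-1) (smult (of_nat n) p)" for n and p :: "'k poly" by simp
      show "finite {n. smult (- of_nat n) (\<Phi> (n - 1) a b) \<noteq> 0}"
        unfolding 1 by (rule fin1'[OF finite_shift[OF f]])
      show "poly (gsum (\<lambda>n. smult (- of_nat n) (\<Phi> (n - 1) a b)) l) x =
          poly (\<phi> [der C a, b] [l, - x - l]) x" for l x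
        unfolding 1 gsum_smult[OF finite_shift[OF f]] gsum_shift[OF f]
        using a b by (simp add: gs der)
    qed (use a b in auto)
    show "\<Phi> n a (der C b) = polyX * \<Phi> n a b + smult (of_nat n) (\<Phi> (n - 1) a b)"
    proof (rule eqI)
      show "finite {n. polyX * \<Phi> n a b + smult (of_nat n) (\<Phi> (n - 1) a b) \<noteq> 0}"
        by (rule fin2[OF fin1[OF f] finite_shift[OF f]])
      show "poly (gsum (\<lambda>n. polyX * \<Phi> n a b + smult (of_nat n) (\<Phi> (n - 1) a b)) l) x =
          poly (\<phi> [a, der C b] [l, - x - l]) x" for l x
        unfolding gsum_add[OF fin1[OF f] finite_shift[OF f]] gsum_mult[OF f] gsum_shift[OF f]
        using a b by (simp add: gs der algebra_simps)
    qed (use a b in auto)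
    assume c: "c \<in> carr C"
    show "\<Phi> n (add C a b) c = \<Phi> n a c + \<Phi> n b c" "\<Phi> n a (add C b c) = \<Phi> n a b + \<Phi> n a c"
      by (rule eqI; use a b c in \<open>simp add: gsum_add gs add fin2 fin\<close>)+
  qed
  have "null_cocycle C act \<Phi>"
  proof unfold_locales
    fix a b c n m assume a: "a \<in> carr C" and b: "b \<in> carr C" and c: "c \<in> carr C"
    have "lact act l a (lam b c m) + lam a (lprod C m b c) l = lam (lprod C l a b) c (l + m)" for l m
    proof (rule poly_ext)
      fix x
      \<comment> \<open>The third variable is chosen so that at \<partial> = x the factor \<partial>
        + \<lambda>_1 + \<lambda>_2 + \<lambda>_3 of \<open>cdel\<close> vanishes.\<close>
      have "poly (hdiff C act 2 \<phi> [a, b, c] [l, m, - x - l - m]) x = 0"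
        by (simp add: \<chi> cdel_def algebra_simps)
      then have "poly (lact act l a (\<phi> [b, c] [m, - x - l - m])) x -
          poly (\<phi> [lprod C l a b, c] [l + m, - x - l - m]) x +
          poly (\<phi> [a, lprod C m b c] [l, m + (- x - l - m)]) x = 0"
        by (simp add: hdiff_2 a b c)
      moreover have "poly (lact act l a (\<phi> [b, c] [m, - x - l - m])) x = poly (lact act l a (lam b c m)) x"
        using reduces_toD[OF red b c, of "x + l" m "- x - l - m"]
        unfolding lam_def poly_lact[OF a, of l "\<phi> _ _"] poly_lact[OF a, of l "gsum _ _"] by simp
      moreover have "poly (\<phi> [lprod C l a b, c] [l + m, - x - l - m]) x = poly (lam (lprod C l a b) c (l + m)) x"
        unfolding lam_def by (rule reduces_toD[OF red]) (use a b c in auto)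
      moreover have "poly (\<phi> [a, lprod C m b c] [l, m + (- x - l - m)]) x = poly (lam a (lprod C m b c) l) x"
        unfolding lam_def by (rule reduces_toD[OF red]) (use a b c in auto)
      ultimately show "poly (lact act l a (lam b c m) + lam a (lprod C m b c) l) x =
          poly (lam (lprod C l a b) c (l + m)) x"
        by (simp add: algebra_simps)
    qed
    then show "act n a (\<Phi> m b c) + \<Phi> n a (nprod C m b c) =
      (\<Sum>s\<le>n. smult (of_nat (n choose s)) (\<Phi> (n + m - s) (nprod C s a b) c))"
      using assoc_iff_lam[OF a b c] by blast
  qed
  then show ?thesis using red by (rule that)
qed

text \<open>The map \<open>u\<close> yields a 1-cochain by restriction to \<partial> = -\<lambda>,
  since \<partial>-linearity then reads as multiplication by -\<lambda>. Its differential agrees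
  with \<open>\<phi>\<close> at \<partial> = -\<lambda>_1 - \<lambda>_2, so the discrepancy is
  divisible by \<partial> + \<lambda>_1 + \<lambda>_2.\<close>

lemma red_coboundaryI:
  assumes \<phi>: "cochain C 2 \<phi>" and red: "reduces_to \<phi> \<Phi>"
    and u: "\<And>a b. a \<in> carr C \<Longrightarrow> b \<in> carr C \<Longrightarrow> u (add C a b) = u a + u b"
      "\<And>k a. a \<in> carr C \<Longrightarrow> u (smul C k a) = smult k (u a)"
      "\<And>a. a \<in> carr C \<Longrightarrow> u (der C a) = polyX * u a"
    and \<Phi>: "\<And>n a b. a \<in> carr C \<Longrightarrow> b \<in> carr C \<Longrightarrow> \<Phi> n a b = act n a (u b) - u (nprod C n a b)"
  shows "\<phi> \<in> red_coboundaries C act 1"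
proof -
  have u0: "u (zer C) = 0" using u(2)[of "zer C" 0] by simp
  define \<psi> :: "('c, 'k) cochain" where "\<psi> = (\<lambda>as ls. if length as = 1 \<and> set as \<subseteq> carr C \<and> length ls = 1
    then [:poly (u (as ! 0)) (- (ls ! 0)):] else 0)"
  have \<psi>: "cochain C 1 \<psi>"
  proof (rule cochainI)
    fix as :: "'c list" assume as: "length as = 1" "set as \<subseteq> carr C"
    have "polyfun 1 (\<lambda>ls. [:poly (u (as ! 0)) (- (ls ! 0)):])"
      using polyfun_smult[OF polyfun_nth[of 0 1], of "-1"]
      by (intro polyfun_poly polyfun_const) simp
    then show "polyfun 1 (\<psi> as)"
      by (subst polyfun_cong) (use as in \<open>auto simp: \<psi>_def\<close>)
  qed (auto simp: \<psi>_def u length_Suc_conv)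
  \<comment> \<open>\<open>quot_cochain\<close> absorbs the dependence of \<open>\<phi>\<close> on
    \<partial>, and \<open>twist\<close> that of the differential of \<open>\<psi>\<close>.\<close>
  define \<chi> where "\<chi> = (\<lambda>as ls. quot_cochain \<phi> as ls - smult 1 (twist 1 \<psi> as ls))"
  have \<chi>: "cochain C (Suc 1) \<chi>"
    unfolding \<chi>_def
    by (rule cochain_diff_smult) (use cochain_twist[OF \<psi>] cochain_quot_cochain[OF \<phi>] in
      \<open>simp_all add: numeral_2_eq_2\<close>)
  have "\<phi> as ls = hdiff C act 1 \<psi> as ls + cdel \<chi> as ls" for as ls
  proof (cases "length as = 2 \<and> set as \<subseteq> carr C \<and> length ls = 2")
    case True
    then have len: "length as = 2" "length ls = 2" by auto
    obtain a b where 1: "as = [a, b]" by (rule list2E[OF len(1)])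
    obtain l m where 2: "ls = [l, m]" by (rule list2E[OF len(2)])
    note as = 1 2
    then have a: "a \<in> carr C" and b: "b \<in> carr C" using True by auto
    have "cdel \<chi> as ls = cdel (quot_cochain \<phi>) as ls - cdel (twist 1 \<psi>) as ls"
      unfolding cdel_def \<chi>_def smult_1_left smult_diff_right right_diff_distrib by (simp only: algebra_simps)
    moreover have "cdel (twist 1 \<psi>) as ls = lact act l a [:poly (u b) (- m):] -
        [:poly (lact act l a [:poly (u b) (- m):]) (- (l + m)):]"
      using cdel_twist[of as 1 ls \<psi> "poly (u b) (- m)"] a b by (simp add: as \<psi>_def)
    moreover have "hdiff C act 1 \<psi> as ls = lact act l a [:poly (u b) (- m):] -
        [:poly (u (lprod C l a b)) (- (l + m)):]"
      using a b unfolding as hdiff_1[OF a b] by (simp add: \<psi>_def)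
    moreover have "poly (\<phi> as ls) (- sum_list ls) =
        poly (lact act l a [:poly (u b) (- m):]) (- (l + m)) - poly (u (lprod C l a b)) (- (l + m))"
    proof -
      have fin: "finite {n. u (nprod C n a b) \<noteq> 0}"
        by (rule finite_subset[OF _ nprod_finite[OF a b]]) (auto simp: u0)
      have fin': "finite {n. smult (-1) (u (nprod C n a b)) \<noteq> 0}"
        by (rule finite_subset[OF _ fin]) auto
      have "poly (\<phi> as ls) (- sum_list ls) = poly (gsum (\<lambda>n. \<Phi> n a b) l) (- (l + m))"
        using reduces_toD[OF red a b, of "- (l + m)" l m] by (simp add: as)
      also have "gsum (\<lambda>n. \<Phi> n a b) l = gsum (\<lambda>n. act n a (u b) + smult (-1) (u (nprod C n a b))) l"
        by (simp add: \<Phi> a b)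
      also have "\<dots> = lact act l a (u b) - u (lprod C l a b)"
        using gsum_add[OF act_finite[OF a] fin', of "u b" l] gsum_smult[OF fin, of "-1" l]
          lprod_hom[OF a b, of u l] u u0
        by (simp add: lact_eq_gsum)
      finally show ?thesis
        using poly_lact[OF a, of l "u b" "- (l + m)"] poly_lact[OF a, of l "[:poly (u b) (- m):]" "- (l + m)"]
        by simp
    qed
    ultimately show ?thesis by (simp add: cdel_quot_cochain)
  next
    case False
    then have "\<chi> as ls = 0" using cochain_zero[OF \<chi>] by (simp add: numeral_2_eq_2)
    moreover have "hdiff C act 1 \<psi> as ls = 0" using False by (auto simp: hdiff_def numeral_2_eq_2)
    ultimately show ?thesis using cochain_zero[OF \<phi> False] by (simp add: cdel_def)
  qed
  then show ?thesis using \<psi> \<chi> unfolding red_coboundaries_def by blast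
qed

end

section \<open>From null cocycles back to the basic complex\<close>

context null_cocycle begin

text \<open>The lift with values free of \<partial>. Restricting to \<partial> = -\<lambda>_1 -
  \<lambda>_2 turns the factor \<partial> + \<lambda>_1 of the second argument back into
  -\<lambda>_2, as a cochain requires.\<close>

definition basic :: "('c, 'k) cochain" where
  "basic = (\<lambda>as ls. if length as = 2 \<and> set as \<subseteq> carr C \<and> length ls = 2
     then [:poly (lam (as ! 0) (as ! 1) (ls ! 0)) (- sum_list ls):] else 0)"

lemma cochain_basic: "cochain C 2 basic"
proof (rule cochainI)
  fix as assume as: "length as = 2" "set as \<subseteq> carr C"
  obtain a b where 1: "as = [a, b]" by (rule list2E[OF as(1)])
  then have ab: "as = [a, b]" "a \<in> carr C" "b \<in> carr C" using as(2) by auto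
  obtain N where N: "\<And>n. n \<ge> N \<Longrightarrow> \<Phi> n a b = 0"
    using finite_support_bound[OF coc_finite[OF ab(2,3)]] by blast
  have "polyfun 2 (\<lambda>ls. \<Sum>k<N. smult (ls ! 0 ^ k) (smult (1 / fact k) (\<Phi> k a b)))"
    by (intro polyfun_sum polyfun_scalar_mult polyfun_scalar_power polyfun_nth polyfun_const) simp
  then have "polyfun 2 (\<lambda>ls. lam a b (ls ! 0))"
    by (simp add: lam_def gsum_eq[OF N])
  then have "polyfun 2 (\<lambda>ls. [:poly (lam a b (ls ! 0)) (- sum_list ls):])"
    by (intro polyfun_poly polyfun_neg_sum_list)
  then show "polyfun 2 (basic as)"
    by (subst polyfun_cong) (use ab in \<open>auto simp: basic_def\<close>)
next
  fix as :: "'c list" and ls :: "'k list" and i :: nat and k x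
  assume as: "length as = 2" "set as \<subseteq> carr C" "i < 2" "x \<in> carr C" "length ls = 2"
  obtain a b where 1: "as = [a, b]" by (rule list2E[OF as(1)])
  obtain l m where 2: "ls = [l, m]" by (rule list2E[OF as(5)])
  note ab = 1 2
  have ab': "a \<in> carr C" "b \<in> carr C" using as(2) 1 by auto
  show "basic (as[i := smul C k x]) ls = smult k (basic (as[i := x]) ls)"
    using ab ab' as(3,4) by (cases i) (auto simp: basic_def lam_smul_left lam_smul_right)
  show "basic (as[i := der C x]) ls = smult (- (ls ! i)) (basic (as[i := x]) ls)"
    using ab ab' as(3,4) by (cases i) (auto simp: basic_def lam_der_left lam_der_right algebra_simps)
  fix y assume "y \<in> carr C"
  then show "basic (as[i := add C x y]) ls = basic (as[i := x]) ls + basic (as[i := y]) ls"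
    using ab ab' as(3,4) by (cases i) (auto simp: basic_def lam_add_left lam_add_right)
qed (auto simp: basic_def)

lemma reduces_to_basic: "reduces_to basic \<Phi>"
  by (simp add: reduces_to_def basic_def lam_def)

text \<open>At \<partial> = -\<lambda>_1 - \<lambda>_2 - \<lambda>_3 the differential vanishes by
  associativity. Only its first term, the action on a constant, depends on \<partial>, and
  \<open>twist\<close> is exactly the quotient of that term's deviation.\<close>

lemma basic_red_cocycle: "basic \<in> red_cocycles C act 2"
proof -
  have "hdiff C act 2 basic as ls = cdel (twist 2 basic) as ls" for as ls
  proof (cases "length as = Suc 2 \<and> set as \<subseteq> carr C \<and> length ls = Suc 2")
    case True
    then have len: "length as = Suc 2" "length ls = Suc 2" by auto
    obtain a b c where 1: "as = [a, b, c]" by (rule list3E[OF len(1)])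
    obtain l m n where 2: "ls = [l, m, n]" by (rule list3E[OF len(2)])
    note as = 1 2
    then have a: "a \<in> carr C" and b: "b \<in> carr C" and c: "c \<in> carr C" using True by auto
    define r where "r = poly (lam b c m) (- (m + n))"
    have bc: "basic [b, c] [m, n] = [:r:]" using b c by (simp add: basic_def r_def)
    have "lact act l a (lam b c m) + lam a (lprod C m b c) l = lam (lprod C l a b) c (l + m)"
      using assoc_iff_lam[OF a b c] coc_assoc[OF a b c] by blast
    then have "poly (lact act l a (lam b c m)) (- (l + m + n)) + poly (lam a (lprod C m b c) l) (- (l + m + n)) =
        poly (lam (lprod C l a b) c (l + m)) (- (l + m + n))"
      by (metis poly_add)
    moreover have "poly (lact act l a (lam b c m)) (- (l + m + n)) = poly (lact act l a [:r:]) (- (l + m + n))"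
      using poly_lact[OF a, of l "lam b c m"] poly_lact[OF a, of l "[:r:]"] by (simp add: r_def)
    ultimately have "[:poly (lact act l a [:r:]) (- (l + m + n)):] -
        basic [lprod C l a b, c] [l + m, n] + basic [a, lprod C m b c] [l, m + n] = 0"
      using a b c by (simp add: basic_def algebra_simps)
    moreover have "cdel (twist 2 basic) as ls = lact act l a [:r:] - [:poly (lact act l a [:r:]) (- (l + m + n)):]"
      using cdel_twist[of as 2 ls basic r] a b c bc by (simp add: as add.assoc)
    ultimately show ?thesis
      unfolding as hdiff_2[OF a b c] bc by algebra
  next
    case False
    then show ?thesis by (auto simp: hdiff_def cdel_def twist_def)
  qed
  then have "hdiff C act 2 basic = cdel (twist 2 basic)" by (intro ext)
  then show ?thesis
    unfolding red_cocycles_def using cochain_basic cochain_twist[OF cochain_basic] by blast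
qed

end

section \<open>Conformal endomorphisms with a deformation parameter\<close>

text \<open>Pascal's rule, in the shape produced when a further derivation is distributed by the
  Leibniz rule.\<close>

lemma sum_pascal:
  fixes G :: "nat \<Rightarrow> nat \<Rightarrow> 'a::comm_ring_1"
  shows "(\<Sum>s\<le>n. of_nat (n choose s) * (G s (Suc (n + m - s)) + G (Suc s) (n + m - s))) =
    (\<Sum>s\<le>Suc n. of_nat (Suc n choose s) * G s (Suc n + m - s))"
proof -
  have "(\<Sum>s\<le>Suc n. of_nat (Suc n choose s) * G s (Suc n + m - s)) =
      G 0 (Suc n + m) + (\<Sum>s\<le>n. of_nat (Suc n choose Suc s) * G (Suc s) (n + m - s))"
    by (subst sum.atMost_Suc_shift) simp
  also have "\<dots> = (G 0 (Suc n + m) + (\<Sum>s\<le>n. of_nat (n choose Suc s) * G (Suc s) (n + m - s))) +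
      (\<Sum>s\<le>n. of_nat (n choose s) * G (Suc s) (n + m - s))"
    by (simp add: distrib_right sum.distrib add_ac)
  also have "G 0 (Suc n + m) + (\<Sum>s\<le>n. of_nat (n choose Suc s) * G (Suc s) (n + m - s)) =
      (\<Sum>s\<le>Suc n. of_nat (n choose s) * G s (Suc n + m - s))"
    by (subst sum.atMost_Suc_shift) simp
  also have "\<dots> = (\<Sum>s\<le>n. of_nat (n choose s) * G s (Suc (n + m - s)))"
    by (simp add: Suc_diff_le binomial_eq_0)
  finally show ?thesis by (simp add: distrib_left sum.distrib)
qed

lemma sum_absorb:
  fixes G :: "nat \<Rightarrow> 'a::comm_ring_1"
  shows "(\<Sum>s\<le>n. of_nat (n choose s) * (of_nat s * G (s - 1))) =
    of_nat n * (\<Sum>s\<le>n - 1. of_nat (n - 1 choose s) * G s)"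
proof (cases n)
  case (Suc k)
  have "(\<Sum>s\<le>Suc k. of_nat (Suc k choose s) * (of_nat s * G (s - 1))) =
      (\<Sum>s\<le>k. of_nat ((Suc k choose Suc s) * Suc s) * G s)"
    by (subst sum.atMost_Suc_shift) (simp add: mult.assoc del: of_nat_Suc binomial_Suc_Suc mult_Suc_right)
  also have "\<dots> = (\<Sum>s\<le>k. of_nat (Suc k * (k choose s)) * G s)"
    by (simp only: Suc_times_binomial mult.commute[of _ "Suc _"])
  also have "\<dots> = of_nat (Suc k) * (\<Sum>s\<le>k. of_nat (k choose s) * G s)"
    by (simp only: sum_distrib_left of_nat_mult mult.assoc)
  finally show ?thesis by (simp only: Suc diff_Suc_1)
qed simp

text \<open>Conformal endomorphisms \<open>\<Sum>\<^sub>i \<partial>\<^sup>i a\<^sub>i\<close> over a commutative ring with derivation, acting by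
  \<open>a\<^bsub>(n)\<^esub> v = a T\<^sup>n v\<close> for \<open>a\<close> in the ring; sesquilinearity forces the rest.\<close>

locale diff_module =
  fixes D :: "'a::comm_ring_1 \<Rightarrow> 'a" and h :: "'a \<Rightarrow> 'v::comm_ring_1" and T :: "'v \<Rightarrow> 'v" and X :: 'v
  assumes h_zero: "h 0 = 0" and h_add: "h (a + b) = h a + h b" and h_mult: "h (a * b) = h a * h b"
    and T_add: "T (v + w) = T v + T w"
    and T_h: "T (h a * v) = h (D a) * v + h a * T v"
    and T_X: "T (X * v) = v + X * T v"
begin

definition nact :: "nat \<Rightarrow> 'a poly \<Rightarrow> 'v \<Rightarrow> 'v" where
  "nact n p v = fold_coeffs (\<lambda>a f n. h a * (T ^^ n) v - of_nat n * f (n - 1)) p (\<lambda>_. 0) n"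

lemma nact_0 [simp]: "nact n 0 v = 0"
  by (simp add: nact_def)

lemma nact_pCons: "nact n (pCons a p) v = h a * (T ^^ n) v - of_nat n * nact (n - 1) p v"
  by (cases "p = 0 \<and> a = 0") (auto simp: nact_def h_zero)

lemma T_0 [simp]: "T 0 = 0"
  using T_add[of 0 0] by simp

lemma T_minus: "T (- v) = - T v"
  using T_add[of v "- v"] by (simp add: eq_neg_iff_add_eq_0 add.commute)

lemma T_diff: "T (v - w) = T v - T w"
  using T_add[of v "- w"] by (simp add: T_minus)

lemma T_of_nat_mult: "T (of_nat n * v) = of_nat n * T v"
  by (induction n) (simp_all add: T_add distrib_right)

lemma funpow_T_0 [simp]: "(T ^^ n) 0 = 0"
  by (induction n) simp_all

lemma funpow_T_add: "(T ^^ n) (v + w) = (T ^^ n) v + (T ^^ n) w"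
  by (induction n) (simp_all add: T_add)

lemma funpow_T_X: "(T ^^ n) (X * v) = X * (T ^^ n) v + of_nat n * (T ^^ (n - 1)) v"
proof (induction n)
  case (Suc n)
  then show ?case
    by (cases n; simp add: T_add T_X T_of_nat_mult; (simp add: algebra_simps T_add T_of_nat_mult)?)
qed simp

lemma funpow_T_const:
  assumes "D c = 0"
  shows "(T ^^ n) (h c * v) = h c * (T ^^ n) v"
  by (induction n) (simp_all add: T_h h_zero assms)

lemma nact_add_left: "nact n (p + q) v = nact n p v + nact n q v"
  by (induction p q arbitrary: n rule: poly_induct2) (simp_all add: nact_pCons h_add algebra_simps)

lemma nact_smult_left: "nact n (smult c p) v = h c * nact n p v"
  by (induction p arbitrary: n) (simp_all add: nact_pCons h_mult algebra_simps)

lemma nact_minus_left: "nact n (- p) v = - nact n p v"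
  using nact_add_left[of n p "- p" v] by (simp add: eq_neg_iff_add_eq_0 add.commute)

lemma nact_of_nat_left: "nact n (of_nat k * p) v = of_nat k * nact n p v"
  by (induction k) (simp_all add: nact_add_left distrib_right)

lemma nact_add_right: "nact n p (v + w) = nact n p v + nact n p w"
  by (induction p arbitrary: n) (simp_all add: nact_pCons funpow_T_add algebra_simps)

lemma nact_const_right: "D c = 0 \<Longrightarrow> nact n p (h c * v) = h c * nact n p v"
  by (induction p arbitrary: n) (simp_all add: nact_pCons funpow_T_const right_diff_distrib mult.left_commute)

lemma nact_X: "nact n p (X * v) = X * nact n p v + of_nat n * nact (n - 1) p v"
proof (induction p arbitrary: n)
  case (pCons a p)
  show ?case
    by (cases n) (simp_all add: nact_pCons funpow_T_X pCons.IH algebra_simps del: funpow.simps)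
qed simp

lemma nact_finite:
  assumes "\<forall>n\<ge>K. (T ^^ n) v = 0"
  shows "finite {n. nact n p v \<noteq> 0}"
proof -
  have "\<exists>N. \<forall>n\<ge>N. nact n p v = 0"
  proof (induction p)
    case (pCons a p)
    then obtain N where "\<forall>n\<ge>N. nact n p v = 0" by blast
    then have "\<forall>n\<ge>Suc (N + K). nact n (pCons a p) v = 0"
      using assms by (auto simp: nact_pCons)
    then show ?case by blast
  qed simp
  then obtain N where "\<forall>n\<ge>N. nact n p v = 0" by blast
  then have "{n. nact n p v \<noteq> 0} \<subseteq> {..<N}" by (auto simp flip: not_le)
  then show ?thesis by (rule finite_subset) simp
qed

end

text \<open>\<open>P\<close> is the algebra acting on itself and \<open>V\<close> a module over it.
  \<open>TP_pCons\<close> makes \<open>TP\<close> the derivation that is \<open>D\<close> on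
  coefficients and has value 1 at \<partial>; this is what the Leibniz rule \<open>T_nact\<close>
  requires.\<close>

locale diff_module_pair =
  P: diff_module D "\<lambda>a. [:a:]" TP "[:0, 1:]" + V: diff_module D h T X
  for D :: "'a::comm_ring_1 \<Rightarrow> 'a" and TP :: "'a poly \<Rightarrow> 'a poly"
    and h :: "'a \<Rightarrow> 'v::comm_ring_1" and T X +
  assumes TP_pCons: "TP (pCons a p) = [:D a:] + p + pCons 0 (TP p)"
begin

lemma T_nact: "T (V.nact m q v) = V.nact (Suc m) q v + V.nact m (TP q) v"
proof (induction q arbitrary: m)
  case (pCons b q)
  show ?case
    by (cases m; simp add: V.nact_pCons V.nact_add_left TP_pCons V.T_diff V.T_h V.T_of_nat_mult
      V.T_add V.h_zero pCons.IH; (simp add: algebra_simps V.T_add V.T_of_nat_mult pCons.IH)?)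
qed simp

text \<open>When \<open>h\<close> preserves 1, the n-th action of 1 is \<open>T ^^ n\<close>, so
  this is associativity with first factor 1. Scaling by ring elements and induction on the power of
  \<partial> then give the general first factor.\<close>

lemma funpow_T_nact:
  "(T ^^ n) (V.nact m q v) = (\<Sum>s\<le>n. of_nat (n choose s) * V.nact (n + m - s) ((TP ^^ s) q) v)"
proof (induction n)
  case (Suc n)
  have T_sum: "T (\<Sum>s\<in>I. f s) = (\<Sum>s\<in>I. T (f s))" for f and I :: "nat set"
    by (induction I rule: infinite_finite_induct) (auto simp: V.T_add)
  show ?case
    using sum_pascal[of n "\<lambda>s r. V.nact r ((TP ^^ s) q) v" m]
    by (simp add: Suc.IH T_sum V.T_of_nat_mult T_nact del: sum.atMost_Suc)
qed simp

lemma nact_assoc: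
  "V.nact n p (V.nact m q v) = (\<Sum>s\<le>n. of_nat (n choose s) * V.nact (n + m - s) (P.nact s p q) v)"
proof (induction p arbitrary: n)
  case (pCons a p)
  have "V.nact n (pCons a p) (V.nact m q v) =
      (\<Sum>s\<le>n. of_nat (n choose s) * (h a * V.nact (n + m - s) ((TP ^^ s) q) v)) -
      of_nat n * (\<Sum>s\<le>n - 1. of_nat (n - 1 choose s) * V.nact (n - 1 + m - s) (P.nact s p q) v)"
    by (simp add: V.nact_pCons pCons.IH funpow_T_nact sum_distrib_left mult_ac)
  also have "of_nat n * (\<Sum>s\<le>n - 1. of_nat (n - 1 choose s) * V.nact (n - 1 + m - s) (P.nact s p q) v) =
      (\<Sum>s\<le>n. of_nat (n choose s) * (of_nat s * V.nact (n - 1 + m - (s - 1)) (P.nact (s - 1) p q) v))"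
    by (rule sum_absorb[symmetric])
  \<comment> \<open>At \<open>s = 0\<close> the factor \<open>of_nat s\<close> is zero, so the
    truncated \<open>s - 1\<close> is harmless.\<close>
  also have "\<dots> = (\<Sum>s\<le>n. of_nat (n choose s) * (of_nat s * V.nact (n + m - s) (P.nact (s - 1) p q) v))"
    by (intro sum.cong refl) (auto simp: gr0_conv_Suc split: nat_diff_split)
  also have "(\<Sum>s\<le>n. of_nat (n choose s) * (h a * V.nact (n + m - s) ((TP ^^ s) q) v)) - \<dots> =
      (\<Sum>s\<le>n. of_nat (n choose s) * V.nact (n + m - s) (P.nact s (pCons a p) q) v)"
    by (simp add: P.nact_pCons V.nact_add_left[of _ "smult _ _" "- _", simplified] V.nact_smult_left
        V.nact_minus_left V.nact_of_nat_left sum_subtractf right_diff_distrib)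
  finally show ?case .
qed simp

end

text \<open>The coefficient ring is \<open>k[x][\<epsilon>]\<close> with the derivation \<open>d/dx\<close>; on \<open>k[x][\<epsilon>]\<close> itself
  \<open>\<partial>\<close> acts as multiplication by \<open>x\<close>.\<close>

definition dx :: "'k::field_char_0 poly poly \<Rightarrow> 'k poly poly" where
  "dx p = map_poly pderiv p"

definition dtot :: "'k::field_char_0 poly poly poly \<Rightarrow> 'k poly poly poly" where
  "dtot p = map_poly dx p + pderiv p"

lemma coeff_dx: "poly.coeff (dx p) i = pderiv (poly.coeff p i)"
  by (simp add: dx_def coeff_map_poly)

lemma dx_0 [simp]: "dx 0 = 0"
  by (simp add: dx_def)

lemma coeff_dtot: "poly.coeff (dtot p) i = dx (poly.coeff p i) + of_nat (Suc i) * poly.coeff p (Suc i)"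
  by (simp add: dtot_def coeff_map_poly coeff_pderiv)

lemma dx_add: "dx (p + q) = dx p + dx q"
  by (rule poly_eqI) (simp add: coeff_dx pderiv_add)

lemma pderiv_sum: "pderiv (\<Sum>i\<in>I. f i) = (\<Sum>i\<in>I. pderiv (f i))"
  by (induction I rule: infinite_finite_induct) (auto simp: pderiv_add)

lemma dx_mult: "dx (p * q) = dx p * q + p * dx q"
  by (rule poly_eqI)
    (simp add: coeff_dx coeff_mult pderiv_sum pderiv_mult sum.distrib add.commute
      mult.commute[of "poly.coeff q _"])

lemma dx_const: "dx [:[:c:]:] = 0"
  by (rule poly_eqI) (simp add: coeff_dx coeff_pCons split: nat.splits)

lemma dtot_pCons: "dtot (pCons a p) = [:dx a:] + p + pCons 0 (dtot p)"
  by (rule poly_eqI) (simp add: coeff_dtot coeff_pCons algebra_simps split: nat.splits)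

interpretation Cend: diff_module_pair dx dtot "\<lambda>a. [:a:]" dtot "[:0, 1:]"
proof unfold_locales
  show "dtot (v + w) = dtot v + dtot w" for v w :: "'a poly poly poly"
    by (rule poly_eqI) (simp add: coeff_dtot dx_add algebra_simps)
  show "dtot ([:a:] * v) = [:dx a:] * v + [:a:] * dtot v" for a and v :: "'a poly poly poly"
    by (rule poly_eqI) (simp add: coeff_dtot dx_mult algebra_simps)
  show "dtot ([:0, 1:] * v) = v + [:0, 1:] * dtot v" for v :: "'a poly poly poly"
    by (simp add: dtot_pCons)
qed (simp_all add: dtot_pCons)

interpretation Mod: diff_module_pair dx dtot "\<lambda>a. a" dx "[:[:0, 1:]:]"
proof unfold_locales
  show "dx ([:[:0, 1:]:] * v) = v + [:[:0, 1:]:] * dx v" for v :: "'a poly poly"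
  proof -
    have "dx [:[:0, 1:]:] = (1 :: 'a poly poly)"
      by (rule poly_eqI) (simp add: coeff_dx coeff_pCons pderiv_pCons split: nat.splits)
    then show ?thesis by (simp only: dx_mult) simp
  qed
qed (simp_all add: dx_add dx_mult dtot_pCons)

lemma dx_nilpotent: "\<exists>K. \<forall>n\<ge>K. (dx ^^ n) (p :: 'a::field_char_0 poly poly) = 0"
proof -
  have co: "poly.coeff ((dx ^^ n) p) i = (pderiv ^^ n) (poly.coeff p i)" for n i
    by (induction n) (simp_all add: coeff_dx)
  have zero: "(pderiv ^^ n) 0 = (0 :: 'a poly)" for n by (induction n) auto
  have nil: "(pderiv ^^ n) q = 0" if "n > degree q" for n and q :: "'a poly"
    using that
  proof (induction n arbitrary: q)
    case (Suc n)
    have "(pderiv ^^ n) (pderiv q) = 0"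
    proof (cases "degree q = 0")
      case True
      then have "pderiv q = 0" by (simp add: pderiv_eq_0_iff)
      then show ?thesis by (simp add: zero)
    next
      case False
      then show ?thesis using Suc by (intro Suc.IH) (simp add: degree_pderiv)
    qed
    then show ?case by (simp only: funpow_Suc_right o_apply)
  qed simp
  define K where "K i = Suc (degree (poly.coeff p i))" for i
  have K: "(pderiv ^^ n) (poly.coeff p i) = 0" if "n \<ge> K i" for i n
    using that by (intro nil) (simp add: K_def)
  have "\<forall>n\<ge>\<Sum>i\<le>degree p. K i. (dx ^^ n) p = 0"
  proof (intro allI impI)
    fix n assume n: "n \<ge> (\<Sum>i\<le>degree p. K i)"
    show "(dx ^^ n) p = 0"
    proof (rule poly_eqI)
      fix i
      show "poly.coeff ((dx ^^ n) p) i = poly.coeff 0 i"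
      proof (cases "i \<le> degree p")
        case True
        then have "K i \<le> (\<Sum>i\<le>degree p. K i)" by (intro member_le_sum) simp_all
        then have "K i \<le> n" using n by (rule le_trans)
        then show ?thesis by (simp only: co K coeff_0)
      next
        case False
        then have "poly.coeff p i = 0" by (intro coeff_eq_0) simp
        then show ?thesis by (simp only: co zero coeff_0)
      qed
    qed
  qed
  then show ?thesis ..
qed

lemma dtot_nilpotent: "\<exists>K. \<forall>n\<ge>K. (dtot ^^ n) p = 0"
proof (induction p)
  case (pCons a p)
  from pCons.IH obtain K where K: "\<forall>n\<ge>K. (dtot ^^ n) p = 0" ..
  from dx_nilpotent[of a] obtain L where L: "\<forall>n\<ge>L. (dx ^^ n) a = 0" ..
  have const: "(dtot ^^ n) [:a:] = [:(dx ^^ n) a:]" for n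
    by (induction n) (simp_all add: dtot_pCons)
  have "\<forall>n\<ge>Suc (K + L). (dtot ^^ n) (pCons a p) = 0"
  proof (intro allI impI)
    fix n assume n: "n \<ge> Suc (K + L)"
    have "pCons a p = [:a:] + [:0, 1:] * p" by simp
    then have "(dtot ^^ n) (pCons a p) =
        [:(dx ^^ n) a:] + ([:0, 1:] * (dtot ^^ n) p + of_nat n * (dtot ^^ (n - 1)) p)"
      by (simp only: Cend.P.funpow_T_add Cend.P.funpow_T_X const)
    moreover have "(dx ^^ n) a = 0" "(dtot ^^ n) p = 0" "(dtot ^^ (n - 1)) p = 0"
      using n by (intro K[rule_format] L[rule_format]; simp)+
    ultimately show "(dtot ^^ n) (pCons a p) = 0" by simp
  qed
  then show ?case ..
qed simp

section \<open>The algebra of conformal endomorphisms of k[x][\<epsilon>]\<close>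

definition cend :: "('k::field_char_0, 'k poly poly poly) confalg" where
  "cend = \<lparr>carr = UNIV, zer = 0, add = (+), smul = \<lambda>k. smult [:[:k:]:], der = \<lambda>p. [:0, 1:] * p,
     nprod = Cend.P.nact\<rparr>"

lemma cend_simps [simp]:
  "carr cend = UNIV" "zer cend = 0" "add cend p q = p + q" "smul cend k p = smult [:[:k:]:] p"
  "der cend p = [:0, 1:] * p" "nprod cend n p q = Cend.P.nact n p q"
  by (simp_all add: cend_def)

lemma csumn_cend: "csumn cend f n = (\<Sum>i<n. f i)"
proof -
  have "foldr (\<lambda>i acc. add cend (f i) acc) xs 0 = (\<Sum>i\<leftarrow>xs. f i)" for xs
    by (induction xs) auto
  from this[of "[0..<n]"] show ?thesis
    by (simp add: csumn_def interv_sum_list_conv_sum_set_nat atLeast0LessThan del: cend_simps(3))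
qed

lemma smult_of_nat2: "smult [:[:of_nat n:]:] p = of_nat n * (p :: 'k::field_char_0 poly poly poly)"
  by (simp add: of_nat_poly)

lemma smult_neg_of_nat2:
  "smult [:[:- of_nat n:]:] p = - (of_nat n * (p :: 'k::field_char_0 poly poly poly))"
  by (simp add: of_nat_poly flip: smult_minus_left)

lemma assoc_confalg_cend: "assoc_confalg (cend :: ('k::field_char_0, _) confalg)"
  unfolding assoc_confalg_def
proof (intro conjI ballI allI)
  have "smult [:[:k + l:]:] p = smult [:[:k:]:] p + smult [:[:l:]:] p"
    and "smult [:[:1:]:] p = p" for k l :: 'k and p :: "'k poly poly poly"
    by (simp flip: smult_add_left) (simp flip: one_pCons)
  then show "kspace (cend :: ('k, _) confalg)"
    by (auto simp: kspace_def smult_add_right smult_add_left algebra_simps intro: exI[of _ "- _"])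
next
  fix n m and a b c :: "'k poly poly poly"
  show "nprod cend n a (nprod cend m b c) = csumn cend
      (\<lambda>s. smul cend (of_nat (n choose s)) (nprod cend (n + m - s) (nprod cend s a b) c)) (Suc n)"
    by (simp add: csumn_cend smult_of_nat2 Cend.nact_assoc lessThan_Suc_atMost del: sum.lessThan_Suc)
next
  fix n and a b :: "'k poly poly poly" and k :: 'k
  show "nprod cend n a (smul cend k b) = smul cend k (nprod cend n a b)"
    using Cend.P.nact_const_right[OF dx_const, of n a k b] by simp
  show "nprod cend n (der cend a) b = smul cend (- of_nat n) (nprod cend (n - 1) a b)"
    by (simp add: Cend.P.nact_pCons smult_neg_of_nat2)
  show "nprod cend n a (der cend b) =
      add cend (der cend (nprod cend n a b)) (smul cend (of_nat n) (nprod cend (n - 1) a b))"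
    by (simp only: cend_simps Cend.P.nact_X smult_of_nat2)
  obtain K where "\<forall>n\<ge>K. (dtot ^^ n) b = 0" using dtot_nilpotent by blast
  then show "finite {n. nprod cend n a b \<noteq> zer cend}"
    by (simp add: Cend.P.nact_finite)
qed (simp_all add: Cend.P.nact_add_left Cend.P.nact_add_right Cend.P.nact_smult_left smult_add_right
  mult.commute)

text \<open>The image of \<open>v\<close>: \<open>x - (1 + \<epsilon>) \<partial>\<close> acts with \<open>\<lambda>\<close>-product \<open>\<partial> + (1 + \<epsilon>) \<lambda>\<close>, because \<open>\<partial>\<close> in the
  left argument becomes \<open>- \<lambda>\<close>.\<close>

definition gen :: "'k::field_char_0 poly poly poly" where
  "gen = [:[:[:0, 1:]:], - [:1, 1:]:]"

lemma U3_rel_cend: "U3_rel cend (gen :: 'k::field_char_0 poly poly poly)"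
proof -
  \<comment> \<open>The contributions 1 of d/dx and -(1 + \<epsilon>) of d/d\<partial> add up to
    -\<epsilon>, a constant. Since the n-th product with \<open>gen\<close> on the left involves
    only derivatives of order n and n - 1, those of \<open>gen\<close> with itself vanish from n = 3
    on.\<close>
  have T1: "dtot (gen :: 'k poly poly poly) = [:[:0, -1:]:]"
    by (rule poly_eqI)
      (auto simp: gen_def coeff_dtot coeff_pCons dx_def map_poly_pCons pderiv_pCons pderiv_minus one_pCons split: nat.splits)
  have T2: "dtot (dtot (gen :: 'k poly poly poly)) = 0"
  proof -
    have "dx [:0, - 1:] = (0 :: 'k poly poly)"
      by (rule poly_eqI) (simp add: coeff_dx coeff_pCons pderiv_minus split: nat.splits)
    then show ?thesis by (simp add: T1 dtot_pCons)
  qed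
  have T: "(dtot ^^ n) (gen :: 'k poly poly poly) = 0" if "n \<ge> 2" for n
  proof -
    have "(dtot ^^ (n - 2 + 2)) gen = (dtot ^^ (n - 2)) (dtot (dtot (gen :: 'k poly poly poly)))"
      by (simp only: funpow_add o_apply) (simp add: numeral_2_eq_2)
    also have "\<dots> = 0" by (simp only: T2 Cend.P.funpow_T_0)
    also have "n - 2 + 2 = n" using that by simp
    finally show ?thesis .
  qed
  have act: "Cend.P.nact n gen p =
      smult [:[:0, 1:]:] ((dtot ^^ n) p) + of_nat n * smult [:1, 1:] ((dtot ^^ (n - 1)) p)"
    for n and p :: "'k poly poly poly"
    by (simp add: gen_def Cend.P.nact_pCons flip: smult_minus_left)
  show ?thesis
    unfolding U3_rel_def
  proof (intro conjI allI impI)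
    show "nprod cend n (gen :: 'k poly poly poly) gen = zer cend" if "n \<ge> 3" for n
      using that by (simp add: act T)
    show "add cend (smul cend 2 (nprod cend 1 gen gen)) (smul cend (-1) (der cend (nprod cend 2 gen gen))) =
        smul cend 2 (gen :: 'k poly poly poly)"
    proof -
      have "Cend.P.nact 1 gen (gen :: 'k poly poly poly) =
          smult [:[:0, 1:]:] [:[:0, - 1:]:] + smult [:1, 1:] gen"
        by (simp only: act) (simp add: T1)
      moreover have "Cend.P.nact 2 gen (gen :: 'k poly poly poly) =
          smult [:1, 1:] [:[:0, - 1:]:] + smult [:1, 1:] [:[:0, - 1:]:]"
        by (simp only: act T[OF order_refl] of_nat_numeral mult_2) (simp add: T1)
      ultimately show ?thesis
        by (simp only: cend_simps) (simp add: gen_def one_pCons)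
    qed
  qed simp
qed

section \<open>First-order expansion in \<epsilon>\<close>

lemma coeff_of_nat_times: "poly.coeff (of_nat n * p) j = of_nat n * poly.coeff p (j :: nat)"
  for p :: "'k::comm_ring_1 poly"
  by (simp add: of_nat_poly)

lemma of_nat_mult_poly: "of_nat n * p = smult (of_nat n) (p :: 'k::comm_ring_1 poly)"
  by (simp add: of_nat_poly)

lemma coeff_funpow_dx: "poly.coeff ((dx ^^ n) p) i = (pderiv ^^ n) (poly.coeff p i)"
  by (induction n) (simp_all add: coeff_dx)

lemma funpow_dx_const: "(dx ^^ n) [:p:] = [:(pderiv ^^ n) p:]"
proof (rule poly_eqI)
  have zero: "(pderiv ^^ n) 0 = (0 :: 'a poly)" by (induction n) auto
  show "poly.coeff ((dx ^^ n) [:p:]) i = poly.coeff [:(pderiv ^^ n) p:] i" for i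
    by (cases i) (simp_all only: coeff_funpow_dx coeff_pCons_0 coeff_pCons_Suc coeff_0 zero)
qed

lemma coeff_mult_1: "poly.coeff (p * q) 1 = poly.coeff p 0 * poly.coeff q 1 + poly.coeff p 1 * poly.coeff q 0"
  by (simp add: coeff_mult)

text \<open>\<open>dx\<close> does not touch \<epsilon>, so the action is linear over k[\<epsilon>],
  and coefficients in \<epsilon> multiply as in a product of polynomials.\<close>

lemma coeff_Mod_nact:
  fixes P :: "'k::field_char_0 poly poly poly"
  shows "poly.coeff (Mod.V.nact n P w) 0 = poly.coeff (Mod.V.nact n P [:poly.coeff w 0:]) 0"
    and "poly.coeff (Mod.V.nact n P w) 1 =
      poly.coeff (Mod.V.nact n P [:poly.coeff w 0:]) 1 + poly.coeff (Mod.V.nact n P [:poly.coeff w 1:]) 0"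
proof (induction P arbitrary: n)
  case (pCons a P)
  have const_1: "poly.coeff [:x:] 1 = 0" for x :: "'k poly" by simp
  { case 1
    show ?case
      by (simp only: Mod.V.nact_pCons coeff_diff coeff_mult_0[of a] coeff_of_nat_times coeff_funpow_dx
          funpow_dx_const coeff_pCons_0 pCons.IH(1)[of "n - 1"]) }
  { case 2
    show ?case
      by (simp only: Mod.V.nact_pCons coeff_diff coeff_mult_1[of a] coeff_of_nat_times coeff_funpow_dx
          funpow_dx_const coeff_pCons_0 const_1 pCons.IH(2)[of "n - 1"])
        (simp add: algebra_simps) }
qed simp_all

text \<open>On \<open>gen\<close>, \<open>comp 0\<close> is the action of \<open>v\<close> at
  \<Delta> = 1 and \<open>comp 1\<close> its derivative in \<Delta>.\<close>

definition comp :: "nat \<Rightarrow> nat \<Rightarrow> 'k::field_char_0 poly poly poly \<Rightarrow> 'k poly \<Rightarrow> 'k poly" where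
  "comp j n P p = poly.coeff (Mod.V.nact n P [:p:]) j"

lemma
  fixes P :: "'k::field_char_0 poly poly poly"
  shows comp_add_right: "comp j n P (p + q) = comp j n P p + comp j n P q"
    and comp_smult_right: "comp j n P (smult k p) = smult k (comp j n P p)"
    and comp_add_left: "comp j n (P + Q) p = comp j n P p + comp j n Q p"
    and comp_smult_left: "comp j n (smult [:[:k:]:] P) p = smult k (comp j n P p)"
    and comp_finite: "finite {n. comp j n P p \<noteq> 0}"
    and comp_der: "comp j n ([:0, 1:] * P) p = smult (- of_nat n) (comp j (n - 1) P p)"
    and comp_polyX: "comp j n P (polyX * p) = polyX * comp j n P p + smult (of_nat n) (comp j (n - 1) P p)"
proof -
  show "comp j n P (p + q) = comp j n P p + comp j n P q"
    using Mod.V.nact_add_right[of n P "[:p:]" "[:q:]"] by (simp add: comp_def)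
  show "comp j n P (smult k p) = smult k (comp j n P p)"
    using Mod.V.nact_const_right[OF dx_const, of n P k "[:p:]"] by (simp add: comp_def)
  show "comp j n (P + Q) p = comp j n P p + comp j n Q p"
    by (simp add: comp_def Mod.V.nact_add_left)
  show "comp j n (smult [:[:k:]:] P) p = smult k (comp j n P p)"
    by (simp add: comp_def Mod.V.nact_smult_left)
  show "finite {n. comp j n P p \<noteq> 0}"
  proof -
    from dx_nilpotent[of "[:p:]"] obtain K where "\<forall>n\<ge>K. (dx ^^ n) [:p:] = 0" ..
    then have "finite {n. Mod.V.nact n P [:p:] \<noteq> 0}" by (rule Mod.V.nact_finite)
    then show ?thesis by (rule rev_finite_subset) (auto simp: comp_def)
  qed
  show "comp j n ([:0, 1:] * P) p = smult (- of_nat n) (comp j (n - 1) P p)"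
    by (simp add: comp_def Mod.V.nact_pCons coeff_of_nat_times of_nat_mult_poly)
  show "comp j n P (polyX * p) = polyX * comp j n P p + smult (of_nat n) (comp j (n - 1) P p)"
    using Mod.V.nact_X[of n P "[:p:]"] by (simp add: comp_def coeff_of_nat_times of_nat_mult_poly)
qed

text \<open>Coefficients of \<epsilon>^0 and \<epsilon>^1 in associativity. The second is a Leibniz
  rule, and with a module map in the last argument it becomes the cocycle identity.\<close>

lemma
  fixes P Q :: "'k::field_char_0 poly poly poly"
  shows comp_0_assoc: "comp 0 n P (comp 0 m Q p) =
      (\<Sum>s\<le>n. smult (of_nat (n choose s)) (comp 0 (n + m - s) (Cend.P.nact s P Q) p))"
    and comp_1_assoc: "comp 0 n P (comp 1 m Q p) + comp 1 n P (comp 0 m Q p) =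
      (\<Sum>s\<le>n. smult (of_nat (n choose s)) (comp 1 (n + m - s) (Cend.P.nact s P Q) p))"
proof -
  have "poly.coeff (Mod.V.nact n P (Mod.V.nact m Q [:p:])) j =
      (\<Sum>s\<le>n. smult (of_nat (n choose s)) (comp j (n + m - s) (Cend.P.nact s P Q) p))" for j
    by (simp add: Mod.nact_assoc coeff_sum coeff_of_nat_times of_nat_mult_poly comp_def)
  from this[of 0] this[of 1] show "comp 0 n P (comp 0 m Q p) =
      (\<Sum>s\<le>n. smult (of_nat (n choose s)) (comp 0 (n + m - s) (Cend.P.nact s P Q) p))"
    "comp 0 n P (comp 1 m Q p) + comp 1 n P (comp 0 m Q p) =
      (\<Sum>s\<le>n. smult (of_nat (n choose s)) (comp 1 (n + m - s) (Cend.P.nact s P Q) p))"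
    unfolding coeff_Mod_nact(1)[of n P "Mod.V.nact m Q [:p:]"]
      coeff_Mod_nact(2)[of n P "Mod.V.nact m Q [:p:]"] comp_def
    by (simp_all only: add.commute)
qed

lemma comp_gen_one:
  "comp 0 n gen 1 = (if n = 0 then polyX else if n = 1 then 1 else (0 :: 'k::field_char_0 poly))"
  "comp 1 n gen 1 = (if n = 1 then 1 else (0 :: 'k::field_char_0 poly))"
proof -
  have dx1: "(dx ^^ n) [:1 :: 'k poly:] = (if n = 0 then [:1:] else 0)" for n
  proof -
    have "(pderiv ^^ Suc k) (1 :: 'k poly) = 0" for k by (induction k) auto
    then show ?thesis unfolding funpow_dx_const by (cases n) (simp, simp only: nat.distinct if_False pCons_0_0)
  qed
  have "Mod.V.nact n gen [:1 :: 'k poly:] =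
      [:[:0, 1:]:] * (dx ^^ n) [:1:] + of_nat n * ([:1, 1:] * (dx ^^ (n - 1)) [:1:])"
    by (simp only: gen_def Mod.V.nact_pCons Mod.V.nact_0 mult_zero_right diff_0_right mult_minus_left
        mult_minus_right diff_minus_eq_add)
  then show "comp 0 n gen 1 = (if n = 0 then polyX else if n = 1 then 1 else (0 :: 'k poly))"
    "comp 1 n gen 1 = (if n = 1 then 1 else (0 :: 'k poly))"
    by (auto simp: comp_def dx1 coeff_of_nat_times)
qed

section \<open>The second cohomology group\<close>

text \<open>Associativity for the m-th action of x on the n-th action of y contains the n-th action
  of x_(m) y with coefficient 1, at \<open>s = m\<close>; the other terms involve x_(s) y with s <
  m. Induction on m thus extends agreement from x and y to their products.\<close>

lemma (in conf_mod) conf_module_unique: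
  assumes act': "conf_module C act'" and gen: "generated_by C v" and v: "v \<in> carr C"
    and eq: "\<And>n. act n v 1 = act' n v 1"
    and a: "a \<in> carr C"
  shows "act n a p = act' n a p"
proof -
  interpret M': conf_mod C act' by unfold_locales (rule act')
  define S where "S = {a \<in> carr C. \<forall>n p. act n a p = act' n a p}"
  have "act n v p = act' n v p" for n p
  proof (induction p arbitrary: n)
    case (pCons c p)
    have "pCons c p = smult c 1 + polyX * p" by simp
    then show ?case
      using v by (simp only: act_add act_smult act_polyX M'.act_add M'.act_smult M'.act_polyX eq pCons.IH)
  qed (simp add: v)
  then have "v \<in> S" by (simp add: S_def v)
  moreover have "zer C \<in> S"
    using act_smul_left[of "zer C" _ 0] M'.act_smul_left[of "zer C" _ 0] by (simp add: S_def)
  moreover have "nprod C m x y \<in> S" if x: "x \<in> S" and y: "y \<in> S" for m x y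
  proof -
    have xy: "x \<in> carr C" "y \<in> carr C" using x y by (auto simp: S_def)
    have "act n (nprod C m x y) p = act' n (nprod C m x y) p" for n p
    proof (induction m arbitrary: n rule: less_induct)
      case (less m)
      have split: "(\<Sum>s\<le>m. smult (of_nat (m choose s)) (g s (m + n - s))) =
          (\<Sum>s<m. smult (of_nat (m choose s)) (g s (m + n - s))) + g m n"
        for g :: "nat \<Rightarrow> nat \<Rightarrow> 'k poly"
        by (cases m) (simp_all add: lessThan_Suc_atMost)
      have "act m x (act n y p) = act' m x (act' n y p)"
        using x y by (simp add: S_def)
      then have "(\<Sum>s<m. smult (of_nat (m choose s)) (act (m + n - s) (nprod C s x y) p)) +
          act n (nprod C m x y) p =
          (\<Sum>s<m. smult (of_nat (m choose s)) (act' (m + n - s) (nprod C s x y) p)) +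
          act' n (nprod C m x y) p"
        unfolding act_assoc[OF xy] M'.act_assoc[OF xy]
          split[of "\<lambda>s r. act r (nprod C s x y) p"] split[of "\<lambda>s r. act' r (nprod C s x y) p"] .
      moreover have "(\<Sum>s<m. smult (of_nat (m choose s)) (act (m + n - s) (nprod C s x y) p)) =
          (\<Sum>s<m. smult (of_nat (m choose s)) (act' (m + n - s) (nprod C s x y) p))"
        by (intro sum.cong refl) (simp add: less)
      ultimately show ?case by simp
    qed
    then show ?thesis using xy by (simp add: S_def)
  qed
  moreover have "add C x y \<in> S" "smul C k x \<in> S" "der C x \<in> S" if "x \<in> S" "y \<in> S" for x y k
    using that by (auto simp: S_def act_add_left M'.act_add_left act_smul_left M'.act_smul_left act_der M'.act_der)
  moreover have "S \<subseteq> carr C" by (auto simp: S_def)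
  ultimately have "S = carr C"
    by (intro gen[unfolded generated_by_def, rule_format] conjI ballI allI)
  then show ?thesis using a by (auto simp: S_def)
qed

text \<open>The class for \<open>\<Delta> = 1\<close> is the image of the 1-cocycle \<open>\<tau>\<close>, \<open>v \<mapsto> u\<close>, under the connecting
  map of the self-extension of the module given by the deformation \<open>\<Delta> = 1 + \<epsilon>\<close>.\<close>

lemma (in conf_mod) ex_class:
  assumes U: "is_U3 C v" and M: "M0Delta_action act v 1"
  obtains \<Phi> where "null_cocycle C act \<Phi>" "\<And>n. \<Phi> n v v = (if n = 1 then 1 else 0)"
proof -
  have v: "v \<in> carr C" and gen: "generated_by C v" using U by (auto simp: is_U3_def U3_rel_def)
  \<comment> \<open>For the zero cocycle a splitting is a map of modules. The lift by 1 satisfies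
    the relation precisely because the first action of \<open>v\<close> on 1 is \<Delta> =
    1.\<close>
  interpret Z: null_cocycle C act "\<lambda>_ _ _. 0"
    by unfold_locales simp_all
  have one: "act 1 v 1 = 1" "\<And>n. n \<ge> 2 \<Longrightarrow> act n v 1 = 0"
    using M by (auto simp: M0Delta_action_def one_pCons)
  have high: "act n v 1 + 0 = 0" if "n \<ge> 3" for n using one(2)[of n] that by simp
  have rel: "smult 2 (act 1 v 1 + 0) - polyX * (act 2 v 1 + 0) = smult 2 1"
    using one(1) one(2)[of 2] by (simp del: One_nat_def)
  obtain \<tau> where \<tau>: "\<tau> v = 1"
    "\<And>a b. a \<in> carr C \<Longrightarrow> b \<in> carr C \<Longrightarrow> \<tau> (add C a b) = \<tau> a + \<tau> b"
    "\<And>k a. a \<in> carr C \<Longrightarrow> \<tau> (smul C k a) = smult k (\<tau> a)"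
    "\<And>a. a \<in> carr C \<Longrightarrow> \<tau> (der C a) = polyX * \<tau> a"
    "\<And>n a b. a \<in> carr C \<Longrightarrow> b \<in> carr C \<Longrightarrow> \<tau> (nprod C n a b) = act n a (\<tau> b) + 0"
  proof (rule Z.splitting[OF U high rel], goal_cases)
    case (2 t)
    show ?case by (rule 2(1)) (fact 2)+
  qed
  obtain f where f: "conf_hom C cend f" "f v = gen"
    using is_U3_lift[OF U assoc_confalg_cend U3_rel_cend] by blast
  note hom = f(1)[unfolded conf_hom_def cend_simps, THEN conjunct2]
  note f' = hom[THEN conjunct1, rule_format] hom[THEN conjunct2, THEN conjunct1, rule_format]
    hom[THEN conjunct2, THEN conjunct2, THEN conjunct1, rule_format]
    hom[THEN conjunct2, THEN conjunct2, THEN conjunct2, rule_format]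
  have "conf_module C (\<lambda>n a. comp 0 n (f a))"
    unfolding conf_module_def
    by (intro conjI allI ballI)
      (simp_all only: f' comp_add_right comp_smult_right comp_add_left comp_smult_left comp_finite
        comp_der comp_polyX comp_0_assoc)
  then have act: "act n a p = comp 0 n (f a) p" if "a \<in> carr C" for n a p
  proof (rule conf_module_unique[OF _ gen v _ that])
    have zero: "act 0 v 1 = polyX" using M by (simp add: M0Delta_action_def)
    show "act n v 1 = comp 0 n (f v) 1" for n
    proof -
      consider "n = 0" | "n = 1" | "n \<ge> 2" by linarith
      then show ?thesis
        unfolding f(2) comp_gen_one by cases (simp_all add: zero one[unfolded One_nat_def])
    qed
  qed
  show ?thesis
  proof (rule that[of "\<lambda>n a b. comp 1 n (f a) (\<tau> b)"])
    show "null_cocycle C act (\<lambda>n a b. comp 1 n (f a) (\<tau> b))"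
    proof unfold_locales
      fix a b c n m assume "a \<in> carr C" "b \<in> carr C" "c \<in> carr C"
      then show "act n a (comp 1 m (f b) (\<tau> c)) + comp 1 n (f a) (\<tau> (nprod C m b c)) =
          (\<Sum>s\<le>n. smult (of_nat (n choose s)) (comp 1 (n + m - s) (f (nprod C s a b)) (\<tau> c)))"
        by (simp only: act \<tau>(5) f' add_0_right comp_1_assoc)
    qed (simp_all only: f' \<tau> comp_add_right comp_smult_right comp_add_left comp_smult_left comp_finite
        comp_der comp_polyX)
    show "comp 1 n (f v) (\<tau> v) = (if n = 1 then 1 else 0)" for n
      by (simp only: f(2) \<tau>(1) comp_gen_one)
  qed
qed

section \<open>Linear combinations of cocycles and the dimension count\<close>

lemma null_cocycle_diff_smult:
  assumes "null_cocycle C act \<Phi>" "null_cocycle C act \<Psi>"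
  shows "null_cocycle C act (\<lambda>n a b. \<Phi> n a b - smult c (\<Psi> n a b))"
proof -
  interpret A: null_cocycle C act \<Phi> by fact
  interpret B: null_cocycle C act \<Psi> by fact
  have act_diff: "act n a (p - smult c q) = act n a p - smult c (act n a q)" if "a \<in> carr C" for n a p q
    using A.act_add[OF that, of n p "smult (- c) q"] A.act_smult[OF that, of n "- c" q] by simp
  show ?thesis
  proof unfold_locales
    fix a b c' n m
    assume a: "a \<in> carr C" and b: "b \<in> carr C"
    show "finite {n. \<Phi> n a b - smult c (\<Psi> n a b) \<noteq> 0}"
      by (rule finite_subset[OF _ finite_UnI[OF A.coc_finite[OF a b] B.coc_finite[OF a b]]]) auto
    assume c': "c' \<in> carr C"
    show "act n a (\<Phi> m b c' - smult c (\<Psi> m b c')) +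
        (\<Phi> n a (nprod C m b c') - smult c (\<Psi> n a (nprod C m b c'))) =
        (\<Sum>s\<le>n. smult (of_nat (n choose s))
          (\<Phi> (n + m - s) (nprod C s a b) c' - smult c (\<Psi> (n + m - s) (nprod C s a b) c')))"
      using A.coc_assoc[OF a b c', of n m] arg_cong[OF B.coc_assoc[OF a b c', of n m], of "smult c"]
      by (simp add: act_diff a smult_diff_right sum_subtractf smult_sum_right smult_add_right
          mult.commute algebra_simps)
  qed (simp_all add: A.coc_add_left B.coc_add_left A.coc_add_right B.coc_add_right A.coc_smul_left
      B.coc_smul_left A.coc_smul_right B.coc_smul_right A.coc_der_left B.coc_der_left
      A.coc_der_right B.coc_der_right smult_diff_right smult_add_right mult.commute algebra_simps)
qed

lemma (in conf_mod) reduces_to_diff_smult: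
  assumes "reduces_to \<phi> \<Phi>" "reduces_to \<psi> \<Psi>" "null_bilinear C act \<Phi>" "null_bilinear C act \<Psi>"
  shows "reduces_to (\<lambda>as ls. \<phi> as ls - smult c (\<psi> as ls)) (\<lambda>n a b. \<Phi> n a b - smult c (\<Psi> n a b))"
proof -
  interpret A: null_bilinear C act \<Phi> by fact
  interpret B: null_bilinear C act \<Psi> by fact
  have "gsum (\<lambda>n. \<Phi> n a b - smult c (\<Psi> n a b)) l =
      gsum (\<lambda>n. \<Phi> n a b) l - smult c (gsum (\<lambda>n. \<Psi> n a b) l)" if a: "a \<in> carr C" and b: "b \<in> carr C" for a b l
  proof -
    have "finite {n. smult (- c) (\<Psi> n a b) \<noteq> 0}"
      by (rule finite_subset[OF _ B.coc_finite[OF a b]]) auto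
    from gsum_add[OF A.coc_finite[OF a b] this, of l] show ?thesis
      using gsum_smult[OF B.coc_finite[OF a b], of "- c" l] by simp
  qed
  then show ?thesis using assms(1,2) by (simp add: reduces_to_def)
qed

lemma (in null_cocycle) red_coboundary_of_splitting:
  assumes U: "is_U3 C v" and \<phi>: "cochain C 2 \<phi>" and red: "reduces_to \<phi> \<Phi>"
    and high: "\<And>n. n \<ge> 3 \<Longrightarrow> act n v q + \<Phi> n v v = 0"
    and rel: "smult 2 (act 1 v q + \<Phi> 1 v v) - polyX * (act 2 v q + \<Phi> 2 v v) = smult 2 q"
  shows "\<phi> \<in> red_coboundaries C act 1"
proof -
  obtain t where t: "t v = q"
    "\<And>a b. a \<in> carr C \<Longrightarrow> b \<in> carr C \<Longrightarrow> t (add C a b) = t a + t b"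
    "\<And>k a. a \<in> carr C \<Longrightarrow> t (smul C k a) = smult k (t a)"
    "\<And>a. a \<in> carr C \<Longrightarrow> t (der C a) = polyX * t a"
    "\<And>n a b. a \<in> carr C \<Longrightarrow> b \<in> carr C \<Longrightarrow> t (nprod C n a b) = act n a (t b) + \<Phi> n a b"
  proof (rule splitting[OF U high rel], goal_cases)
    case (2 t)
    show ?case by (rule 2(1)) (fact 2)+
  qed
  have act_minus: "act n a (- p) = - act n a p" if "a \<in> carr C" for n a p
    using act_smult[OF that, of n "- 1" p] by simp
  \<comment> \<open>The splitting expresses \<open>\<Phi>\<close> as t(a_(n) b) - a_(n) t(b), which
    is the coboundary of -t.\<close>
  show ?thesis
    by (rule red_coboundaryI[OF \<phi> red, of "\<lambda>a. - t a"]) (simp_all add: t act_minus)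
qed

text \<open>Comparing the two sides at \<open>(\<lambda>\<^sub>1, \<lambda>\<^sub>2) = (1, 0)\<close> and \<open>(0, 1)\<close> already separates the class
  from the coboundaries.\<close>

lemma (in null_cocycle) class_nontrivial:
  assumes U: "U3_rel C v" and M: "M0Delta_action act v 1"
    and \<Phi>: "\<And>n. \<Phi> n v v = (if n = 1 then 1 else 0)"
    and B: "(\<lambda>as ls. smult c (basic as ls)) \<in> red_coboundaries C act 1"
  shows "c = 0"
proof -
  have v: "v \<in> carr C" using U by (simp add: U3_rel_def)
  obtain \<psi> \<chi> where \<psi>: "cochain C 1 \<psi>"
    and eq: "(\<lambda>as ls. smult c (basic as ls)) = (\<lambda>as ls. hdiff C act 1 \<psi> as ls + cdel \<chi> as ls)"
    using B unfolding red_coboundaries_def by blast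
  note psi = cochain_add[OF \<psi>, of "[_]" 0, simplified] cochain_smul[OF \<psi>, of "[_]" 0, simplified]
    cochain_der[OF \<psi>, of "[_]" 0 _ "[_]", simplified]
  define p where "p a l = poly (\<psi> [a] [l]) (- l)" for a l
  define e0 e1 e2 where "e0 = nprod C 0 v v" and "e1 = nprod C 1 v v" and "e2 = nprod C 2 v v"
  have e: "e0 \<in> carr C" "e1 \<in> carr C" "e2 \<in> carr C" using v by (simp_all add: e0_def e1_def e2_def)
  have z: "nprod C s v v = zer C" if "s \<ge> 3" for s using U that by (simp add: U3_rel_def)
  have psi0: "\<psi> [zer C] [l] = 0" for l using psi(2)[of "zer C" "zer C" 0 "[l]"] by simp
  have rel: "add C (smul C 2 e1) (smul C (-1) (der C e2)) = smul C 2 v"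
    using U by (simp add: U3_rel_def e1_def e2_def)
  have "smult 2 (\<psi> [e1] [l]) + smult l (\<psi> [e2] [l]) = smult 2 (\<psi> [v] [l])" for l
    using arg_cong[OF rel, of "\<lambda>x. \<psi> [x] [l]"] e v psi(1)[of v "smul C 2 e1" "smul C (-1) (der C e2)" "[l]"]
    by (simp add: psi)
  from arg_cong[OF this, of "\<lambda>q. poly q x" for x]
  have e1: "2 * p e1 l = 2 * p v l - l * p e2 l" for l
    by (simp add: p_def algebra_simps eq_diff_eq)
  have lpr: "\<psi> [lprod C l v v] [m] =
      \<psi> [e0] [m] + smult l (\<psi> [e1] [m]) + smult (l ^ 2 / 2) (\<psi> [e2] [m])" for l m
  proof -
    have "\<psi> [lprod C l v v] [m] = gsum (\<lambda>n. \<psi> [nprod C n v v] [m]) l"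
      by (rule lprod_hom[OF v v]) (use psi0 psi v in auto)
    also have "\<dots> = (\<Sum>n<3. smult (l ^ n / fact n) (\<psi> [nprod C n v v] [m]))"
      by (rule gsum_eq) (simp add: z psi0)
    finally show ?thesis by (simp add: eval_nat_numeral e0_def e1_def e2_def)
  qed
  have act1: "poly (lact act l v 1) x = x + l" for l x
  proof -
    have "lact act l v 1 = (\<Sum>n<2. smult (l ^ n / fact n) (act n v 1))"
      unfolding lact_eq_gsum by (rule gsum_eq) (use M in \<open>simp add: M0Delta_action_def\<close>)
    then show ?thesis using M by (simp add: M0Delta_action_def eval_nat_numeral)
  qed
  have lam: "lam v v l = [:l:]" for l
  proof -
    have "lam v v l = (\<Sum>n<2. smult (l ^ n / fact n) (\<Phi> n v v))"
      unfolding lam_def by (rule gsum_eq) (simp add: \<Phi>)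
    then show ?thesis by (simp add: \<Phi> eval_nat_numeral)
  qed
  \<comment> \<open>Evaluation at \<partial> = -l - m removes \<open>cdel \<chi>\<close>; there
    \<partial> + l, the action of \<open>v\<close> on 1, equals -m.\<close>
  have main: "c * l = - m * p v m - (p e0 (l + m) + l * p e1 (l + m) + l ^ 2 / 2 * p e2 (l + m))" for l m
  proof -
    have "smult c (basic [v, v] [l, m]) = hdiff C act 1 \<psi> [v, v] [l, m] + cdel \<chi> [v, v] [l, m]"
      using fun_cong[OF fun_cong[OF eq, of "[v, v]"], of "[l, m]"] .
    from arg_cong[OF this, of "\<lambda>q. poly q (- (l + m))"] show ?thesis
      using v by (simp add: hdiff_1[OF v v, unfolded One_nat_def] basic_def lam cdel_def lpr
          poly_lact[OF v, of l "\<psi> [v] [m]"] act1 p_def algebra_simps)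
  qed
  \<comment> \<open>By the relation both right-hand sides become -(\<open>p v 1\<close> +
    \<open>p e0 1\<close>), while the left-hand sides are \<open>c\<close> at (1, 0) and 0 at (0,
    1).\<close>
  have "p e1 1 = p v 1 - p e2 1 / 2" using e1[of 1] by (simp add: field_simps)
  with main[of 1 0] main[of 0 1] show "c = 0"
    by (simp add: algebra_simps)
qed

theorem theorem4p4:
  fixes C :: "('k::field_char_0, 'c) confalg" and v :: 'c
    and act :: "nat \<Rightarrow> 'c \<Rightarrow> 'k poly \<Rightarrow> 'k poly" and \<Delta> :: 'k
  assumes "is_U3 C v"
    and "conf_module C act"
    and "M0Delta_action act v \<Delta>"
    and "\<Delta> \<noteq> 0"
  shows "H2_dim_is C act (if \<Delta> = 1 then 1 else 0)"
proof -
  have U: "U3_rel C v" and "assoc_confalg C" using assms(1) by (auto simp: is_U3_def)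
  then interpret conf_mod C act using assms(2) by unfold_locales
  show ?thesis
  proof (cases "\<Delta> = 1")
    case False
    have "\<phi> \<in> red_coboundaries C act 1" if \<phi>: "\<phi> \<in> red_cocycles C act 2" for \<phi>
    proof -
      obtain \<Phi> where \<Phi>: "null_cocycle C act \<Phi>" "reduces_to \<phi> \<Phi>"
        by (rule red_cocycle_reduces[OF \<phi>])
      interpret null_cocycle C act \<Phi> by (rule \<Phi>(1))
      obtain q c where q: "\<And>m. m \<ge> 3 \<Longrightarrow> act m v q + \<Phi> m v v = 0"
        "smult 2 (act 1 v q + \<Phi> 1 v v) - polyX * (act 2 v q + \<Phi> 2 v v) = smult 2 (q + [:c:])"
        "\<Delta> \<noteq> 1 \<Longrightarrow> c = 0"
      proof (rule normal_form[OF U assms(3,4)], goal_cases)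
        case (1 q c)
        show ?case by (rule 1(1)) (fact 1)+
      qed
      show ?thesis
        by (rule red_coboundary_of_splitting[OF assms(1) _ \<Phi>(2) q(1)])
          (use \<phi> q(2,3) False in \<open>auto simp: red_cocycles_def\<close>)
    qed
    then show ?thesis
      using False unfolding H2_dim_is_def quot_dim_is_def by (intro exI[of _ "{}"]) simp
  next
    case True
    then have M: "M0Delta_action act v 1" using assms(3) by simp
    obtain \<Psi> where \<Psi>: "null_cocycle C act \<Psi>" "\<And>n. \<Psi> n v v = (if n = 1 then 1 else 0)"
    proof (rule ex_class[OF assms(1) M], goal_cases)
      case (1 \<Psi>)
      show ?case by (rule 1(1)) (fact 1)+
    qed
    interpret \<Psi>: null_cocycle C act \<Psi> by (rule \<Psi>(1))
    have "\<exists>c. (\<lambda>x y. \<phi> x y - smult c (\<Psi>.basic x y)) \<in> red_coboundaries C act 1"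
      if \<phi>: "\<phi> \<in> red_cocycles C act 2" for \<phi>
    proof -
      obtain \<Phi> where \<Phi>: "null_cocycle C act \<Phi>" "reduces_to \<phi> \<Phi>"
        by (rule red_cocycle_reduces[OF \<phi>])
      interpret \<Phi>: null_cocycle C act \<Phi> by (rule \<Phi>(1))
      obtain q c where q: "\<And>m. m \<ge> 3 \<Longrightarrow> act m v q + \<Phi> m v v = 0"
        "smult 2 (act 1 v q + \<Phi> 1 v v) - polyX * (act 2 v q + \<Phi> 2 v v) = smult 2 (q + [:c:])"
      proof (rule \<Phi>.normal_form[OF U assms(3,4)], goal_cases)
        case (1 q c)
        show ?case by (rule 1(1)) (fact 1)+
      qed
      \<comment> \<open>On \<open>(v, v)\<close> the class changes only the product of index 1, by a
        constant. Subtracting it \<open>c\<close> times removes exactly the excess 2 c from the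
        relation, so the same \<open>q\<close> now defines a splitting.\<close>
      interpret D: null_cocycle C act "\<lambda>n a b. \<Phi> n a b - smult c (\<Psi> n a b)"
        by (rule null_cocycle_diff_smult[OF \<Phi>(1) \<Psi>(1)])
      have "(\<lambda>x y. \<phi> x y - smult c (\<Psi>.basic x y)) \<in> red_coboundaries C act 1"
      proof (rule D.red_coboundary_of_splitting[OF assms(1)])
        show "cochain C 2 (\<lambda>x y. \<phi> x y - smult c (\<Psi>.basic x y))"
          using \<phi> by (intro cochain_diff_smult \<Psi>.cochain_basic) (auto simp: red_cocycles_def)
        show "reduces_to (\<lambda>x y. \<phi> x y - smult c (\<Psi>.basic x y)) (\<lambda>n a b. \<Phi> n a b - smult c (\<Psi> n a b))"
          by (intro reduces_to_diff_smult \<Phi>(2) \<Psi>.reduces_to_basic \<Phi>.null_bilinear_axioms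
              \<Psi>.null_bilinear_axioms)
        show "act m v q + (\<Phi> m v v - smult c (\<Psi> m v v)) = 0" if "m \<ge> 3" for m
          using q(1)[OF that] that by (simp add: \<Psi>(2))
        have "smult 2 (act 1 v q + (\<Phi> 1 v v - [:c:])) - polyX * (act 2 v q + \<Phi> 2 v v) =
            smult 2 (act 1 v q + \<Phi> 1 v v) - polyX * (act 2 v q + \<Phi> 2 v v) - smult 2 [:c:]"
          by (simp only: smult_add_right smult_diff_right algebra_simps)
        then show "smult 2 (act 1 v q + (\<Phi> 1 v v - smult c (\<Psi> 1 v v))) -
            polyX * (act 2 v q + (\<Phi> 2 v v - smult c (\<Psi> 2 v v))) = smult 2 q"
          unfolding q(2) by (simp add: \<Psi>(2) one_pCons smult_add_right del: One_nat_def)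
      qed
      then show ?thesis ..
    qed
    moreover have "c = 0" if "(\<lambda>x y. smult c (\<Psi>.basic x y)) \<in> red_coboundaries C act 1" for c
      by (rule \<Psi>.class_nontrivial[OF U M \<Psi>(2) that])
    ultimately show ?thesis
      using True \<Psi>.basic_red_cocycle unfolding H2_dim_is_def quot_dim_is_def
      by (intro exI[of _ "{\<Psi>.basic}"]) (auto intro: exI[of _ "\<lambda>_. _"])
  qed
qed

end
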